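(* Let $d\ge2$, let $f:\mathbb{R}\to\mathbb{R}^d$ be a smooth flux satisfying (ND), and let $u_+<u_-$ be real numbers such that $A(u_-,u_+)\ne\{0\}$. Let $v=v(u_-,u_+)$. Then every entropy solution of $\partial_tu+\mathrm{div}_xf(u)=0$ ($t>0$, $x\in\mathbb{R}^d$) which takes values in $\{u_-,u_+\}$ almost everywhere is stationary in the frame moving with velocity $v$, that is, it has the form $(t,x)\mapsto u(x-tv)$ for some $u:\mathbb{R}^d\to\{u_-,u_+\}$, and (up to null sets) $u$ is of one of the following forms: (Constants) either $u\equiv u_-$ in $\mathbb{R}^d$, or $u\equiv u_+$ in $\mathbb{R}^d$; (Shocks) a complete Lipschitz hypersurface $\Gamma$, whose normals (oriented towards $D_+$, at almost every point) belong to $A(u_-,u_+)$, separates $\mathbb{R}^d$ into two halves $D_\pm$, on which $u\equiv u_\pm$ respectively; in particular $\Gamma$ is a graph in suitable linear coordinates. In the latter case, for every interior point $W$ of $A(u_-,u_+)^\circ$, the family $(D_-+sW)_{s\in\mathbb{R}}$ is ordered by inclusion and $$\bigcap_{s\in\mathbb{R}}(D_-+sW)=\emptyset,\qquad\bigcup_{s\in\mathbb{R}}(D_-+sW)=\mathbb{R}^d.$$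
   Context: Entropy solutions are in Kruzhkov's sense: $\partial_t|u-k|+\mathrm{div}_x(\mathrm{sgn}(u-k)(f(u)-f(k)))\le0$ in the distributional sense for every $k\in\mathbb{R}$. (ND): for every $(\tau,\xi)\in\mathbb{R}\times\mathbb{R}^d$ with $(\tau,\xi)\ne(0,0)$, the set $\{s\in\mathbb{R}:\tau+f'(s)\cdot\xi=0\}$ has Lebesgue measure zero. $v(u_-,u_+)=\frac{f(u_+)-f(u_-)}{u_+-u_-}$; $F(s)=f(s)-s\,v(u_-,u_+)$, so that $F(u_+)=F(u_-)=:\bar F$. The closed convex cone of admissible directions is $A(u_-,u_+)=\{\xi\in\mathbb{R}^d:\ \xi\cdot F(s)\le\xi\cdot\bar F\ \ \forall s\in(u_+,u_-)\}$, and its dual cone is $A(u_-,u_+)^\circ=\{n\in\mathbb{R}^d:\ n\cdot\xi\ge0\ \ \forall\xi\in A(u_-,u_+)\}$. *)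

theory Defs
  imports "HOL-Analysis.Analysis"
begin

text \<open>Conventions: \<open>um\<close>, \<open>up\<close> are the states \<open>u\<^sub>-\<close>, \<open>u\<^sub>+\<close>. Functions of time and space live on
  \<open>real \<times> real ^ 'd\<close>, and only their restriction to positive times is meaningful.\<close>

subsection \<open>Smooth functions and entropy solutions\<close>

text \<open>Class \<open>C\<^sup>n\<close>: the iterated directional derivatives of order less than \<open>n\<close> are Frechet differentiable,
  and those of order \<open>n\<close> are continuous.\<close>

primrec Cn :: "nat \<Rightarrow> ('a::euclidean_space \<Rightarrow> 'b::euclidean_space) \<Rightarrow> bool" where
  "Cn 0 g \<longleftrightarrow> continuous_on UNIV g"
| "Cn (Suc n) g \<longleftrightarrow> (\<forall>x. g differentiable (at x)) \<and>
     (\<forall>w. Cn n (\<lambda>x. frechet_derivative g (at x) w))"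

definition smooth :: "('a::euclidean_space \<Rightarrow> 'b::euclidean_space) \<Rightarrow> bool" where
  "smooth g \<longleftrightarrow> (\<forall>n. Cn n g)"

definition half_space_time :: "(real \<times> (real ^ 'd)) set" where
  "half_space_time = {0<..} \<times> UNIV"

definition test_function :: "(real \<times> (real ^ 'd) \<Rightarrow> real) \<Rightarrow> bool" where
  "test_function \<phi> \<longleftrightarrow> smooth \<phi> \<and> compact (closure {z. \<phi> z \<noteq> 0}) \<and>
     closure {z. \<phi> z \<noteq> 0} \<subseteq> half_space_time"

text \<open>Below, \<open>frechet_derivative \<phi> (at z) (1, 0)\<close> is the time derivative of \<open>\<phi>\<close>, and
  \<open>frechet_derivative \<phi> (at z) (0, w)\<close> is the inner product of \<open>w\<close> with the space gradient of \<open>\<phi>\<close>.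
  The inequality is reversed by the integration by parts. Solutions are taken in \<open>L\<^sup>\<infinity>\<close>, so that the
  integrand is always integrable.\<close>

definition entropy_solution ::
    "(real \<Rightarrow> real ^ 'd) \<Rightarrow> (real \<times> (real ^ 'd) \<Rightarrow> real) \<Rightarrow> bool" where
  "entropy_solution f u \<longleftrightarrow>
     u \<in> borel_measurable (lebesgue_on half_space_time) \<and>
     (\<exists>M. AE z in lebesgue_on half_space_time. \<bar>u z\<bar> \<le> M) \<and>
     (\<forall>k \<phi>. test_function \<phi> \<longrightarrow> (\<forall>z. \<phi> z \<ge> 0) \<longrightarrow>
       (LINT z|lebesgue_on half_space_time.
          \<bar>u z - k\<bar> * frechet_derivative \<phi> (at z) (1, 0) +
          frechet_derivative \<phi> (at z) (0, sgn (u z - k) *\<^sub>R (f (u z) - f k))) \<ge> 0)"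

definition nondegenerate :: "(real \<Rightarrow> real ^ 'd) \<Rightarrow> bool" where
  "nondegenerate f \<longleftrightarrow> (\<forall>\<tau> \<xi>. (\<tau>, \<xi>) \<noteq> (0, 0) \<longrightarrow>
     {s. \<tau> + vector_derivative f (at s) \<bullet> \<xi> = 0} \<in> null_sets lebesgue)"

subsection \<open>Admissible directions\<close>

definition shock_velocity :: "(real \<Rightarrow> real ^ 'd) \<Rightarrow> real \<Rightarrow> real \<Rightarrow> real ^ 'd" where
  "shock_velocity f um up = (f up - f um) /\<^sub>R (up - um)"

definition moving_flux :: "(real \<Rightarrow> real ^ 'd) \<Rightarrow> real \<Rightarrow> real \<Rightarrow> real \<Rightarrow> real ^ 'd" where
  "moving_flux f um up s = f s - s *\<^sub>R shock_velocity f um up"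

text \<open>The common value of the moving flux at \<open>um\<close> and \<open>up\<close> is written as its value at \<open>up\<close>.\<close>

definition admissible_cone :: "(real \<Rightarrow> real ^ 'd) \<Rightarrow> real \<Rightarrow> real \<Rightarrow> (real ^ 'd) set" where
  "admissible_cone f um up =
     {\<xi>. \<forall>s\<in>{up<..<um}. \<xi> \<bullet> moving_flux f um up s \<le> \<xi> \<bullet> moving_flux f um up up}"

definition dual_cone :: "(real ^ 'd) set \<Rightarrow> (real ^ 'd) set" where
  "dual_cone A = {n. \<forall>\<xi>\<in>A. n \<bullet> \<xi> \<ge> 0}"

subsection \<open>Lipschitz hypersurfaces\<close>

text \<open>The graph of \<open>g\<close> over the hyperplane orthogonal to \<open>n\<close>, with values measured along the axis
  \<open>e\<close>. If \<open>n \<bullet> e \<noteq> 0\<close>, these are linear coordinates on the whole space.\<close>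

definition graph_over ::
    "real ^ 'd \<Rightarrow> real ^ 'd \<Rightarrow> (real ^ 'd \<Rightarrow> real) \<Rightarrow> (real ^ 'd) set" where
  "graph_over n e g = {y + g y *\<^sub>R e | y. n \<bullet> y = 0}"

definition lipschitz_hypersurface :: "(real ^ 'd) set \<Rightarrow> bool" where
  "lipschitz_hypersurface \<Gamma> \<longleftrightarrow>
     (\<forall>p\<in>\<Gamma>. \<exists>e g L U. norm e = 1 \<and> L-lipschitz_on {y. e \<bullet> y = 0} g \<and>
        open U \<and> p \<in> U \<and> \<Gamma> \<inter> U = graph_over e e g \<inter> U)"

definition lipschitz_graph_in_linear_coordinates :: "(real ^ 'd) set \<Rightarrow> bool" where
  "lipschitz_graph_in_linear_coordinates \<Gamma> \<longleftrightarrow>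
     (\<exists>n e g L. n \<bullet> e \<noteq> 0 \<and> L-lipschitz_on {y. n \<bullet> y = 0} g \<and> \<Gamma> = graph_over n e g)"

definition separates_into ::
    "(real ^ 'd) set \<Rightarrow> (real ^ 'd) set \<Rightarrow> (real ^ 'd) set \<Rightarrow> bool" where
  "separates_into \<Gamma> Dm Dp \<longleftrightarrow> Dm \<noteq> Dp \<and> components (- \<Gamma>) = {Dm, Dp} \<and>
     frontier Dm = \<Gamma> \<and> frontier Dp = \<Gamma>"

text \<open>\<open>n\<close> is the unit normal at \<open>p\<close>, oriented from \<open>Dm\<close> towards \<open>Dp\<close>, of the common boundary of the
  disjoint sets \<open>Dm\<close> and \<open>Dp\<close>: up to an error that is small compared with the distance to \<open>p\<close>, the
  two sets are the two sides of the hyperplane through \<open>p\<close> orthogonal to \<open>n\<close>. For the two sides of a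
  Lipschitz graph, this says that the graph is differentiable over \<open>p\<close>.\<close>

definition oriented_normal ::
    "(real ^ 'd) set \<Rightarrow> (real ^ 'd) set \<Rightarrow> real ^ 'd \<Rightarrow> real ^ 'd \<Rightarrow> bool" where
  "oriented_normal Dm Dp p n \<longleftrightarrow> norm n = 1 \<and>
     (\<forall>\<epsilon>>0. \<exists>\<delta>>0. \<forall>x\<in>ball p \<delta>.
        (n \<bullet> (x - p) > \<epsilon> * norm (x - p) \<longrightarrow> x \<in> Dp) \<and>
        (n \<bullet> (x - p) < - \<epsilon> * norm (x - p) \<longrightarrow> x \<in> Dm))"

text \<open>The \<open>m\<close>-dimensional Hausdorff outer measure for \<open>m \<ge> 1\<close>, without normalising constant. (For
  \<open>m = 0\<close> the convention \<open>0 ^ 0 = 1\<close> would wrongly count empty sets of the covering.)\<close>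

definition hausdorff_measure :: "nat \<Rightarrow> 'a::metric_space set \<Rightarrow> ennreal" where
  "hausdorff_measure m S = (SUP \<delta>\<in>{(0::real)<..}.
     INF C\<in>{C. S \<subseteq> (\<Union>i::nat. C i) \<and> (\<forall>i. bounded (C i) \<and> diameter (C i) \<le> \<delta>)}.
       \<Sum>i. ennreal (diameter (C i) ^ m))"

end

theory Submission
  imports Defs
begin

text \<open>
  A solution with the two values \<open>u\<^sub>-\<close> and \<open>u\<^sub>+\<close> is described by the set \<open>E\<close> where it equals \<open>u\<^sub>-\<close>, and
  Kruzhkov's inequalities are linear in the indicator of \<open>E\<close>. The levels \<open>k = u\<^sub>\<plusminus>\<close> say that the
  indicator is transported with velocity \<open>v\<close>, so it is a function of \<open>x - t v\<close>; let \<open>E\<^sub>0\<close> be its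
  profile. The levels \<open>k\<close> in between, combined with the transport equation, say that the indicator of
  \<open>E\<^sub>0\<close> is nonincreasing in the direction \<open>F(u\<^sub>+) - F(k)\<close>. Testing against translated cutoffs turns both
  statements into inclusions of \<open>E\<close> and its translates up to null sets
  (\<open>two_state_entropy_solution_profile\<close>).

  Monotonicity passes from the vectors \<open>F(u\<^sub>+) - F(k)\<close> to the convex cone \<open>C\<close> that they generate. By
  the bipolar theorem the closure of \<open>C\<close> is the dual of the cone of admissible directions, and by
  nondegeneracy \<open>C\<close> has interior points. Let \<open>K\<close> be the interior of \<open>C\<close>, and let \<open>D\<^sub>-\<close> and \<open>D\<^sub>+\<close> be the
  open sets of points near which \<open>E\<^sub>0\<close> has full, respectively zero, measure. A Fubini argument shows
  that \<open>x - K \<subseteq> D\<^sub>-\<close> whenever \<open>x \<notin> D\<^sub>+\<close>, and \<open>x + K \<subseteq> D\<^sub>+\<close> whenever \<open>x \<notin> D\<^sub>-\<close>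
  (\<open>cone_monotone_set_separates\<close>). Hence the rest \<open>\<Gamma>\<close> is either empty, which gives the constant
  solutions, or meets every line in a direction \<open>e \<in> K\<close> exactly once, and two points of \<open>\<Gamma>\<close> never
  differ by a vector of \<open>K\<close>: this is a Lipschitz graph over the hyperplane orthogonal to \<open>e\<close>. The
  statements about translates of \<open>D\<^sub>-\<close> follow from the same two inclusions.

  It remains to find normals almost everywhere on \<open>\<Gamma>\<close>. With \<open>\<Phi> x\<close> the signed distance from \<open>x\<close> to
  \<open>\<Gamma>\<close> along \<open>e\<close>, the surface is the zero set of a Lipschitz function on the whole space that
  satisfies \<open>\<Phi> (x + t e) = \<Phi> x - t\<close>. A derivative of \<open>\<Phi>\<close> at a point of \<open>\<Gamma>\<close> is a normal, and it is
  admissible because \<open>\<Phi>\<close> decreases along \<open>K\<close>. By \<open>Rademacher\<close>, \<open>\<Phi>\<close> is differentiable off a null set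
  of the whole space. This null set is a cylinder with axis \<open>e\<close>, and averaging coverings by small
  cubes over the sections of the cylinder shows that its trace on \<open>\<Gamma>\<close> is null for the Hausdorff
  measure of codimension one (\<open>cylinder_image_hausdorff_null\<close>).
\<close>

section \<open>Smooth functions with compact support\<close>

lemma Cn_imp_continuous_on: "Cn n g \<Longrightarrow> continuous_on UNIV g"
  by (cases n) (auto intro!: differentiable_imp_continuous_on simp: differentiable_on_def
      differentiable_at_withinI)

lemma Cn_SucD: "Cn (Suc n) g \<Longrightarrow> Cn n g"
proof (induction n arbitrary: g)
  case 0
  then show ?case using Cn_imp_continuous_on[OF 0] by simp
qed auto

lemma Cn_const: "Cn n (\<lambda>x. c)"
proof (induction n arbitrary: c)
  case (Suc n)
  have "frechet_derivative (\<lambda>x. c) (at x) = (\<lambda>w. 0)" for x :: 'a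
    by (rule frechet_derivative_at[symmetric]) (rule has_derivative_const)
  then show ?case using Suc by simp
qed simp

lemma Cn_add:
  fixes g h :: "'a::euclidean_space \<Rightarrow> real"
  shows "Cn n g \<Longrightarrow> Cn n h \<Longrightarrow> Cn n (\<lambda>x. g x + h x)"
proof (induction n arbitrary: g h)
  case 0
  then show ?case by (simp add: continuous_on_add)
next
  case (Suc n)
  have d: "frechet_derivative (\<lambda>x. g x + h x) (at x)
      = (\<lambda>w. frechet_derivative g (at x) w + frechet_derivative h (at x) w)" for x
    by (rule frechet_derivative_at[symmetric], rule has_derivative_add)
      (use Suc.prems in \<open>auto simp: frechet_derivative_works[symmetric]\<close>)
  show ?case unfolding Cn.simps d
    using Suc by (auto intro!: differentiable_add)
qed

lemma Cn_mult:
  fixes g h :: "'a::euclidean_space \<Rightarrow> real"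
  shows "Cn n g \<Longrightarrow> Cn n h \<Longrightarrow> Cn n (\<lambda>x. g x * h x)"
proof (induction n arbitrary: g h)
  case 0
  then show ?case by (simp add: continuous_on_mult)
next
  case (Suc n)
  have d: "frechet_derivative (\<lambda>x. g x * h x) (at x)
      = (\<lambda>w. g x * frechet_derivative h (at x) w + frechet_derivative g (at x) w * h x)" for x
    by (rule frechet_derivative_at[symmetric], rule has_derivative_mult)
      (use Suc.prems in \<open>auto simp: frechet_derivative_works[symmetric]\<close>)
  have "Cn n g" "Cn n h" using Suc.prems by (auto intro: Cn_SucD)
  then show ?case unfolding Cn.simps d
    using Suc by (auto intro!: differentiable_mult Cn_add)
qed

lemma Cn_translate: "Cn n g \<Longrightarrow> Cn n (\<lambda>x. g (x - c))"
proof (induction n arbitrary: g)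
  case 0
  then show ?case by (auto intro!: continuous_on_compose2[of UNIV g] continuous_intros)
next
  case (Suc n)
  have d: "((\<lambda>x. g (x - c)) has_derivative frechet_derivative g (at (x - c))) (at x)" for x
  proof -
    have "(g has_derivative frechet_derivative g (at (x - c))) (at (x - c))"
      using Suc.prems frechet_derivative_works by auto
    moreover have "((\<lambda>x. x - c) has_derivative (\<lambda>w. w)) (at x)"
      by (auto intro!: derivative_eq_intros)
    ultimately show ?thesis using has_derivative_compose by blast
  qed
  then have d': "frechet_derivative (\<lambda>x. g (x - c)) (at x) = frechet_derivative g (at (x - c))" for x
    by (rule frechet_derivative_at[symmetric])
  show ?case unfolding Cn.simps d'
    using Suc d by (auto simp: differentiable_def)
qed

lemma smooth_const: "smooth (\<lambda>x. c)"
  and smooth_translate: "smooth h \<Longrightarrow> smooth (\<lambda>x. h (x - d))"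
  by (simp_all add: smooth_def Cn_const Cn_translate)

lemma
  fixes g h :: "'a::euclidean_space \<Rightarrow> real"
  shows smooth_add: "smooth g \<Longrightarrow> smooth h \<Longrightarrow> smooth (\<lambda>x. g x + h x)"
    and smooth_mult: "smooth g \<Longrightarrow> smooth h \<Longrightarrow> smooth (\<lambda>x. g x * h x)"
  by (simp_all add: smooth_def Cn_add Cn_mult)

lemma smooth_diff:
  fixes g h :: "'a::euclidean_space \<Rightarrow> real"
  assumes "smooth g" "smooth h"
  shows "smooth (\<lambda>x. g x - h x)"
  using smooth_add[OF assms(1) smooth_mult[OF smooth_const[of "-1"] assms(2)]] by simp

lemma smooth_prod:
  fixes g :: "'i \<Rightarrow> 'a::euclidean_space \<Rightarrow> real"
  assumes "\<And>i. i \<in> I \<Longrightarrow> smooth (g i)"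
  shows "smooth (\<lambda>x. \<Prod>i\<in>I. g i x)"
  using assms by (induction I rule: infinite_finite_induct) (auto intro: smooth_const smooth_mult)

text \<open>Differentiating \<open>p (1/t) * exp (-1/t)\<close> gives a function of the same form, with the
  polynomial \<open>s\<^sup>2 (p - p')\<close> in place of \<open>p\<close>; this closure property is the reason why the
  polynomial factor is carried along.\<close>

definition flat_exp :: "real poly \<Rightarrow> real \<Rightarrow> real" where
  "flat_exp p t = (if t > 0 then poly p (1/t) * exp (- (1/t)) else 0)"

lemma poly_over_exp_tendsto_0: "((\<lambda>s. poly p s * exp (- s)) \<longlongrightarrow> 0) (at_top :: real filter)"
proof -
  have "((\<lambda>s::real. \<Sum>i\<le>degree p. coeff p i * (s ^ i / exp s)) \<longlongrightarrow> (\<Sum>i\<le>degree p. coeff p i * 0)) at_top"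
    by (intro tendsto_intros tendsto_power_div_exp_0)
  then show ?thesis
    by (simp add: poly_altdef sum_distrib_right sum_divide_distrib exp_minus divide_inverse mult.assoc)
qed

lemma flat_exp_has_derivative:
  "(flat_exp p has_real_derivative flat_exp ([:0, 0, 1:] * (p - pderiv p)) t) (at t)"
proof (cases "t = 0")
  case True
  have "((\<lambda>h. flat_exp p h / h) \<longlongrightarrow> 0) (at 0)"
    unfolding filterlim_at_split
  proof (intro conjI)
    show "((\<lambda>h. flat_exp p h / h) \<longlongrightarrow> 0) (at_left 0)"
      by (rule tendsto_eventually) (auto simp: eventually_at_filter flat_exp_def)
    have "filterlim (\<lambda>h::real. 1 / h) at_top (at_right 0)"
      using filterlim_inverse_at_top_right by (simp add: inverse_eq_divide)
    from filterlim_compose[OF poly_over_exp_tendsto_0[of "[:0,1:] * p"] this]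
    show "((\<lambda>h. flat_exp p h / h) \<longlongrightarrow> 0) (at_right 0)"
      by (rule Lim_transform_eventually) (auto simp: eventually_at_filter flat_exp_def)
  qed
  then show ?thesis using True
    by (simp add: DERIV_def flat_exp_def)
next
  case False
  show ?thesis
  proof (cases "t > 0")
    case True
    have "((\<lambda>t. poly p (1/t) * exp (- (1/t))) has_real_derivative
        flat_exp ([:0, 0, 1:] * (p - pderiv p)) t) (at t)"
      using True
      by (auto intro!: derivative_eq_intros poly_DERIV[THEN DERIV_chain2]
          simp: flat_exp_def field_simps power2_eq_square)
    then show ?thesis
      by (rule has_field_derivative_transform_within_open[where S = "{0<..}"])
        (use True in \<open>auto simp: flat_exp_def\<close>)
  next
    case False
    then have "t < 0" using \<open>t \<noteq> 0\<close> by simp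
    have "((\<lambda>t. 0) has_real_derivative flat_exp ([:0, 0, 1:] * (p - pderiv p)) t) (at t)"
      using \<open>t < 0\<close> by (auto simp: flat_exp_def)
    then show ?thesis
      by (rule has_field_derivative_transform_within_open[where S = "{..<0}"])
        (use \<open>t < 0\<close> in \<open>auto simp: flat_exp_def\<close>)
  qed
qed

lemma smooth_flat_exp: "smooth (\<lambda>x::'a::euclidean_space. flat_exp p (a \<bullet> x + c))"
proof -
  have "Cn n (\<lambda>x. flat_exp p (a \<bullet> x + c))" for n
  proof (induction n arbitrary: p)
    case 0
    have "continuous_on UNIV (flat_exp p)"
      using flat_exp_has_derivative by (auto intro!: DERIV_continuous_on)
    then show ?case by (auto intro!: continuous_on_compose2[of UNIV "flat_exp p"] continuous_intros)
  next
    case (Suc n)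
    have d: "((\<lambda>x. flat_exp p (a \<bullet> x + c)) has_derivative
        (\<lambda>w. (a \<bullet> w) * flat_exp ([:0, 0, 1:] * (p - pderiv p)) (a \<bullet> x + c))) (at x)" for x
    proof -
      have "((\<lambda>x. a \<bullet> x + c) has_derivative (\<lambda>w. a \<bullet> w)) (at x)"
        by (auto intro!: derivative_eq_intros)
      from has_derivative_compose[OF this flat_exp_has_derivative[unfolded has_field_derivative_def]]
      show ?thesis by (simp add: mult.commute)
    qed
    then have d': "frechet_derivative (\<lambda>x. flat_exp p (a \<bullet> x + c)) (at x) =
        (\<lambda>w. (a \<bullet> w) * flat_exp ([:0, 0, 1:] * (p - pderiv p)) (a \<bullet> x + c))" for x
      by (rule frechet_derivative_at[symmetric])
    show ?case unfolding Cn.simps d' using d Suc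
      by (auto simp: differentiable_def simp del: mult_pCons_left intro!: Cn_mult Cn_const)
  qed
  then show ?thesis by (simp add: smooth_def)
qed

text \<open>Test functions on an arbitrary set \<open>H\<close> and in arbitrary dimension: they are used in half
  space-time for the entropy inequalities, and on the whole space for the linearity of derivatives.\<close>

definition cutoff :: "'a::euclidean_space set \<Rightarrow> ('a \<Rightarrow> real) \<Rightarrow> bool" where
  "cutoff H \<phi> \<longleftrightarrow> smooth \<phi> \<and> compact (closure {z. \<phi> z \<noteq> 0}) \<and> closure {z. \<phi> z \<noteq> 0} \<subseteq> H"

lemma cutoff_Cn: "cutoff H \<phi> \<Longrightarrow> Cn n \<phi>"
  by (simp add: cutoff_def smooth_def)

lemma cutoff_continuous_on: "cutoff H \<phi> \<Longrightarrow> continuous_on A \<phi>"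
  using cutoff_Cn[of H \<phi> 0] by (auto intro: continuous_on_subset)

lemma test_function_iff_cutoff: "test_function \<phi> \<longleftrightarrow> cutoff half_space_time \<phi>"
  by (simp add: test_function_def cutoff_def)

text \<open>With growing steepness \<open>m\<close> the bump tends to the indicator of the box.\<close>

definition box_bump :: "'a::euclidean_space \<Rightarrow> 'a \<Rightarrow> real \<Rightarrow> 'a \<Rightarrow> real" where
  "box_bump a b m x = (\<Prod>i\<in>Basis. flat_exp 1 (m * (x \<bullet> i - a \<bullet> i)) * flat_exp 1 (m * (b \<bullet> i - x \<bullet> i)))"

lemma flat_exp_1_bounds: "0 \<le> flat_exp 1 t" "flat_exp 1 t \<le> 1"
  by (auto simp: flat_exp_def)

lemma box_bump_bounds: "0 \<le> box_bump a b m x" "box_bump a b m x \<le> 1"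
  by (auto simp: box_bump_def intro!: prod_nonneg prod_le_1 mult_le_one mult_nonneg_nonneg flat_exp_1_bounds)

lemma smooth_box_bump: "smooth (box_bump a b m)"
proof -
  have "smooth (\<lambda>x. flat_exp 1 ((m *\<^sub>R i) \<bullet> x + (- m * (a \<bullet> i))) *
      flat_exp 1 (((- m) *\<^sub>R i) \<bullet> x + m * (b \<bullet> i)))" for i
    by (intro smooth_mult smooth_flat_exp)
  then have "smooth (\<lambda>x. \<Prod>i\<in>Basis. flat_exp 1 ((m *\<^sub>R i) \<bullet> x + (- m * (a \<bullet> i))) *
      flat_exp 1 (((- m) *\<^sub>R i) \<bullet> x + m * (b \<bullet> i)))"
    by (intro smooth_prod)
  moreover have "box_bump a b m = (\<lambda>x. \<Prod>i\<in>Basis. flat_exp 1 ((m *\<^sub>R i) \<bullet> x + (- m * (a \<bullet> i))) *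
      flat_exp 1 (((- m) *\<^sub>R i) \<bullet> x + m * (b \<bullet> i)))"
    by (auto simp: box_bump_def fun_eq_iff algebra_simps inner_commute)
  ultimately show ?thesis by simp
qed

lemma box_bump_outside: "m > 0 \<Longrightarrow> x \<notin> box a b \<Longrightarrow> box_bump a b m x = 0"
  unfolding box_bump_def mem_box
  by (subst prod_zero_iff) (auto simp: flat_exp_def zero_less_mult_iff)

lemma box_bump_tendsto_1:
  assumes "x \<in> box a b"
  shows "((\<lambda>n. box_bump a b (real (Suc n)) x) \<longlongrightarrow> 1) sequentially"
proof -
  have *: "((\<lambda>n. flat_exp 1 (real (Suc n) * t)) \<longlongrightarrow> 1) sequentially" if "t > 0" for t :: real
  proof -
    have "((\<lambda>n. exp (- (inverse t * inverse (real (Suc n))))) \<longlongrightarrow> exp (- (inverse t * 0))) sequentially"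
      by (intro tendsto_intros LIMSEQ_inverse_real_of_nat)
    moreover have "flat_exp 1 (real (Suc n) * t) = exp (- (inverse t * inverse (real (Suc n))))" for n
      using that by (simp add: flat_exp_def divide_inverse del: of_nat_Suc)
    ultimately show ?thesis by simp
  qed
  have "((\<lambda>n. box_bump a b (real (Suc n)) x) \<longlongrightarrow> (\<Prod>i\<in>(Basis::'a set). 1 * (1::real))) sequentially"
    unfolding box_bump_def
    by (intro tendsto_prod tendsto_mult *) (use assms in \<open>auto simp: mem_box\<close>)
  then show ?thesis by simp
qed

text \<open>If \<open>\<beta>\<^sub>j\<close> are bumps on countably many boxes with union \<open>U\<close>, then \<open>1 - \<Prod>\<^sub>j\<^sub><\<^sub>m (1 - \<beta>\<^sub>j)\<close> is a
  smooth function with values in \<open>[0, 1]\<close> that vanishes outside \<open>U\<close>. Steepening the bumps together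
  with \<open>m\<close> makes it converge to the indicator.\<close>

lemma cutoff_approximates_open:
  fixes U H :: "'a::euclidean_space set"
  assumes "open U" "bounded U" "closure U \<subseteq> H"
  obtains \<phi> :: "nat \<Rightarrow> 'a \<Rightarrow> real" where
    "\<And>m. cutoff H (\<phi> m)" "\<And>m x. 0 \<le> \<phi> m x" "\<And>m x. \<phi> m x \<le> 1"
    "\<And>m x. x \<notin> U \<Longrightarrow> \<phi> m x = 0"
    "\<And>x. (\<lambda>m. \<phi> m x) \<longlonglongrightarrow> indicator U x"
proof -
  obtain D where D: "countable D" "D \<subseteq> Pow U" "\<And>X. X \<in> D \<Longrightarrow> \<exists>a b. X = box a b" "\<Union> D = U"
    using open_countable_Union_open_box[OF \<open>open U\<close>] by metis
  \<comment> \<open>An empty box is added so that the boxes can be enumerated by \<open>nat\<close> even if \<open>U\<close> is empty.\<close>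
  define D' where "D' = insert {} D"
  have D': "countable D'" "D' \<noteq> {}" "\<Union> D' = U" "\<And>X. X \<in> D' \<Longrightarrow> \<exists>a b. X = box a b"
    using D by (auto simp: D'_def) (metis box_idem)
  have "\<exists>a b. from_nat_into D' j = box a b" for j
    by (rule D'(4)) (simp add: D'(2) from_nat_into)
  then obtain a b where ab: "\<And>j. from_nat_into D' j = box (a j) (b j)" by metis
  have U: "U = (\<Union>j. box (a j) (b j))"
    using D'(1-3) range_from_nat_into[of D'] by (simp add: ab)
  define \<theta> where "\<theta> j m x = 1 - box_bump (a j) (b j) (real (Suc m)) x" for j m x
  have \<theta>: "0 \<le> \<theta> j m x" "\<theta> j m x \<le> 1" for j m x
    using box_bump_bounds by (auto simp: \<theta>_def)
  define \<phi> where "\<phi> m x = 1 - (\<Prod>j<m. \<theta> j m x)" for m x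
  have "smooth (\<phi> m)" for m
    unfolding \<phi>_def \<theta>_def
    by (intro smooth_diff smooth_const smooth_prod smooth_box_bump)
  have 0: "0 \<le> \<phi> m x" "\<phi> m x \<le> 1" for m x
    unfolding \<phi>_def using \<theta> by (auto intro!: prod_le_1 prod_nonneg)
  have out: "\<phi> m x = 0" if "x \<notin> U" for m x
    using that unfolding \<phi>_def \<theta>_def U by (auto simp: box_bump_outside)
  have "cutoff H (\<phi> m)" for m
  proof -
    have "{z. \<phi> m z \<noteq> 0} \<subseteq> U" using out by auto
    then have "closure {z. \<phi> m z \<noteq> 0} \<subseteq> closure U" by (rule closure_mono)
    moreover have "bounded (closure U)" using \<open>bounded U\<close> by (rule bounded_closure)
    ultimately show ?thesis using \<open>smooth (\<phi> m)\<close> assms(3)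
      unfolding cutoff_def compact_eq_bounded_closed
      by (meson bounded_subset closed_closure order_trans)
  qed
  moreover have "(\<lambda>m. \<phi> m x) \<longlonglongrightarrow> indicator U x" for x
  proof (cases "x \<in> U")
    case True
    then obtain j where j: "x \<in> box (a j) (b j)" using U by blast
    have "(\<lambda>m. \<theta> j m x) \<longlonglongrightarrow> 1 - 1"
      unfolding \<theta>_def by (intro tendsto_intros box_bump_tendsto_1 j)
    then have t1: "(\<lambda>m. \<theta> j m x) \<longlonglongrightarrow> 0" by simp
    have t2: "\<forall>\<^sub>F m in sequentially. (\<Prod>j<m. \<theta> j m x) \<le> \<theta> j m x"
      using eventually_gt_at_top[of j]
    proof eventually_elim
      case (elim m)
      have "(\<Prod>j<m. \<theta> j m x) = \<theta> j m x * (\<Prod>j\<in>{..<m}-{j}. \<theta> j m x)"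
        using elim by (intro prod.remove) auto
      also have "\<dots> \<le> \<theta> j m x * 1"
        using \<theta> by (intro mult_left_mono prod_le_1) auto
      finally show ?case by simp
    qed
    have t3: "\<forall>\<^sub>F m in sequentially. 0 \<le> (\<Prod>j<m. \<theta> j m x)"
      using \<theta> by (intro always_eventually allI prod_nonneg) auto
    have "(\<lambda>m. \<Prod>j<m. \<theta> j m x) \<longlonglongrightarrow> 0"
      by (rule real_tendsto_sandwich[OF t3 t2 tendsto_const t1])
    from tendsto_diff[OF tendsto_const[of 1] this] show ?thesis using True by (simp add: \<phi>_def)
  next
    case False
    then show ?thesis using out by simp
  qed
  ultimately show ?thesis using that 0 out by metis
qed

definition locally_bounded :: "('a::euclidean_space \<Rightarrow> real) \<Rightarrow> bool" where
  "locally_bounded w \<longleftrightarrow> (\<forall>R. \<exists>M. \<forall>z\<in>cball 0 R. \<bar>w z\<bar> \<le> M)"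

lemma integrable_bounded_support:
  fixes g :: "'a::euclidean_space \<Rightarrow> real"
  assumes "g \<in> borel_measurable borel" "\<And>z. \<bar>g z\<bar> \<le> M" "\<And>z. z \<notin> cball 0 R \<Longrightarrow> g z = 0"
  shows "integrable lborel g"
proof (rule Bochner_Integration.integrable_bound[of _ "\<lambda>z. M * indicator (cball 0 R) z"])
  show "integrable lborel (\<lambda>z::'a. M * indicator (cball 0 R) z)"
    using emeasure_lborel_cball_finite[of "0::'a" R]
    by (intro integrable_mult_right integrable_real_indicator) (auto simp: top.not_eq_extremum)
  show "AE x in lborel. norm (g x) \<le> norm (M * indicator (cball 0 R) x)"
    using assms(2,3) by (intro always_eventually allI) (auto simp: indicator_def dest: order_trans[OF _ abs_ge_self])
qed (use assms in simp)

lemma integrable_locally_bounded_mult: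
  fixes g h :: "'a::euclidean_space \<Rightarrow> real"
  assumes "g \<in> borel_measurable borel" "locally_bounded g" "h \<in> borel_measurable borel"
    and "\<And>z. \<bar>h z\<bar> \<le> N" "\<And>z. z \<notin> cball 0 R \<Longrightarrow> h z = 0"
  shows "integrable lborel (\<lambda>z. g z * h z)"
proof -
  obtain M where M: "\<And>z. z \<in> cball 0 R \<Longrightarrow> \<bar>g z\<bar> \<le> M"
    using assms(2) unfolding locally_bounded_def by metis
  show ?thesis
  proof (rule integrable_bounded_support[where R = R and M = "\<bar>M\<bar> * N"])
    show "\<bar>g z * h z\<bar> \<le> \<bar>M\<bar> * N" for z
    proof (cases "z \<in> cball 0 R")
      case True
      then show ?thesis unfolding abs_mult using M[OF True] assms(4)[of z]
        by (intro mult_mono) auto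
    next
      case False
      then show ?thesis using assms(4)[of z] assms(5) by auto
    qed
  qed (use assms in auto)
qed

text \<open>The integrals of \<open>g\<close> over open sets are limits of integrals against cutoffs, hence nonpositive;
  by outer regularity the same holds for the integral over \<open>{g > 0}\<close>.\<close>

lemma AE_nonpos_if_cutoff_integrals_nonpos:
  fixes g :: "'a::euclidean_space \<Rightarrow> real"
  assumes g[measurable]: "g \<in> borel_measurable borel" and lb: "locally_bounded g" and "open H"
    and nonpos: "\<And>\<phi>. cutoff H \<phi> \<Longrightarrow> (\<And>z. \<phi> z \<ge> 0) \<Longrightarrow> (\<integral>z. g z * \<phi> z \<partial>lborel) \<le> 0"
  shows "AE z in lborel. z \<in> H \<longrightarrow> g z \<le> 0"
proof -
  have open_le: "(\<integral>z. g z * indicator U z \<partial>lborel) \<le> 0"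
    if U: "open U" "bounded U" "closure U \<subseteq> H" for U
  proof -
    obtain \<phi> :: "nat \<Rightarrow> 'a \<Rightarrow> real" where \<phi>:
      "\<And>m. cutoff H (\<phi> m)" "\<And>m x. 0 \<le> \<phi> m x" "\<And>m x. \<phi> m x \<le> 1"
      "\<And>m x. x \<notin> U \<Longrightarrow> \<phi> m x = 0" "\<And>x. (\<lambda>m. \<phi> m x) \<longlonglongrightarrow> indicator U x"
      using cutoff_approximates_open[OF U] by blast
    have \<phi>m[measurable]: "\<phi> m \<in> borel_measurable borel" for m
      by (intro borel_measurable_continuous_onI cutoff_continuous_on[OF \<phi>(1)])
    obtain R where R: "U \<subseteq> cball 0 R" using bounded_subset_ballD[OF U(2), of 0] ball_subset_cball by (meson order_trans)
    have [measurable]: "U \<in> sets borel" using U by simp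
    have "(\<lambda>m. \<integral>z. g z * \<phi> m z \<partial>lborel) \<longlonglongrightarrow> (\<integral>z. g z * indicator U z \<partial>lborel)"
    proof (rule integral_dominated_convergence[where w = "\<lambda>z. \<bar>g z * indicator U z\<bar>"])
      show "integrable lborel (\<lambda>z. \<bar>g z * indicator U z\<bar>)"
        by (intro integrable_abs integrable_locally_bounded_mult[where N = 1 and R = R])
          (use R lb in \<open>auto simp: indicator_def\<close>)
      show "AE z in lborel. norm (g z * \<phi> m z) \<le> \<bar>g z * indicator U z\<bar>" for m
        using \<phi>(2,3)[of m] \<phi>(4) by (intro always_eventually allI)
          (auto simp: indicator_def abs_mult mult_left_le)
      show "AE z in lborel. (\<lambda>m. g z * \<phi> m z) \<longlonglongrightarrow> g z * indicator U z"
        by (intro always_eventually allI tendsto_intros \<phi>)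
    qed auto
    then show ?thesis
      by (rule LIMSEQ_le_const2) (use nonpos \<phi>(1,2) in blast)
  qed
  have box_AE: "AE z in lborel. z \<in> box a b \<longrightarrow> g z \<le> 0" if ab: "cbox a b \<subseteq> H" for a b
  proof -
    define V where "V = box a b"
    have "closure V \<subseteq> cbox a b" unfolding V_def by (intro closure_minimal box_subset_cbox closed_cbox)
    then have V: "open V" "bounded V" "closure V \<subseteq> H" using ab by (auto simp: V_def)
    obtain R where R: "V \<subseteq> cball 0 R" using bounded_subset_ballD[OF V(2), of 0] ball_subset_cball by (meson order_trans)
    obtain M where M: "\<And>z. z \<in> cball 0 R \<Longrightarrow> \<bar>g z\<bar> \<le> M"
      using lb unfolding locally_bounded_def by metis
    define M' where "M' = \<bar>M\<bar> + 1"
    have M': "\<bar>g z\<bar> \<le> M'" if "z \<in> V" for z using M R that by (force simp: M'_def)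
    have [measurable]: "V \<in> sets borel" using V by simp
    define S where "S = {z \<in> V. g z > 0}"
    have [measurable]: "S \<in> sets borel" unfolding S_def by measurable
    have "S \<subseteq> V" by (auto simp: S_def)
    have int: "integrable lborel (\<lambda>z. g z * indicator T z)" if "T \<in> sets borel" "T \<subseteq> V" for T
      by (rule integrable_locally_bounded_mult[where N = 1 and R = R])
        (use that R lb in \<open>auto simp: indicator_def\<close>)
    have "(\<integral>z. g z * indicator S z \<partial>lborel) \<le> 0"
    proof (rule field_le_epsilon)
      fix e :: real assume "e > 0"
      have "S \<in> sets borel" "0 < e / M'" using \<open>e > 0\<close> by (simp_all add: M'_def)
      then obtain T where T: "open T" "S \<subseteq> T" "emeasure lborel (T - S) < ennreal (e / M')"
        by (rule outer_regular_lborel)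
      define U where "U = T \<inter> V"
      have U: "open U" "bounded U" "closure U \<subseteq> H" "S \<subseteq> U" "U \<subseteq> V"
        using T V \<open>S \<subseteq> V\<close> closure_mono[of U V] bounded_subset[of V U] by (auto simp: U_def)
      have [measurable]: "U \<in> sets borel" using U by simp
      have "emeasure lborel (U - S) \<le> emeasure lborel (T - S)"
        using T by (intro emeasure_mono) (auto simp: U_def)
      then have fin: "emeasure lborel (U - S) < ennreal (e / M')" using T(3) by (rule le_less_trans)
      have "(\<integral>z. g z * indicator S z \<partial>lborel) = (\<integral>z. g z * indicator U z - g z * indicator (U - S) z \<partial>lborel)"
        using U by (intro Bochner_Integration.integral_cong) (auto simp: indicator_def)
      also have "\<dots> = (\<integral>z. g z * indicator U z \<partial>lborel) - (\<integral>z. g z * indicator (U - S) z \<partial>lborel)"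
        using U by (intro Bochner_Integration.integral_diff int) auto
      also have "\<dots> \<le> 0 + (\<integral>z. M' * indicator (U - S) z \<partial>lborel)"
      proof -
        have "(\<integral>z. - (g z * indicator (U - S) z) \<partial>lborel) \<le> (\<integral>z. M' * indicator (U - S) z \<partial>lborel)"
          using M' U fin
          by (intro integral_mono integrable_minus int integrable_mult_right integrable_real_indicator)
            (fastforce simp: indicator_def abs_le_iff dest: less_trans[OF _ ennreal_less_top])+
        with open_le[OF U(1-3)] show ?thesis by simp
      qed
      also have "\<dots> = M' * measure lborel (U - S)" by simp
      also have "\<dots> \<le> M' * (e / M')"
        using fin \<open>e > 0\<close> by (intro mult_left_mono) (auto simp: M'_def measure_def intro!: enn2real_leI)
      also have "\<dots> = e" by (simp add: M'_def)
      finally show "(\<integral>z. g z * indicator S z \<partial>lborel) \<le> 0 + e" by simp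
    qed
    moreover have "0 \<le> (\<integral>z. g z * indicator S z \<partial>lborel)"
      by (intro integral_nonneg_AE always_eventually allI) (auto simp: S_def indicator_def)
    ultimately have "(\<integral>z. g z * indicator S z \<partial>lborel) = 0" by (rule antisym)
    moreover have "AE z in lborel. 0 \<le> g z * indicator S z"
      by (intro always_eventually allI) (auto simp: S_def indicator_def)
    ultimately have "AE z in lborel. g z * indicator S z = 0"
      using integral_nonneg_eq_0_iff_AE[OF int[of S]] \<open>S \<subseteq> V\<close> by simp
    then show ?thesis
      by (rule eventually_mono) (auto simp: S_def V_def indicator_def split: if_splits)
  qed
  obtain D where D: "countable D" "D \<subseteq> Pow H" "\<And>X. X \<in> D \<Longrightarrow> \<exists>a b. X = cbox a b" "\<Union> D = H"
    using open_countable_Union_open_cbox[OF \<open>open H\<close>] by metis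
  have "AE z in lborel. \<forall>K\<in>D. z \<in> K \<longrightarrow> g z \<le> 0"
  proof (intro AE_ball_countable[THEN iffD2] ballI)
    fix K assume "K \<in> D"
    then obtain a b where K: "K = cbox a b" "cbox a b \<subseteq> H" using D(2) D(3) by blast
    have "cbox a b - box a b \<in> null_sets lborel"
      using negligible_frontier_interval[of a b] by (simp add: negligible_iff_null_sets null_sets_completion_iff)
    from AE_not_in[OF this] box_AE[OF K(2)] show "AE z in lborel. z \<in> K \<longrightarrow> g z \<le> 0"
      by eventually_elim (auto simp: K(1))
  qed (rule D(1))
  then show ?thesis by (rule eventually_mono) (use D(4) in blast)
qed

section \<open>Functions that are monotone along a direction\<close>

lemma lborel_integral_translate:
  fixes h :: "'a::euclidean_space \<Rightarrow> real"
  assumes [measurable]: "h \<in> borel_measurable borel"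
  shows "(\<integral>z. h (z + c) \<partial>lborel) = (\<integral>z. h z \<partial>lborel)"
proof -
  have "(\<integral>z. h z \<partial>lborel) = (\<integral>z. h z \<partial>distr lborel borel ((+) c))"
    by (simp add: lborel_distr_plus)
  also have "\<dots> = (\<integral>z. h (c + z) \<partial>lborel)"
    by (subst integral_distr) auto
  finally show ?thesis by (simp add: add.commute)
qed

lemma cutoff_differentiable:
  "cutoff H \<phi> \<Longrightarrow> (\<phi> has_derivative frechet_derivative \<phi> (at z)) (at z)"
  using cutoff_Cn[of H \<phi> 1] by (simp add: frechet_derivative_works)

lemma cutoff_deriv_continuous_on: "cutoff H \<phi> \<Longrightarrow> continuous_on A (\<lambda>z. frechet_derivative \<phi> (at z) C)"
  using cutoff_Cn[of H \<phi> 1] by (auto intro: continuous_on_subset)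

lemma cutoff_measurable:
  "cutoff H \<phi> \<Longrightarrow> \<phi> \<in> borel_measurable borel"
  "cutoff H \<phi> \<Longrightarrow> (\<lambda>z. frechet_derivative \<phi> (at z) C) \<in> borel_measurable borel"
  by (auto intro!: borel_measurable_continuous_onI cutoff_continuous_on cutoff_deriv_continuous_on)

lemma frechet_derivative_zero_outside_support:
  assumes "z \<notin> closure {z. \<phi> z \<noteq> 0}"
  shows "frechet_derivative \<phi> (at z) = (\<lambda>w. 0)"
proof -
  have "((\<lambda>_. 0) has_derivative (\<lambda>w. 0)) (at z)" by (rule has_derivative_const)
  then have "(\<phi> has_derivative (\<lambda>w. 0)) (at z)"
    by (rule has_derivative_transform_within_open[of _ _ _ _ "- closure {z. \<phi> z \<noteq> 0}"])
      (use assms closure_subset[of "{z. \<phi> z \<noteq> 0}"] in auto)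
  then show ?thesis by (rule frechet_derivative_at[symmetric])
qed

lemma cutoff_bounds:
  fixes \<phi> :: "'a::euclidean_space \<Rightarrow> real"
  assumes "cutoff H \<phi>"
  obtains R N where "R > 0" "N > 0" "\<And>z. z \<notin> cball 0 R \<Longrightarrow> \<phi> z = 0"
    "\<And>z. z \<notin> cball 0 R \<Longrightarrow> frechet_derivative \<phi> (at z) C = 0"
    "\<And>z. \<bar>\<phi> z\<bar> \<le> N" "\<And>z. \<bar>frechet_derivative \<phi> (at z) C\<bar> \<le> N"
proof -
  let ?K = "closure {z. \<phi> z \<noteq> 0}"
  have K: "compact ?K" using assms by (simp add: cutoff_def)
  obtain R where R: "R > 0" "?K \<subseteq> cball 0 R"
    using bounded_subset_ballD[OF compact_imp_bounded[OF K], of 0] ball_subset_cball by (meson order_trans)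
  have "bounded (\<phi> ` ?K)" "bounded ((\<lambda>z. frechet_derivative \<phi> (at z) C) ` ?K)"
    using assms K
    by (auto intro!: compact_imp_bounded compact_continuous_image cutoff_continuous_on cutoff_deriv_continuous_on)
  then obtain N1 N2 where N: "N1 > 0" "N2 > 0" "\<And>z. z \<in> ?K \<Longrightarrow> \<bar>\<phi> z\<bar> \<le> N1"
    "\<And>z. z \<in> ?K \<Longrightarrow> \<bar>frechet_derivative \<phi> (at z) C\<bar> \<le> N2"
    unfolding bounded_pos by auto
  have 0: "\<phi> z = 0" if "z \<notin> ?K" for z using that closure_subset[of "{z. \<phi> z \<noteq> 0}"] by blast
  show ?thesis
  proof (rule that[of R "max N1 N2"])
    show "\<bar>\<phi> z\<bar> \<le> max N1 N2" for z using N(1) N(3)[of z] 0[of z] by (cases "z \<in> ?K") auto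
    show "\<bar>frechet_derivative \<phi> (at z) C\<bar> \<le> max N1 N2" for z
      using N(2) N(4)[of z] frechet_derivative_zero_outside_support[of z \<phi>] by (cases "z \<in> ?K") auto
    show "\<phi> z = 0" if "z \<notin> cball 0 R" for z using 0 that R by blast
    show "frechet_derivative \<phi> (at z) C = 0" if "z \<notin> cball 0 R" for z
      using frechet_derivative_zero_outside_support[of z \<phi>] that R by (metis subsetD)
  qed (use R N in auto)
qed

lemma cutoff_derivative_linear: "cutoff H \<phi> \<Longrightarrow> linear (frechet_derivative \<phi> (at z))"
  using cutoff_differentiable has_derivative_linear by blast

lemma
  fixes w :: "'a::euclidean_space \<Rightarrow> real"
  assumes "cutoff H \<phi>" "w \<in> borel_measurable borel" "locally_bounded w"
  shows integrable_mult_cutoff: "integrable lborel (\<lambda>z. w z * \<phi> z)"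
    and integrable_mult_cutoff_derivative: "integrable lborel (\<lambda>z. w z * frechet_derivative \<phi> (at z) C)"
proof -
  obtain R N where "\<And>z. z \<notin> cball 0 R \<Longrightarrow> \<phi> z = 0"
    "\<And>z. z \<notin> cball 0 R \<Longrightarrow> frechet_derivative \<phi> (at z) C = 0"
    "\<And>z. \<bar>\<phi> z\<bar> \<le> N" "\<And>z. \<bar>frechet_derivative \<phi> (at z) C\<bar> \<le> N"
    by (rule cutoff_bounds[OF assms(1), where C = C]) blast
  with assms show "integrable lborel (\<lambda>z. w z * \<phi> z)" "integrable lborel (\<lambda>z. w z * frechet_derivative \<phi> (at z) C)"
    by (auto intro!: integrable_locally_bounded_mult[where R = R and N = N] cutoff_measurable[OF assms(1)])
qed

lemma cutoff_line_derivative: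
  assumes "cutoff H \<phi>"
  shows "((\<lambda>s. \<phi> (z - s *\<^sub>R C)) has_real_derivative - frechet_derivative \<phi> (at (z - s *\<^sub>R C)) C) (at s)"
proof -
  have "((\<lambda>s. z - s *\<^sub>R C) has_derivative (\<lambda>h. - (h *\<^sub>R C))) (at s)"
    by (auto intro!: derivative_eq_intros)
  from has_derivative_compose[OF this cutoff_differentiable[OF assms]]
  have "((\<lambda>s. \<phi> (z - s *\<^sub>R C)) has_derivative
      (\<lambda>h. frechet_derivative \<phi> (at (z - s *\<^sub>R C)) (- (h *\<^sub>R C)))) (at s)" .
  moreover have "linear (frechet_derivative \<phi> (at (z - s *\<^sub>R C)))"
    by (rule cutoff_derivative_linear[OF assms])
  ultimately show ?thesis
    by (auto elim!: has_derivative_eq_rhs simp: has_field_derivative_def linear_neg linear_scale)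
qed

text \<open>The difference quotients of \<open>\<phi>\<close> along \<open>C\<close> are uniformly bounded and have uniformly bounded
  support, which allows differentiation under the integral.\<close>

lemma integral_translated_cutoff_derivative:
  fixes w :: "'a::euclidean_space \<Rightarrow> real"
  assumes w[measurable]: "w \<in> borel_measurable borel" and lb: "locally_bounded w" and \<phi>: "cutoff H \<phi>"
  shows "((\<lambda>s. \<integral>z. w z * \<phi> (z - s *\<^sub>R C) \<partial>lborel) has_real_derivative
     - (\<integral>z. w z * frechet_derivative \<phi> (at (z - s *\<^sub>R C)) C \<partial>lborel)) (at s)"
proof -
  obtain R N where R: "R > 0" "N > 0" "\<And>z. z \<notin> cball 0 R \<Longrightarrow> \<phi> z = 0"
    "\<And>z. z \<notin> cball 0 R \<Longrightarrow> frechet_derivative \<phi> (at z) C = 0"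
    "\<And>z. \<bar>\<phi> z\<bar> \<le> N" "\<And>z. \<bar>frechet_derivative \<phi> (at z) C\<bar> \<le> N"
    using cutoff_bounds[OF \<phi>, where C=C] by metis
  note [measurable] = cutoff_measurable[OF \<phi>]
  define R' where "R' = R + (\<bar>s\<bar> + 1) * norm C"
  have out: "z - t *\<^sub>R C \<notin> cball 0 R" if "z \<notin> cball 0 R'" "\<bar>t\<bar> \<le> \<bar>s\<bar> + 1" for z t
  proof -
    have "norm (t *\<^sub>R C) \<le> (\<bar>s\<bar> + 1) * norm C"
      using that by (auto intro!: mult_right_mono)
    then show ?thesis using that norm_triangle_ineq[of "z - t *\<^sub>R C" "t *\<^sub>R C"]
      by (auto simp: R'_def)
  qed
  have lip: "\<bar>\<phi> (z - (s + h) *\<^sub>R C) - \<phi> (z - s *\<^sub>R C)\<bar> \<le> N * \<bar>h\<bar>" for z h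
  proof -
    have "norm (\<phi> (z - (s + h) *\<^sub>R C) - \<phi> (z - s *\<^sub>R C)) \<le> N * norm (s + h - s)"
      by (rule field_differentiable_bound[of UNIV "\<lambda>s. \<phi> (z - s *\<^sub>R C)"
            "\<lambda>s. - frechet_derivative \<phi> (at (z - s *\<^sub>R C)) C"])
        (use cutoff_line_derivative[OF \<phi>] R in auto)
    then show ?thesis by simp
  qed
  define q where "q h z = (\<phi> (z - (s + h) *\<^sub>R C) - \<phi> (z - s *\<^sub>R C)) / h" for h z
  have int: "integrable lborel (\<lambda>z. w z * \<phi> (z - t *\<^sub>R C))" if "\<bar>t\<bar> \<le> \<bar>s\<bar> + 1" for t
    by (rule integrable_locally_bounded_mult[where N = N and R = R'])
      (use R out[OF _ that] lb in auto)
  have "((\<lambda>h. \<integral>z. w z * q h z \<partial>lborel) \<longlongrightarrow>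
     (\<integral>z. w z * - frechet_derivative \<phi> (at (z - s *\<^sub>R C)) C \<partial>lborel)) (at 0 within {-1<..<1})"
    unfolding tendsto_at_iff_sequentially o_def
  proof (intro allI impI)
    fix X :: "nat \<Rightarrow> real" assume X: "\<forall>i. X i \<in> {-1<..<1} - {0}" "X \<longlonglongrightarrow> 0"
    show "(\<lambda>i. \<integral>z. w z * q (X i) z \<partial>lborel) \<longlonglongrightarrow>
       (\<integral>z. w z * - frechet_derivative \<phi> (at (z - s *\<^sub>R C)) C \<partial>lborel)"
    proof (rule integral_dominated_convergence[where w = "\<lambda>z. \<bar>w z * (N * indicator (cball 0 R') z)\<bar>"])
      show "integrable lborel (\<lambda>z. \<bar>w z * (N * indicator (cball 0 R') z)\<bar>)"
        by (intro integrable_abs integrable_locally_bounded_mult[where N = N and R = R'])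
          (use lb R in \<open>auto simp: indicator_def\<close>)
      show "AE z in lborel. (\<lambda>i. w z * q (X i) z) \<longlonglongrightarrow>
          w z * - frechet_derivative \<phi> (at (z - s *\<^sub>R C)) C"
      proof (intro always_eventually allI tendsto_mult tendsto_const)
        fix z
        have "((\<lambda>h. q h z) \<longlongrightarrow>
            - frechet_derivative \<phi> (at (z - s *\<^sub>R C)) C) (at 0)"
          using cutoff_line_derivative[OF \<phi>, of z C s] by (simp add: DERIV_def q_def)
        then show "(\<lambda>i. q (X i) z) \<longlonglongrightarrow>
            - frechet_derivative \<phi> (at (z - s *\<^sub>R C)) C"
          using X unfolding tendsto_at_iff_sequentially o_def by auto
      qed
      show "AE z in lborel. norm (w z * q (X i) z)
          \<le> \<bar>w z * (N * indicator (cball 0 R') z)\<bar>" for i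
      proof (intro always_eventually allI)
        fix z
        have Xi: "\<bar>X i\<bar> \<le> 1" "X i \<noteq> 0" using X(1)[rule_format, of i] by auto
        show "norm (w z * q (X i) z)
          \<le> \<bar>w z * (N * indicator (cball 0 R') z)\<bar>"
        proof (cases "z \<in> cball 0 R'")
          case True
          have "\<bar>q (X i) z\<bar> \<le> N"
            using lip[of z "X i"] Xi by (simp add: q_def abs_divide pos_divide_le_eq)
          then show ?thesis using True R(2)
            using mult_left_mono[of "\<bar>q (X i) z\<bar>" N "\<bar>w z\<bar>"]
            by (simp add: abs_mult)
        next
          case False
          have "\<phi> (z - (s + X i) *\<^sub>R C) = 0" "\<phi> (z - s *\<^sub>R C) = 0"
            using Xi by (auto intro!: R(3) out[OF False])
          then show ?thesis by (simp add: q_def)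
        qed
      qed
    qed (auto simp: q_def)
  qed
  moreover have "at (0::real) within {-1<..<1} = at 0" by (rule at_within_open) auto
  ultimately have lim: "((\<lambda>h. \<integral>z. w z * q h z \<partial>lborel) \<longlongrightarrow>
     (\<integral>z. w z * - frechet_derivative \<phi> (at (z - s *\<^sub>R C)) C \<partial>lborel)) (at 0)" by simp
  have "\<forall>\<^sub>F h in at 0. (\<integral>z. w z * q h z \<partial>lborel)
      = ((\<integral>z. w z * \<phi> (z - (s + h) *\<^sub>R C) \<partial>lborel) - (\<integral>z. w z * \<phi> (z - s *\<^sub>R C) \<partial>lborel)) / h"
    unfolding eventually_at
  proof (intro exI[of _ 1] conjI ballI impI)
    fix h :: real assume "h \<noteq> 0 \<and> dist h 0 < 1"
    then have h: "\<bar>s + h\<bar> \<le> \<bar>s\<bar> + 1" by auto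
    show "(\<integral>z. w z * q h z \<partial>lborel)
      = ((\<integral>z. w z * \<phi> (z - (s + h) *\<^sub>R C) \<partial>lborel) - (\<integral>z. w z * \<phi> (z - s *\<^sub>R C) \<partial>lborel)) / h"
      using Bochner_Integration.integral_diff[OF int[OF h] int[of s]]
      by (simp add: q_def right_diff_distrib[symmetric])
  qed simp
  from Lim_transform_eventually[OF lim this] show ?thesis
    by (simp add: DERIV_def)
qed

lemma integral_cutoff_derivative_eq_0:
  fixes \<phi> :: "'a::euclidean_space \<Rightarrow> real"
  assumes "cutoff H \<phi>"
  shows "(\<integral>z. frechet_derivative \<phi> (at z) C \<partial>lborel) = 0"
proof -
  have "((\<lambda>s. \<integral>z. 1 * \<phi> (z - s *\<^sub>R C) \<partial>lborel) has_real_derivative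
     - (\<integral>z. 1 * frechet_derivative \<phi> (at (z - 0 *\<^sub>R C)) C \<partial>lborel)) (at 0)"
    by (rule integral_translated_cutoff_derivative[OF _ _ assms]) (auto simp: locally_bounded_def)
  moreover have "(\<lambda>s. \<integral>z. 1 * \<phi> (z - s *\<^sub>R C) \<partial>lborel) = (\<lambda>s. \<integral>z. \<phi> z \<partial>lborel)"
    using lborel_integral_translate[OF cutoff_measurable(1)[OF assms], of "- _ *\<^sub>R C"] by simp
  moreover have "((\<lambda>s. \<integral>z. \<phi> z \<partial>lborel) has_real_derivative 0) (at 0)" by simp
  ultimately have "- (\<integral>z. 1 * frechet_derivative \<phi> (at (z - 0 *\<^sub>R C)) C \<partial>lborel) = 0"
    using DERIV_unique by fastforce
  then show ?thesis by simp
qed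

lemma
  fixes \<phi> :: "'a::euclidean_space \<Rightarrow> real"
  assumes "cutoff H \<phi>" "\<And>z. z \<in> H \<Longrightarrow> z + c \<in> H"
  shows cutoff_translate: "cutoff H (\<lambda>z. \<phi> (z - c))"
    and frechet_derivative_translate:
      "frechet_derivative (\<lambda>z. \<phi> (z - c)) (at z) = frechet_derivative \<phi> (at (z - c))"
proof -
  have "{z. \<phi> (z - c) \<noteq> 0} = (+) c ` {z. \<phi> z \<noteq> 0}"
    by (force simp: image_iff intro: exI[of _ "_ - c"])
  then have cl: "closure {z. \<phi> (z - c) \<noteq> 0} = (+) c ` closure {z. \<phi> z \<noteq> 0}"
    by (simp add: closure_translation)
  then show "cutoff H (\<lambda>z. \<phi> (z - c))"
    using assms compact_translation[of "closure {z. \<phi> z \<noteq> 0}" c]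
    by (auto simp: cutoff_def smooth_translate add.commute)
  have "((\<lambda>z. z - c) has_derivative (\<lambda>w. w)) (at z)" by (auto intro!: derivative_eq_intros)
  from has_derivative_compose[OF this cutoff_differentiable[OF assms(1)]]
  show "frechet_derivative (\<lambda>z. \<phi> (z - c)) (at z) = frechet_derivative \<phi> (at (z - c))"
    by (rule frechet_derivative_at[symmetric])
qed

text \<open>For a nonnegative cutoff \<open>\<phi>\<close> the function \<open>s \<mapsto> \<integral> w(z) \<phi>(z - s C) dz\<close> is nonincreasing,
  because its derivative at \<open>s\<close> is the given integral for the translated cutoff, up to the sign.\<close>

proposition AE_decreasing_along_direction:
  fixes w :: "'a::euclidean_space \<Rightarrow> real"
  assumes w[measurable]: "w \<in> borel_measurable borel" and lb: "\<And>z. \<bar>w z\<bar> \<le> M" and "open H"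
    and H: "\<And>z s. z \<in> H \<Longrightarrow> s \<ge> 0 \<Longrightarrow> z + s *\<^sub>R C \<in> H"
    and weak: "\<And>\<phi>. cutoff H \<phi> \<Longrightarrow> (\<And>z. \<phi> z \<ge> 0) \<Longrightarrow> (\<integral>z. w z * frechet_derivative \<phi> (at z) C \<partial>lborel) \<ge> 0"
    and s: "s \<ge> 0"
  shows "AE z in lborel. z \<in> H \<longrightarrow> w (z + s *\<^sub>R C) \<le> w z"
proof -
  have lbw: "locally_bounded w" "locally_bounded (\<lambda>z. w (z + c))" for c
    using lb by (auto simp: locally_bounded_def)
  have "AE z in lborel. z \<in> H \<longrightarrow> w (z + s *\<^sub>R C) - w z \<le> 0"
  proof (rule AE_nonpos_if_cutoff_integrals_nonpos)
    show "locally_bounded (\<lambda>z. w (z + s *\<^sub>R C) - w z)"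
      unfolding locally_bounded_def
    proof (intro allI exI ballI)
      show "\<bar>w (z + s *\<^sub>R C) - w z\<bar> \<le> 2 * M" for z
        using lb[of "z + s *\<^sub>R C"] lb[of z] by linarith
    qed
    fix \<phi> :: "'a \<Rightarrow> real" assume \<phi>: "cutoff H \<phi>" "\<And>z. \<phi> z \<ge> 0"
    note [measurable] = cutoff_measurable[OF \<phi>(1)]
    define h where "h s = (\<integral>z. w z * \<phi> (z - s *\<^sub>R C) \<partial>lborel)" for s
    have tr: "h s = (\<integral>z. w (z + s *\<^sub>R C) * \<phi> z \<partial>lborel)" for s
      using lborel_integral_translate[of "\<lambda>z. w z * \<phi> (z - s *\<^sub>R C)" "s *\<^sub>R C"] by (simp add: h_def)
    have int: "integrable lborel (\<lambda>z. w (z + c) * \<phi> z)" for c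
      by (rule integrable_mult_cutoff[OF \<phi>(1) _ lbw(2)]) simp
    have "h s \<le> h 0"
    proof (rule DERIV_nonpos_imp_nonincreasing[OF s])
      fix t :: real assume t: "0 \<le> t" "t \<le> s"
      have "(h has_real_derivative - (\<integral>z. w z * frechet_derivative \<phi> (at (z - t *\<^sub>R C)) C \<partial>lborel)) (at t)"
        unfolding h_def by (rule integral_translated_cutoff_derivative[OF w lbw(1) \<phi>(1)])
      moreover have "(\<integral>z. w z * frechet_derivative \<phi> (at (z - t *\<^sub>R C)) C \<partial>lborel) \<ge> 0"
        using weak[OF cutoff_translate[OF \<phi>(1)], of "t *\<^sub>R C"] H[OF _ t(1)] \<phi>
          frechet_derivative_translate[OF \<phi>(1), of "t *\<^sub>R C"] by simp
      ultimately show "\<exists>y. (h has_real_derivative y) (at t) \<and> y \<le> 0"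
        by (intro exI[of _ "- (\<integral>z. w z * frechet_derivative \<phi> (at (z - t *\<^sub>R C)) C \<partial>lborel)"]) auto
    qed
    then show "(\<integral>z. (w (z + s *\<^sub>R C) - w z) * \<phi> z \<partial>lborel) \<le> 0"
      using Bochner_Integration.integral_diff[OF int[of "s *\<^sub>R C"] int[of 0]]
      by (simp add: tr left_diff_distrib)
  qed (use \<open>open H\<close> in auto)
  then show ?thesis by simp
qed

section \<open>Two-valued entropy solutions are travelling waves with a monotone profile\<close>

lemma AE_lborel_translate:
  fixes c :: "'a::euclidean_space"
  assumes "AE x in lborel. P x"
  shows "AE x in lborel. P (x + c)"
proof -
  obtain N where N: "{x. \<not> P x} \<subseteq> N" "N \<in> null_sets lborel"
    using assms by (auto simp: eventually_ae_filter)
  have [measurable]: "N \<in> sets borel" using N by (auto simp: null_sets_def)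
  have "emeasure lborel N = emeasure (distr lborel borel ((+) c)) N"
    by (simp add: lborel_distr_plus)
  also have "\<dots> = emeasure lborel {x. c + x \<in> N}"
    by (subst emeasure_distr) (auto simp: vimage_def)
  finally have "{x. c + x \<in> N} \<in> null_sets lborel"
    using N by (auto simp: null_sets_def)
  then show ?thesis
    by (rule AE_I') (use N in \<open>auto simp: add.commute\<close>)
qed

lemma AE_lborel_positive_witness:
  assumes "AE t in lborel. P (t::real)"
  obtains t where "t > 0" "P t"
proof -
  obtain N where N: "{x. \<not> P x} \<subseteq> N" "N \<in> null_sets lborel"
    using assms by (auto simp: eventually_ae_filter)
  have "\<not> {0<..<1} \<subseteq> N"
    using null_sets_subset[of N lborel "{0<..<1::real}"] N(2) by (auto simp: null_sets_def)
  then obtain t where "0 < t" "t \<notin> N" by (metis greaterThanLessThan_iff subsetI)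
  then show ?thesis using N(1) that by auto
qed

lemma half_space_time_sets [measurable]: "half_space_time \<in> sets borel"
  and open_half_space_time: "open half_space_time"
proof -
  show "open (half_space_time :: (real \<times> (real ^ 'd)) set)"
    unfolding half_space_time_def by (intro open_Times) auto
  then show "half_space_time \<in> sets (borel :: (real \<times> (real ^ 'd)) measure)" by (rule borel_open)
qed

lemma AE_lebesgue_on_half_space_time:
  "(AE z in lebesgue_on half_space_time. P z) \<longleftrightarrow> (AE z in lborel. z \<in> half_space_time \<longrightarrow> P z)"
  by (simp add: AE_restrict_space_iff AE_completion_iff)

lemma borel_preimage_continuous:
  fixes h :: "'a::topological_space \<Rightarrow> 'b::topological_space"
  assumes "continuous_on UNIV h" "E \<in> sets borel"
  shows "{x. h x \<in> E} \<in> sets borel"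
  using measurable_sets_borel[OF borel_measurable_continuous_onI[OF assms(1)] assms(2)]
  by (simp add: vimage_def)

lemma AE_lborel_swap:
  fixes P :: "'a::euclidean_space \<Rightarrow> 'b::euclidean_space \<Rightarrow> bool"
  assumes "AE x in lborel. AE y in lborel. P x y" "{p. P (fst p) (snd p)} \<in> sets borel"
  shows "AE y in lborel. AE x in lborel. P x y"
proof (rule lborel_pair.AE_commute[THEN iffD1])
  show "{p \<in> space (lborel \<Otimes>\<^sub>M lborel). P (fst p) (snd p)} \<in> sets (lborel \<Otimes>\<^sub>M lborel)"
    unfolding lborel_prod using assms(2) by simp
qed (use assms(1) in simp)

lemma two_state_borel_set:
  fixes u :: "real \<times> (real ^ 'd) \<Rightarrow> real"
  assumes u: "u \<in> borel_measurable (lebesgue_on half_space_time)"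
    and two: "AE z in lebesgue_on half_space_time. u z \<in> {um, up}"
  obtains E where "E \<in> sets borel"
    "AE z in lborel. z \<in> half_space_time \<longrightarrow> u z = (if z \<in> E then um else up)"
proof -
  let ?A = "u -` {um} \<inter> space (lebesgue_on half_space_time)"
  have "?A \<in> sets (lebesgue_on half_space_time)"
    using u by (rule measurable_sets) simp
  then have "?A \<in> sets lebesgue"
    by (subst (asm) sets_restrict_space_iff) auto
  then obtain S N N' where S: "?A = S \<union> N" "N \<subseteq> N'" "N' \<in> null_sets lborel" "S \<in> sets lborel"
    by (rule sets_completionE)
  have "AE z in lborel. z \<notin> N'" using S(3) by (rule AE_not_in)
  moreover have "AE z in lborel. z \<in> half_space_time \<longrightarrow> u z \<in> {um, up}"
    using two by (simp add: AE_lebesgue_on_half_space_time)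
  ultimately have "AE z in lborel. z \<in> half_space_time \<longrightarrow> u z = (if z \<in> S then um else up)"
  proof eventually_elim
    case (elim z)
    have "z \<in> half_space_time \<Longrightarrow> u z = um \<longleftrightarrow> z \<in> S"
      using elim(1) S(1,2) by (auto simp: space_restrict_space)
    then show ?case using elim(2) by auto
  qed
  then show ?thesis using that S(4) by simp
qed

lemma locally_bounded_indicator: "locally_bounded (indicator E)"
  by (auto simp: locally_bounded_def indicator_def intro!: exI[of _ 1])

text \<open>Kruzhkov's entropy and its flux are combined to one vector of space-time: the integrand of the
  entropy inequality is then the derivative of the test function in a direction that depends only on
  the state.\<close>

definition entropy_pair :: "(real \<Rightarrow> real ^ 'd) \<Rightarrow> real \<Rightarrow> real \<Rightarrow> real \<times> (real ^ 'd)" where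
  "entropy_pair f k s = (\<bar>s - k\<bar>, sgn (s - k) *\<^sub>R (f s - f k))"

text \<open>With two states the integrand is an affine function of the indicator of \<open>E\<close>. Its constant part
  is a derivative of the cutoff in a fixed direction, which integrates to zero.\<close>

lemma entropy_inequality_two_states:
  fixes u :: "real \<times> (real ^ 'd) \<Rightarrow> real"
  assumes sol: "entropy_solution f u" and E[measurable]: "E \<in> sets borel"
    and uE: "AE z in lborel. z \<in> half_space_time \<longrightarrow> u z = (if z \<in> E then um else up)"
    and \<phi>: "cutoff half_space_time \<phi>" "\<And>z. \<phi> z \<ge> 0"
  shows "0 \<le> (\<integral>z. indicator E z * frechet_derivative \<phi> (at z) (entropy_pair f k um - entropy_pair f k up) \<partial>lborel)"
proof -
  let ?D = "\<lambda>z. frechet_derivative \<phi> (at z)"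
  let ?H = "half_space_time :: (real \<times> (real ^ 'd)) set"
  let ?c = "entropy_pair f k"
  note lin = cutoff_derivative_linear[OF \<phi>(1)]
  note m = cutoff_measurable(2)[OF \<phi>(1)]
  have zero: "?D z = (\<lambda>w. 0)" if "z \<notin> ?H" for z
    using frechet_derivative_zero_outside_support[of z \<phi>] \<phi>(1) that unfolding cutoff_def by blast
  define I where "I z = \<bar>u z - k\<bar> * ?D z (1, 0) + ?D z (0, sgn (u z - k) *\<^sub>R (f (u z) - f k))" for z
  have I: "I z = ?D z (?c (u z))" for z
  proof -
    have "?c (u z) = \<bar>u z - k\<bar> *\<^sub>R (1, 0) + (0, sgn (u z - k) *\<^sub>R (f (u z) - f k))"
      by (simp add: entropy_pair_def)
    then show ?thesis
      unfolding I_def by (simp only: linear_add[OF lin] linear_scale[OF lin]) simp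
  qed
  define J where "J z = indicator E z * ?D z (?c um - ?c up) + ?D z (?c up)" for z
  have J: "J z = ?D z (?c (if z \<in> E then um else up))" for z
    unfolding J_def by (simp add: linear_diff[OF lin])
  have [measurable]: "J \<in> borel_measurable borel"
    unfolding J_def by (intro borel_measurable_add borel_measurable_times m) simp
  have "0 \<le> (\<integral>z. I z \<partial>lebesgue_on ?H)"
    using sol \<phi> unfolding entropy_solution_def I_def by (auto simp: test_function_iff_cutoff)
  also have "\<dots> = (\<integral>z. indicator ?H z *\<^sub>R I z \<partial>lebesgue)"
    by (rule integral_restrict_space) simp
  also have "\<dots> = (\<integral>z. J z \<partial>lebesgue)"
  proof (rule integral_cong_AE)
    have "AE z in lborel. J z = indicator ?H z *\<^sub>R I z"
      using uE
    proof eventually_elim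
      case (elim z)
      then show ?case by (cases "z \<in> ?H") (auto simp: I J zero)
    qed
    then have ae: "AE z in lebesgue. J z = indicator ?H z *\<^sub>R I z"
      by (rule AE_completion)
    then show "AE z in lebesgue. indicator ?H z *\<^sub>R I z = J z"
      by eventually_elim simp
    show J_meas: "J \<in> borel_measurable lebesgue" by (simp add: measurable_completion)
    show "(\<lambda>z. indicator ?H z *\<^sub>R I z) \<in> borel_measurable lebesgue"
      by (rule borel_measurable_AE[OF J_meas ae])
  qed
  also have "\<dots> = (\<integral>z. J z \<partial>lborel)" by (rule integral_completion) simp
  also have "\<dots> = (\<integral>z. indicator E z * ?D z (?c um - ?c up) \<partial>lborel) + (\<integral>z. ?D z (?c up) \<partial>lborel)"
    unfolding J_def
    using integrable_mult_cutoff_derivative[OF \<phi>(1) _ locally_bounded_indicator, of E]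
      integrable_mult_cutoff_derivative[OF \<phi>(1) _ locally_bounded_indicator, of UNIV]
    by (intro Bochner_Integration.integral_add) simp_all
  finally show ?thesis by (simp add: integral_cutoff_derivative_eq_0[OF \<phi>(1)])
qed

text \<open>The levels \<open>k = um\<close> and \<open>k = up\<close> give the two signs of the transport equation along \<open>(1, v)\<close>.
  For \<open>k\<close> in between, subtracting a multiple of the transport equation leaves a purely spatial
  direction.\<close>

lemma two_state_weak_inequalities:
  fixes u :: "real \<times> (real ^ 'd) \<Rightarrow> real"
  assumes sol: "entropy_solution f u" and E[measurable]: "E \<in> sets borel" and "up < um"
    and uE: "AE z in lborel. z \<in> half_space_time \<longrightarrow> u z = (if z \<in> E then um else up)"
    and \<phi>: "cutoff half_space_time \<phi>" "\<And>z. \<phi> z \<ge> 0"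
  shows "(\<integral>z. indicator E z * frechet_derivative \<phi> (at z) (1, shock_velocity f um up) \<partial>lborel) = 0"
    and "up < k \<Longrightarrow> k < um \<Longrightarrow>
      0 \<le> (\<integral>z. indicator E z * frechet_derivative \<phi> (at z) (0, moving_flux f um up up - moving_flux f um up k) \<partial>lborel)"
proof -
  let ?D = "\<lambda>z. frechet_derivative \<phi> (at z)"
  let ?v = "shock_velocity f um up"
  define T where "T C = (\<integral>z. indicator E z * ?D z C \<partial>lborel)" for C
  note lin = cutoff_derivative_linear[OF \<phi>(1)]
  have int: "integrable lborel (\<lambda>z. indicator E z * ?D z C)" for C
    by (rule integrable_mult_cutoff_derivative[OF \<phi>(1)]) (simp_all add: locally_bounded_indicator)
  have T_scale: "T (c *\<^sub>R C) = c * T C" for c C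
    unfolding T_def by (simp add: linear_scale[OF lin] mult.left_commute)
  have T_add: "T (C + C') = T C + T C'" for C C'
    unfolding T_def by (simp add: linear_add[OF lin] distrib_left Bochner_Integration.integral_add[OF int int])
  have pos: "0 \<le> T (entropy_pair f k um - entropy_pair f k up)" for k
    unfolding T_def by (rule entropy_inequality_two_states[OF sol E uE \<phi>])
  have fv: "f um - f up = (um - up) *\<^sub>R ?v"
  proof -
    have "(um - up) *\<^sub>R ?v = (- (um - up)) *\<^sub>R ((f um - f up) /\<^sub>R (up - um))"
      unfolding shock_velocity_def by (simp add: scaleR_right_diff_distrib algebra_simps)
    also have "\<dots> = f um - f up" using \<open>up < um\<close> by simp
    finally show ?thesis by simp
  qed
  have "entropy_pair f um um - entropy_pair f um up = (up - um) *\<^sub>R (1, ?v)"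
    using \<open>up < um\<close> fv by (simp add: entropy_pair_def algebra_simps)
  with pos[of um] have 1: "0 \<le> (up - um) * T (1, ?v)" by (simp add: T_scale del: scaleR_Pair)
  have "entropy_pair f up um - entropy_pair f up up = (um - up) *\<^sub>R (1, ?v)"
    using \<open>up < um\<close> fv by (simp add: entropy_pair_def)
  with pos[of up] have 2: "0 \<le> (um - up) * T (1, ?v)" by (simp add: T_scale del: scaleR_Pair)
  from 1 2 \<open>up < um\<close> have T0: "T (1, ?v) = 0"
    by (simp add: zero_le_mult_iff)
  then show "(\<integral>z. indicator E z * ?D z (1, ?v) \<partial>lborel) = 0" by (simp add: T_def)
  assume k: "up < k" "k < um"
  have f_um: "f um = f up + (um - up) *\<^sub>R ?v" using fv by (simp add: algebra_simps)
  have "entropy_pair f k um - entropy_pair f k up =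
      (um + up - 2 * k) *\<^sub>R (1, ?v) + 2 *\<^sub>R (0, moving_flux f um up up - moving_flux f um up k)"
    using k by (simp add: entropy_pair_def moving_flux_def f_um)
      (simp add: algebra_simps scaleR_2 flip: scaleR_scaleR)
  with pos[of k] show "0 \<le> (\<integral>z. indicator E z * ?D z (0, moving_flux f um up up - moving_flux f um up k) \<partial>lborel)"
    by (simp add: T_add T_scale T0 del: scaleR_Pair add_Pair) (simp add: T_def)
qed

lemma two_state_AE_along_directions:
  fixes u :: "real \<times> (real ^ 'd) \<Rightarrow> real"
  assumes sol: "entropy_solution f u" and E[measurable]: "E \<in> sets borel" and "up < um"
    and uE: "AE z in lborel. z \<in> half_space_time \<longrightarrow> u z = (if z \<in> E then um else up)"
    and s: "s \<ge> 0"
  shows "AE z in lborel. z \<in> half_space_time \<longrightarrow>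
      (z + s *\<^sub>R (1, shock_velocity f um up) \<in> E \<longleftrightarrow> z \<in> E)"
    and "up < k \<Longrightarrow> k < um \<Longrightarrow> AE z in lborel. z \<in> half_space_time \<longrightarrow>
      z + s *\<^sub>R (0, moving_flux f um up up - moving_flux f um up k) \<in> E \<longrightarrow> z \<in> E"
proof -
  let ?v = "shock_velocity f um up"
  note weak = two_state_weak_inequalities[OF sol E \<open>up < um\<close> uE]
  have H: "z + s *\<^sub>R (c, C) \<in> half_space_time"
    if "z \<in> half_space_time" "s \<ge> 0" "c \<ge> 0" for z s c and C :: "real ^ 'd"
    using that by (cases z) (auto simp: half_space_time_def intro: add_pos_nonneg)
  have "AE z in lborel. z \<in> half_space_time \<longrightarrow>
      indicator E (z + s *\<^sub>R (1, ?v)) \<le> (indicator E z :: real)"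
    by (rule AE_decreasing_along_direction[where M = 1, OF _ _ open_half_space_time H _ s])
      (auto simp: weak(1))
  moreover have "AE z in lborel. z \<in> half_space_time \<longrightarrow>
      - indicator E (z + s *\<^sub>R (1, ?v)) \<le> (- indicator E z :: real)"
    by (rule AE_decreasing_along_direction[where M = 1, OF _ _ open_half_space_time H _ s])
      (auto simp: weak(1) abs_indicator)
  ultimately show "AE z in lborel. z \<in> half_space_time \<longrightarrow> (z + s *\<^sub>R (1, ?v) \<in> E \<longleftrightarrow> z \<in> E)"
    by eventually_elim (auto simp: indicator_def split: if_splits)
  assume k: "up < k" "k < um"
  have "AE z in lborel. z \<in> half_space_time \<longrightarrow>
      indicator E (z + s *\<^sub>R (0, moving_flux f um up up - moving_flux f um up k)) \<le> (indicator E z :: real)"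
    by (rule AE_decreasing_along_direction[where M = 1, OF _ _ open_half_space_time H _ s])
      (use weak(2)[OF _ _ k] in \<open>auto simp: indicator_def[abs_def]\<close>)
  then show "AE z in lborel. z \<in> half_space_time \<longrightarrow>
      z + s *\<^sub>R (0, moving_flux f um up up - moving_flux f um up k) \<in> E \<longrightarrow> z \<in> E"
    by eventually_elim (auto simp: indicator_def split: if_splits)
qed

text \<open>Invariance along \<open>(1, v)\<close> says that, in the moving frame, almost every two time slices of \<open>E\<close>
  agree almost everywhere; hence almost all of them agree with one suitably chosen slice.\<close>

lemma AE_invariant_set_is_travelling:
  fixes E :: "(real \<times> 'a::euclidean_space) set"
  assumes E[measurable]: "E \<in> sets borel"
    and inv: "\<And>s. s \<ge> 0 \<Longrightarrow> AE z in lborel. z \<in> {0<..} \<times> UNIV \<longrightarrow> (z + s *\<^sub>R (1, v) \<in> E \<longleftrightarrow> z \<in> E)"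
  obtains E0 where "E0 \<in> sets borel"
    "AE t in lborel. t > 0 \<longrightarrow> (AE x in lborel. (t, x) \<in> E \<longleftrightarrow> x - t *\<^sub>R v \<in> E0)"
proof -
  define R where "R s z \<longleftrightarrow> fst z > 0 \<and> fst z + s > 0 \<longrightarrow> (z + s *\<^sub>R (1, v) \<in> E \<longleftrightarrow> z \<in> E)"
    for s :: real and z :: "real \<times> 'a"
  have R_AE: "AE z in lborel. R s z" for s
  proof (cases "s \<ge> 0")
    case True
    from inv[OF True] show ?thesis by eventually_elim (auto simp: R_def mem_Times_iff)
  next
    case False
    then have "AE z in lborel. z \<in> {0<..} \<times> UNIV \<longrightarrow> (z + (- s) *\<^sub>R (1, v) \<in> E \<longleftrightarrow> z \<in> E)"
      by (intro inv) simp
    from AE_lborel_translate[OF this, of "s *\<^sub>R (1, v)"] show ?thesis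
      by eventually_elim (auto simp: R_def mem_Times_iff zero_prod_def[symmetric])
  qed
  have R_sets: "{p. R (fst p) (snd p)} \<in> sets borel"
  proof -
    let ?X = "{p :: real \<times> (real \<times> 'a). snd p + fst p *\<^sub>R (1, v) \<in> E}" and ?Y = "{p :: real \<times> (real \<times> 'a). snd p \<in> E}"
    let ?P = "{p :: real \<times> (real \<times> 'a). fst (snd p) > 0}" and ?Q = "{p :: real \<times> (real \<times> 'a). fst (snd p) + fst p > 0}"
    have "?X \<in> sets borel" "?Y \<in> sets borel"
      by (rule borel_preimage_continuous; auto intro!: continuous_intros)+
    moreover have "?P \<in> sets borel" "?Q \<in> sets borel"
      by (auto intro!: borel_open open_Collect_less continuous_intros)
    ultimately have "- ?P \<union> - ?Q \<union> (?X \<inter> ?Y) \<union> (- ?X \<inter> - ?Y) \<in> sets borel"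
      by (intro sets.Un sets.Int borel_comp)
    also have "- ?P \<union> - ?Q \<union> (?X \<inter> ?Y) \<union> (- ?X \<inter> - ?Y) = {p. R (fst p) (snd p)}" by (auto simp: R_def)
    finally show ?thesis .
  qed
  have "AE z in lborel. AE s in lborel. R s z" by (rule AE_lborel_swap[OF AE_I2[OF R_AE] R_sets])
  then have "AE z in lborel \<Otimes>\<^sub>M lborel. AE s in lborel. R s z" unfolding lborel_prod .
  then have "AE t in lborel. AE x in lborel. AE s in lborel. R s (t, x)" by (rule lborel_pair.AE_pair)
  then obtain t0 where t0: "t0 > 0" "AE x in lborel. AE s in lborel. R s (t0, x)"
    by (rule AE_lborel_positive_witness)
  have "(\<lambda>p. (snd p, (t0, fst p))) -` {p. R (fst p) (snd p)} \<in> sets (borel :: ('a \<times> real) measure)"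
    by (rule measurable_sets_borel[OF borel_measurable_continuous_onI R_sets]) (auto intro!: continuous_intros)
  then have "{p. R (snd p) (t0, fst p)} \<in> sets borel" by (simp add: vimage_def)
  from AE_lborel_swap[OF t0(2) this] have "AE s in lborel. AE x in lborel. R s (t0, x)" .
  from AE_lborel_translate[OF this, of "- t0"]
  have slices: "AE t in lborel. AE x in lborel. R (t - t0) (t0, x)" by simp
  define E0 where "E0 = {y. (t0, y + t0 *\<^sub>R v) \<in> E}"
  have "E0 \<in> sets borel"
    unfolding E0_def by (auto intro!: borel_preimage_continuous continuous_intros)
  moreover have "AE t in lborel. t > 0 \<longrightarrow> (AE x in lborel. (t, x) \<in> E \<longleftrightarrow> x - t *\<^sub>R v \<in> E0)"
    using slices
  proof eventually_elim
    case (elim t)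
    show ?case
    proof
      assume "t > 0"
      from AE_lborel_translate[OF elim, of "- (t - t0) *\<^sub>R v"]
      show "AE x in lborel. (t, x) \<in> E \<longleftrightarrow> x - t *\<^sub>R v \<in> E0"
        by eventually_elim (use \<open>t > 0\<close> t0(1) in \<open>simp add: R_def E0_def algebra_simps\<close>)
    qed
  qed
  ultimately show ?thesis using that by blast
qed

text \<open>The monotonicity is inherited by the profile because it holds, by Fubini, on some time slice that
  agrees with the translated profile.\<close>

proposition two_state_entropy_solution_profile:
  fixes f :: "real \<Rightarrow> real ^ 'd"
  assumes sol: "entropy_solution f u" and "up < um"
    and two: "AE z in lebesgue_on half_space_time. u z \<in> {um, up}"
  obtains E0 where "E0 \<in> sets borel"
    "AE z in lebesgue_on half_space_time. u z = (if snd z - fst z *\<^sub>R shock_velocity f um up \<in> E0 then um else up)"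
    "\<And>k s. up < k \<Longrightarrow> k < um \<Longrightarrow> s \<ge> 0 \<Longrightarrow>
       AE x in lborel. x + s *\<^sub>R (moving_flux f um up up - moving_flux f um up k) \<in> E0 \<longrightarrow> x \<in> E0"
proof -
  let ?v = "shock_velocity f um up"
  have "u \<in> borel_measurable (lebesgue_on half_space_time)" using sol by (simp add: entropy_solution_def)
  from two_state_borel_set[OF this two] obtain E where E[measurable]: "E \<in> sets borel"
    and uE: "AE z in lborel. z \<in> half_space_time \<longrightarrow> u z = (if z \<in> E then um else up)" .
  note dir = two_state_AE_along_directions[OF sol E \<open>up < um\<close> uE]
  obtain E0 where E0[measurable]: "E0 \<in> sets borel" and slices:
    "AE t in lborel. t > 0 \<longrightarrow> (AE x in lborel. (t, x) \<in> E \<longleftrightarrow> x - t *\<^sub>R ?v \<in> E0)"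
    using AE_invariant_set_is_travelling[OF E dir(1)[unfolded half_space_time_def]] by blast
  have "AE z in lborel \<Otimes>\<^sub>M lborel. fst z > 0 \<longrightarrow> (z \<in> E \<longleftrightarrow> snd z - fst z *\<^sub>R ?v \<in> E0)"
  proof (rule lborel_pair.AE_pair_measure)
    define A where "A = {x :: real \<times> (real ^ 'd). fst x > 0}"
    define B where "B = {x :: real \<times> (real ^ 'd). snd x - fst x *\<^sub>R ?v \<in> E0}"
    have "A \<in> sets borel" unfolding A_def
      by (auto intro!: borel_open open_Collect_less continuous_intros)
    moreover have "B \<in> sets borel" unfolding B_def
      by (rule borel_preimage_continuous[OF _ E0]) (auto intro!: continuous_intros)
    ultimately have "(- A) \<union> (E \<inter> B) \<union> (- E \<inter> - B) \<in> sets borel" by auto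
    also have "(- A) \<union> (E \<inter> B) \<union> (- E \<inter> - B) =
        {x. fst x > 0 \<longrightarrow> (x \<in> E \<longleftrightarrow> snd x - fst x *\<^sub>R ?v \<in> E0)}" by (auto simp: A_def B_def)
    finally have "{x. fst x > 0 \<longrightarrow> (x \<in> E \<longleftrightarrow> snd x - fst x *\<^sub>R ?v \<in> E0)} \<in> sets borel" .
    then show "{x \<in> space (lborel \<Otimes>\<^sub>M lborel). fst x > 0 \<longrightarrow> (x \<in> E \<longleftrightarrow> snd x - fst x *\<^sub>R ?v \<in> E0)}
        \<in> sets (lborel \<Otimes>\<^sub>M lborel)" unfolding lborel_prod by simp
    show "AE t in lborel. AE x in lborel. fst (t, x) > 0 \<longrightarrow> ((t, x) \<in> E \<longleftrightarrow> snd (t, x) - fst (t, x) *\<^sub>R ?v \<in> E0)"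
      using slices by eventually_elim simp
  qed
  then have "AE z in lborel. fst z > 0 \<longrightarrow> (z \<in> E \<longleftrightarrow> snd z - fst z *\<^sub>R ?v \<in> E0)"
    unfolding lborel_prod .
  with uE have "AE z in lborel. z \<in> half_space_time \<longrightarrow> u z = (if snd z - fst z *\<^sub>R ?v \<in> E0 then um else up)"
    by eventually_elim (auto simp: half_space_time_def)
  moreover have "AE x in lborel. x + s *\<^sub>R (moving_flux f um up up - moving_flux f um up k) \<in> E0 \<longrightarrow> x \<in> E0"
    if k: "up < k" "k < um" "s \<ge> 0" for k s
  proof -
    let ?w = "s *\<^sub>R (moving_flux f um up up - moving_flux f um up k)"
    have "AE z in lborel \<Otimes>\<^sub>M lborel. z \<in> half_space_time \<longrightarrow> z + s *\<^sub>R (0, moving_flux f um up up - moving_flux f um up k) \<in> E \<longrightarrow> z \<in> E"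
      using dir(2)[OF k(3,1,2)] unfolding lborel_prod .
    then have "AE t in lborel. AE x in lborel. t > 0 \<longrightarrow> (t, x + ?w) \<in> E \<longrightarrow> (t, x) \<in> E"
      by (rule lborel_pair.AE_pair[THEN eventually_mono]) (simp add: half_space_time_def)
    with slices have "AE t in lborel. t > 0 \<longrightarrow>
        (AE x in lborel. (t, x) \<in> E \<longleftrightarrow> x - t *\<^sub>R ?v \<in> E0) \<and> (AE x in lborel. (t, x + ?w) \<in> E \<longrightarrow> (t, x) \<in> E)"
      by eventually_elim simp
    then obtain t where t: "t > 0" "AE x in lborel. (t, x) \<in> E \<longleftrightarrow> x - t *\<^sub>R ?v \<in> E0"
      "AE x in lborel. (t, x + ?w) \<in> E \<longrightarrow> (t, x) \<in> E"
      using AE_lborel_positive_witness by blast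
    from AE_lborel_translate[OF t(2), of ?w] t(2,3)
    have "AE x in lborel. x + ?w - t *\<^sub>R ?v \<in> E0 \<longrightarrow> x - t *\<^sub>R ?v \<in> E0"
      by eventually_elim simp
    from AE_lborel_translate[OF this, of "t *\<^sub>R ?v"] show ?thesis
      by eventually_elim (simp add: algebra_simps)
  qed
  ultimately show ?thesis using that[OF E0] by (simp add: AE_lebesgue_on_half_space_time)
qed

section \<open>The cone generated by the directions of monotonicity\<close>

text \<open>The directions along which \<open>E\<close> decreases, with all their nonnegative multiples, are closed under
  addition: a translation along \<open>n + m\<close> is one along \<open>n\<close> followed by one along \<open>m\<close>.\<close>

lemma convex_cone_hull_AE_decreasing:
  fixes E :: "'a::euclidean_space set"
  assumes W: "\<And>w s. w \<in> W \<Longrightarrow> s \<ge> 0 \<Longrightarrow> AE x in lborel. x + s *\<^sub>R w \<in> E \<longrightarrow> x \<in> E"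
    and n: "n \<in> convex_cone hull W"
  shows "AE x in lborel. x + n \<in> E \<longrightarrow> x \<in> E"
proof -
  define M where "M = {n. \<forall>s\<ge>0. AE x in lborel. x + s *\<^sub>R n \<in> E \<longrightarrow> x \<in> E}"
  have "convex_cone M"
    unfolding convex_cone_iff
  proof (intro conjI ballI allI impI)
    show "0 \<in> M" by (simp add: M_def)
  next
    fix n m assume nm: "n \<in> M" "m \<in> M"
    show "n + m \<in> M" unfolding M_def
    proof (intro CollectI allI impI)
      fix s :: real assume "s \<ge> 0"
      with nm have "AE x in lborel. x + s *\<^sub>R n \<in> E \<longrightarrow> x \<in> E"
        "AE x in lborel. x + s *\<^sub>R n + s *\<^sub>R m \<in> E \<longrightarrow> x + s *\<^sub>R n \<in> E"
        by (auto simp: M_def intro: AE_lborel_translate[of "\<lambda>x. x + s *\<^sub>R m \<in> E \<longrightarrow> x \<in> E"])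
      then show "AE x in lborel. x + s *\<^sub>R (n + m) \<in> E \<longrightarrow> x \<in> E"
        by eventually_elim (simp add: algebra_simps)
    qed
  next
    fix n and c :: real assume "n \<in> M" "c \<ge> 0"
    then show "c *\<^sub>R n \<in> M" by (auto simp: M_def)
  qed
  moreover have "W \<subseteq> M" using W by (auto simp: M_def)
  ultimately have "convex_cone hull W \<subseteq> M" by (rule hull_minimal[rotated])
  with n have "n \<in> M" by blast
  then have "AE x in lborel. x + 1 *\<^sub>R n \<in> E \<longrightarrow> x \<in> E" unfolding M_def using zero_le_one by blast
  then show ?thesis by simp
qed

text \<open>The cone of admissible directions is the polar of the vectors \<open>F(u\<^sub>+) - F(k)\<close>, so by the
  bipolar theorem its dual cone is the closed convex cone that they generate.\<close>

definition flux_drops :: "(real \<Rightarrow> real ^ 'd) \<Rightarrow> real \<Rightarrow> real \<Rightarrow> (real ^ 'd) set" where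
  "flux_drops f um up = (\<lambda>k. moving_flux f um up up - moving_flux f um up k) ` {up<..<um}"

lemma admissible_cone_iff: "\<xi> \<in> admissible_cone f um up \<longleftrightarrow> (\<forall>w\<in>flux_drops f um up. 0 \<le> \<xi> \<bullet> w)"
  by (auto simp: admissible_cone_def flux_drops_def inner_diff_right)

lemma dual_cone_subset_closure_hull:
  "dual_cone (admissible_cone f um up) \<subseteq> closure (convex_cone hull flux_drops f um up)"
proof
  let ?C = "convex_cone hull flux_drops f um up"
  fix n assume n: "n \<in> dual_cone (admissible_cone f um up)"
  show "n \<in> closure ?C"
  proof (rule ccontr)
    assume "n \<notin> closure ?C"
    then obtain a b where ab: "a \<bullet> n < b" "\<And>x. x \<in> closure ?C \<Longrightarrow> a \<bullet> x > b"
      using separating_hyperplane_closed_point[of "closure ?C" n]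
      by (auto simp: convex_closure convex_convex_cone_hull)
    have b: "a \<bullet> x > b" if "x \<in> ?C" for x using ab(2) closure_subset[of ?C] that by blast
    have "b < 0" using b[OF convex_cone_hull_contains_0] by simp
    have "0 \<le> a \<bullet> w" if "w \<in> flux_drops f um up" for w
    proof (rule ccontr)
      assume "\<not> 0 \<le> a \<bullet> w"
      then have neg: "a \<bullet> w < 0" by simp
      have "(b / (a \<bullet> w)) *\<^sub>R w \<in> ?C"
        using that neg \<open>b < 0\<close> by (intro convex_cone_hull_mul hull_inc) (auto intro: divide_nonpos_nonpos)
      from b[OF this] show False using neg by simp
    qed
    then have "a \<in> admissible_cone f um up" by (simp add: admissible_cone_iff)
    then have "0 \<le> a \<bullet> n" using n by (simp add: dual_cone_def inner_commute)
    then show False using ab(1) \<open>b < 0\<close> by simp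
  qed
qed

lemma interior_dual_cone_subset:
  "interior (dual_cone (admissible_cone f um up)) \<subseteq> interior (convex_cone hull flux_drops f um up)"
  using interior_mono[OF dual_cone_subset_closure_hull] convex_interior_closure[OF convex_convex_cone_hull]
  by blast

text \<open>If the vectors \<open>F(u\<^sub>+) - F(k)\<close> were contained in a hyperplane orthogonal to \<open>a\<close>, then
  \<open>a \<bullet> f'\<close> would be constant on an interval.\<close>

lemma interior_flux_drops_hull_nonempty:
  fixes f :: "real \<Rightarrow> real ^ 'd"
  assumes "smooth f" "nondegenerate f" "up < um"
  shows "interior (convex_cone hull flux_drops f um up) \<noteq> {}"
proof
  assume "interior (convex_cone hull flux_drops f um up) = {}"
  then obtain a b where a: "a \<noteq> 0" "convex_cone hull flux_drops f um up \<subseteq> {x. a \<bullet> x = b}"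
    using empty_interior_subset_hyperplane[OF convex_convex_cone_hull] by blast
  have "b = 0" using a(2) convex_cone_hull_contains_0[of "flux_drops f um up"] by auto
  have eq: "a \<bullet> moving_flux f um up k = a \<bullet> moving_flux f um up up" if "k \<in> {up<..<um}" for k
  proof -
    have "moving_flux f um up up - moving_flux f um up k \<in> convex_cone hull flux_drops f um up"
      using that by (intro hull_inc) (auto simp: flux_drops_def)
    with a(2) \<open>b = 0\<close> have "a \<bullet> (moving_flux f um up up - moving_flux f um up k) = 0" by auto
    then show ?thesis by (simp add: inner_diff_right)
  qed
  let ?v = "shock_velocity f um up"
  have f: "(f has_vector_derivative vector_derivative f (at s)) (at s)" for s
  proof -
    have "Cn 1 f" using \<open>smooth f\<close> by (simp add: smooth_def)
    then show ?thesis by (simp add: vector_derivative_works)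
  qed
  have "- (a \<bullet> ?v) + vector_derivative f (at s) \<bullet> a = 0" if s: "s \<in> {up<..<um}" for s
  proof -
    have "((\<lambda>s. a \<bullet> moving_flux f um up s) has_vector_derivative a \<bullet> (vector_derivative f (at s) - ?v)) (at s)"
      unfolding moving_flux_def
      by (intro bounded_linear.has_vector_derivative[OF bounded_linear_inner_right])
        (auto intro!: derivative_eq_intros f)
    moreover have "((\<lambda>s. a \<bullet> moving_flux f um up s) has_vector_derivative 0) (at s)"
      by (rule has_vector_derivative_transform_within_open[OF has_vector_derivative_const, of "{up<..<um}"])
        (use s eq in auto)
    ultimately have "a \<bullet> (vector_derivative f (at s) - ?v) = 0"
      by (rule vector_derivative_unique_at)
    then show ?thesis by (simp add: inner_diff_right inner_commute)
  qed
  then have sub: "{up<..<um} \<subseteq> {s. - (a \<bullet> ?v) + vector_derivative f (at s) \<bullet> a = 0}" by auto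
  have "{s. - (a \<bullet> ?v) + vector_derivative f (at s) \<bullet> a = 0} \<in> null_sets lebesgue"
    using assms(2) a(1) unfolding nondegenerate_def by blast
  from null_sets_subset[OF this _ sub] have "{up<..<um} \<in> null_sets lebesgue" by simp
  then show False using \<open>up < um\<close> by (auto simp: null_sets_def)
qed

section \<open>Sets that are monotone with respect to an open cone of directions\<close>

text \<open>The interior in the sense of measure theory, which depends only on the class of \<open>E\<close> modulo null
  sets. Outside \<open>essential_interior E \<union> essential_interior (- E)\<close> lie the points near which \<open>E\<close> and its
  complement both have positive measure.\<close>

definition essential_interior :: "'a::euclidean_space set \<Rightarrow> 'a set" where
  "essential_interior E = {x. \<exists>r>0. AE y in lborel. y \<in> ball x r \<longrightarrow> y \<in> E}"

lemma open_essential_interior: "open (essential_interior E)"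
  unfolding open_dist
proof
  fix x assume "x \<in> essential_interior E"
  then obtain r where r: "r > 0" "AE y in lborel. y \<in> ball x r \<longrightarrow> y \<in> E" by (auto simp: essential_interior_def)
  show "\<exists>e>0. \<forall>y. dist y x < e \<longrightarrow> y \<in> essential_interior E"
  proof (intro exI[of _ "r/2"] conjI allI impI)
    fix y assume "dist y x < r / 2"
    then have "ball y (r/2) \<subseteq> ball x r"
      by (intro subsetI) (metis dist_commute dist_triangle_half_l mem_ball)
    with r(2) have "AE z in lborel. z \<in> ball y (r/2) \<longrightarrow> z \<in> E"
      by (auto elim!: eventually_mono)
    then show "y \<in> essential_interior E" using r(1)
      unfolding essential_interior_def by (intro CollectI exI[of _ "r/2"]) auto
  qed (use r in auto)
qed

lemma essential_interior_disjoint: "essential_interior E \<inter> essential_interior (- E) = {}"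
proof (rule ccontr)
  assume "essential_interior E \<inter> essential_interior (- E) \<noteq> {}"
  then obtain x r s where rs: "r > 0" "s > 0" "AE y in lborel. y \<in> ball x r \<longrightarrow> y \<in> E"
    "AE y in lborel. y \<in> ball x s \<longrightarrow> y \<in> - E"
    by (auto simp: essential_interior_def)
  from rs(3,4) have "AE y in lborel. y \<notin> ball x (min r s)"
    by eventually_elim auto
  then have "emeasure lborel (ball x (min r s)) = 0"
    by (subst (asm) AE_iff_measurable[of "ball x (min r s)"]) auto
  then have "measure lebesgue (ball x (min r s)) = 0" by (simp add: measure_def)
  then show False using content_ball_pos[of "min r s" x] rs(1,2) by simp
qed

text \<open>By Lindelof, countably many balls on which \<open>E\<close> has full measure cover the essential interior.\<close>

lemma AE_essential_interior: "AE x in lborel. x \<in> essential_interior E \<longrightarrow> x \<in> E"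
proof -
  let ?\<B> = "{b. \<exists>x r. b = ball x r \<and> (AE y in lborel. y \<in> ball x r \<longrightarrow> y \<in> E)}"
  obtain \<C> where C: "\<C> \<subseteq> ?\<B>" "countable \<C>" "\<Union> \<C> = \<Union> ?\<B>"
    using Lindelof[of ?\<B>] by (auto simp: open_ball)
  have "AE y in lborel. \<forall>b\<in>\<C>. y \<in> b \<longrightarrow> y \<in> E"
    using C(1,2) by (intro AE_ball_countable[THEN iffD2]) auto
  then show ?thesis
  proof eventually_elim
    case (elim y)
    show ?case
    proof
      assume "y \<in> essential_interior E"
      then obtain r where "r > 0" "AE z in lborel. z \<in> ball y r \<longrightarrow> z \<in> E"
        by (auto simp: essential_interior_def)
      then have "y \<in> \<Union> ?\<B>" by (intro UnionI[of "ball y r"]) auto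
      then have "y \<in> \<Union> \<C>" unfolding C(3) .
      then show "y \<in> E" using elim by auto
    qed
  qed
qed

text \<open>If \<open>E\<close> charges every ball around \<open>x\<close>, then by Fubini some point \<open>z\<close> of \<open>E\<close> near \<open>x\<close> has
  almost all of its translates by vectors of the cone in \<open>E\<close>; these translates fill a ball
  around \<open>x + n\<close>.\<close>

lemma essential_interior_translate:
  fixes E :: "'a::euclidean_space set"
  assumes E[measurable]: "E \<in> sets borel" and "r > 0"
    and mono: "\<And>m. m \<in> ball n (2 * r) \<Longrightarrow> AE x in lborel. x \<in> E \<longrightarrow> x + m \<in> E"
    and x: "x \<notin> essential_interior (- E)"
  shows "x + n \<in> essential_interior E"
proof -
  have ae: "AE z in lborel. AE m in lborel. m \<in> ball n (2 * r) \<and> z \<in> E \<longrightarrow> z + m \<in> E"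
  proof (rule AE_lborel_swap[OF AE_I2])
    show "AE z in lborel. m \<in> ball n (2 * r) \<and> z \<in> E \<longrightarrow> z + m \<in> E" for m
      using mono[of m] by (cases "m \<in> ball n (2 * r)") auto
    have "{p :: 'a \<times> 'a. fst p \<in> ball n (2 * r)} \<in> sets borel" "{p :: 'a \<times> 'a. snd p \<in> E} \<in> sets borel"
      "{p :: 'a \<times> 'a. snd p + fst p \<in> E} \<in> sets borel"
      by (rule borel_preimage_continuous; auto intro!: continuous_intros)+
    then have "(- {p :: 'a \<times> 'a. fst p \<in> ball n (2 * r)}) \<union> (- {p. snd p \<in> E}) \<union> {p. snd p + fst p \<in> E} \<in> sets borel"
      by auto
    also have "(- {p :: 'a \<times> 'a. fst p \<in> ball n (2 * r)}) \<union> (- {p. snd p \<in> E}) \<union> {p. snd p + fst p \<in> E}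
      = {p. fst p \<in> ball n (2 * r) \<and> snd p \<in> E \<longrightarrow> snd p + fst p \<in> E}" by auto
    finally show "{p. fst p \<in> ball n (2 * r) \<and> snd p \<in> E \<longrightarrow> snd p + fst p \<in> E} \<in> sets borel" .
  qed
  have "\<exists>z. z \<in> ball x r \<and> z \<in> E \<and> (AE m in lborel. m \<in> ball n (2 * r) \<and> z \<in> E \<longrightarrow> z + m \<in> E)"
  proof (rule ccontr)
    assume "\<not> ?thesis"
    with ae have "AE z in lborel. z \<in> ball x r \<longrightarrow> z \<in> - E"
      by (auto elim!: eventually_mono)
    then show False using x \<open>r > 0\<close> by (auto simp: essential_interior_def)
  qed
  then obtain z where z: "z \<in> ball x r" "z \<in> E" "AE m in lborel. m \<in> ball n (2 * r) \<and> z \<in> E \<longrightarrow> z + m \<in> E"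
    by blast
  have "AE y in lborel. y \<in> ball (x + n) r \<longrightarrow> y \<in> E"
    using AE_lborel_translate[OF z(3), of "- z"]
  proof eventually_elim
    case (elim y)
    show ?case
    proof
      assume "y \<in> ball (x + n) r"
      then have "norm (y - (x + n)) < r" "norm (x - z) < r"
        using z(1) by (auto simp: dist_norm norm_minus_commute)
      then have "norm ((y - (x + n)) + (x - z)) < 2 * r"
        using norm_triangle_ineq[of "y - (x + n)" "x - z"] by linarith
      then have "y + - z \<in> ball n (2 * r)"
        by (simp add: dist_norm norm_minus_commute algebra_simps)
      then show "y \<in> E" using elim z(2) by simp
    qed
  qed
  then show ?thesis using \<open>r > 0\<close> by (auto simp: essential_interior_def)
qed

text \<open>What is left of a cone-monotone set once null sets are forgotten: \<open>Dm\<close> and \<open>Dp\<close> are open, and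
  each point outside \<open>Dp\<close>, also one on the boundary, has the open cone below it inside \<open>Dm\<close>, and
  symmetrically. From here on the argument is purely geometric.\<close>

locale cone_separated_sets =
  fixes Dm Dp K :: "'a::euclidean_space set"
  assumes open_Dm: "open Dm" and open_Dp: "open Dp" and disjoint: "Dm \<inter> Dp = {}"
    and open_K: "open K" and K_scale: "\<And>n s. n \<in> K \<Longrightarrow> s > 0 \<Longrightarrow> s *\<^sub>R n \<in> K"
    and minus_K: "\<And>x n. x \<notin> Dp \<Longrightarrow> n \<in> K \<Longrightarrow> x - n \<in> Dm"
    and plus_K: "\<And>x n. x \<notin> Dm \<Longrightarrow> n \<in> K \<Longrightarrow> x + n \<in> Dp"

text \<open>Complementation reverses the direction of monotonicity, so both inclusions are instances of
  \<open>essential_interior_translate\<close>.\<close>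

proposition cone_monotone_set_separates:
  fixes E :: "'a::euclidean_space set"
  assumes E: "E \<in> sets borel"
    and mono: "\<And>n. n \<in> convex_cone hull W \<Longrightarrow> AE x in lborel. x + n \<in> E \<longrightarrow> x \<in> E"
  shows "cone_separated_sets (essential_interior E) (essential_interior (- E)) (interior (convex_cone hull W))"
proof
  let ?C = "convex_cone hull W"
  show "open (essential_interior E)" "open (essential_interior (- E))" "open (interior ?C)"
    by (auto intro: open_essential_interior)
  show "essential_interior E \<inter> essential_interior (- E) = {}" by (rule essential_interior_disjoint)
  show "s *\<^sub>R n \<in> interior ?C" if "n \<in> interior ?C" "s > 0" for n s
  proof -
    obtain r where "r > 0" "ball n r \<subseteq> ?C" using \<open>n \<in> interior ?C\<close> by (auto simp: mem_interior)
    have "ball (s *\<^sub>R n) (s * r) \<subseteq> ?C"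
    proof
      fix y assume "y \<in> ball (s *\<^sub>R n) (s * r)"
      then have "norm (s *\<^sub>R (n - y /\<^sub>R s)) < s * r" using \<open>s > 0\<close> by (simp add: dist_norm scaleR_diff_right)
      then have "y /\<^sub>R s \<in> ball n r" using \<open>s > 0\<close> by (simp add: dist_norm)
      then have "y /\<^sub>R s \<in> ?C" using \<open>ball n r \<subseteq> ?C\<close> by blast
      with \<open>s > 0\<close> have "s *\<^sub>R (y /\<^sub>R s) \<in> ?C"
        using convex_cone_hull_mul less_imp_le by blast
      then show "y \<in> ?C" using \<open>s > 0\<close> by simp
    qed
    then show ?thesis using \<open>r > 0\<close> \<open>s > 0\<close> by (auto simp: mem_interior intro!: exI[of _ "s * r"])
  qed
  fix x n assume n: "n \<in> interior ?C"
  then obtain r where "r > 0" "ball n r \<subseteq> ?C" by (auto simp: mem_interior)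
  define \<rho> where "\<rho> = r / 2"
  have \<rho>: "\<rho> > 0" "ball n (2 * \<rho>) \<subseteq> ?C" using \<open>r > 0\<close> \<open>ball n r \<subseteq> ?C\<close> by (auto simp: \<rho>_def)
  show "x - n \<in> essential_interior E" if "x \<notin> essential_interior (- E)"
  proof -
    have "x + (- n) \<in> essential_interior E"
    proof (rule essential_interior_translate[OF E \<rho>(1) _ that])
      fix m assume "m \<in> ball (- n) (2 * \<rho>)"
      then have "- m \<in> ?C" using \<rho>(2) by (auto simp: dist_norm norm_minus_commute add.commute dest!: subsetD[of _ _ "- m"])
      from AE_lborel_translate[OF mono[OF this], of m]
      show "AE x in lborel. x \<in> E \<longrightarrow> x + m \<in> E" by simp
    qed
    then show ?thesis by simp
  qed
  show "x + n \<in> essential_interior (- E)" if "x \<notin> essential_interior E"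
  proof (rule essential_interior_translate[OF _ \<rho>(1)])
    show "- E \<in> sets borel" using E by auto
    show "x \<notin> essential_interior (- (- E))" using that by simp
    fix m assume "m \<in> ball n (2 * \<rho>)"
    then have "m \<in> ?C" using \<rho>(2) by auto
    from mono[OF this] show "AE x in lborel. x \<in> - E \<longrightarrow> x + m \<in> - E"
      by eventually_elim auto
  qed
qed

context cone_separated_sets
begin

abbreviation \<Gamma> :: "'a set" where "\<Gamma> \<equiv> - (Dm \<union> Dp)"

lemma eventually_in_K:
  fixes z
  assumes "W \<in> K"
  obtains T where "T > 0" "\<And>t. t \<ge> T \<Longrightarrow> t *\<^sub>R W + z \<in> K"
proof -
  obtain r where r: "r > 0" "ball W r \<subseteq> K" using open_K assms open_contains_ball by blast
  show ?thesis
  proof (rule that[of "norm z / r + 1"])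
    show "norm z / r + 1 > 0" using r(1) by (simp add: add_nonneg_pos)
    fix t :: real assume t: "t \<ge> norm z / r + 1"
    then have "t > 0" using r(1) by (meson add_nonneg_pos divide_nonneg_pos less_le_trans norm_ge_zero zero_less_one)
    have "norm z / r < t" using t by simp
    then have "norm (z /\<^sub>R t) < r" using r(1) \<open>t > 0\<close> by (simp add: field_simps)
    then have "W + z /\<^sub>R t \<in> K" using r(2) by (auto simp: dist_norm)
    from K_scale[OF this \<open>t > 0\<close>] show "t *\<^sub>R W + z \<in> K"
      using \<open>t > 0\<close> by (simp add: scaleR_add_right)
  qed
qed

lemma mem_translate_iff: "x \<in> (\<lambda>x. x + s *\<^sub>R W) ` Dm \<longleftrightarrow> x - s *\<^sub>R W \<in> Dm"
  by (force simp: image_iff)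

lemma Dm_translates_mono:
  assumes "W \<in> K"
  shows "mono (\<lambda>s::real. (\<lambda>x. x + s *\<^sub>R W) ` Dm)"
proof (intro monoI subsetI)
  fix s t :: real and x assume "s \<le> t" "x \<in> (\<lambda>x. x + s *\<^sub>R W) ` Dm"
  then have x: "x - s *\<^sub>R W \<in> Dm" "s = t \<or> t - s > 0" by (auto simp: mem_translate_iff)
  then have "t - s > 0 \<Longrightarrow> x - s *\<^sub>R W - (t - s) *\<^sub>R W \<in> Dm"
    using disjoint assms by (intro minus_K K_scale) auto
  then show "x \<in> (\<lambda>x. x + t *\<^sub>R W) ` Dm"
    using x by (auto simp: mem_translate_iff algebra_simps)
qed

lemma Dm_translates_Inter_Union:
  assumes "W \<in> K" "p \<in> \<Gamma>"
  shows "(\<Inter>s::real. (\<lambda>x. x + s *\<^sub>R W) ` Dm) = {}"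
    and "(\<Union>s::real. (\<lambda>x. x + s *\<^sub>R W) ` Dm) = UNIV"
proof -
  have "\<exists>s. x - s *\<^sub>R W \<notin> Dm" for x
  proof -
    obtain T where "\<And>t. t \<ge> T \<Longrightarrow> t *\<^sub>R W + (x - p) \<in> K" by (rule eventually_in_K[OF assms(1), of "x - p"]) blast
    from plus_K[OF _ this[OF order_refl], of p] have "x - (- T) *\<^sub>R W \<in> Dp"
      using assms(2) by (simp add: add.commute)
    then show ?thesis using disjoint by blast
  qed
  then show "(\<Inter>s::real. (\<lambda>x. x + s *\<^sub>R W) ` Dm) = {}" by (simp add: set_eq_iff mem_translate_iff)
  have "\<exists>s. x - s *\<^sub>R W \<in> Dm" for x
  proof -
    obtain T where "\<And>t. t \<ge> T \<Longrightarrow> t *\<^sub>R W + (p - x) \<in> K" by (rule eventually_in_K[OF assms(1), of "p - x"]) blast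
    from minus_K[OF _ this[OF order_refl], of p] show ?thesis using assms(2) by (intro exI[of _ T]) (simp add: algebra_simps)
  qed
  then show "(\<Union>s::real. (\<lambda>x. x + s *\<^sub>R W) ` Dm) = UNIV" by (auto simp: mem_translate_iff simp del: image_iff)
qed

end

text \<open>Every line in direction \<open>e\<close> meets \<open>\<Gamma>\<close> exactly once; \<open>\<Phi> x\<close> is the signed distance, measured along
  \<open>e\<close>, from \<open>x\<close> to \<open>\<Gamma>\<close>.\<close>

locale cone_separated_graph = cone_separated_sets +
  fixes e
  assumes e_K: "e \<in> K" and norm_e: "norm e = 1" and \<Gamma>_nonempty: "\<Gamma> \<noteq> {}"
begin

lemma line_meets_\<Gamma>: "\<exists>!t. x + t *\<^sub>R e \<in> \<Gamma>"
proof -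
  obtain p where p: "p \<in> \<Gamma>" using \<Gamma>_nonempty by blast
  have "\<exists>t. x + t *\<^sub>R e \<in> Dp"
  proof -
    obtain T where "T > 0" "\<And>t. t \<ge> T \<Longrightarrow> t *\<^sub>R e + (x - p) \<in> K" by (rule eventually_in_K[OF e_K, of "x - p"]) blast
    then have "T *\<^sub>R e + (x - p) \<in> K" by simp
    from plus_K[OF _ this, of p] show ?thesis using p by (intro exI[of _ T]) (simp add: add.commute)
  qed
  moreover have "\<exists>t. x + t *\<^sub>R e \<in> Dm"
  proof -
    obtain T where "T > 0" "\<And>t. t \<ge> T \<Longrightarrow> t *\<^sub>R e + (p - x) \<in> K" by (rule eventually_in_K[OF e_K, of "p - x"]) blast
    then have "T *\<^sub>R e + (p - x) \<in> K" by simp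
    from minus_K[OF _ this, of p] show ?thesis using p by (intro exI[of _ "- T"]) (simp add: algebra_simps)
  qed
  moreover have "continuous_on UNIV (\<lambda>t::real. x + t *\<^sub>R e)" by (intro continuous_intros)
  then have "open {t. x + t *\<^sub>R e \<in> Dm}" "open {t. x + t *\<^sub>R e \<in> Dp}"
    using open_vimage[OF open_Dm] open_vimage[OF open_Dp] by (auto simp: vimage_def)
  moreover have "{t. x + t *\<^sub>R e \<in> Dm} \<inter> {t. x + t *\<^sub>R e \<in> Dp} = {}" using disjoint by auto
  ultimately have "{t. x + t *\<^sub>R e \<in> Dm} \<union> {t. x + t *\<^sub>R e \<in> Dp} \<noteq> (UNIV :: real set)"
    using connected_UNIV[where 'a = real] unfolding connected_def by blast
  then obtain t where t: "x + t *\<^sub>R e \<in> \<Gamma>" by blast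
  show ?thesis
  proof (rule ex1I[where P = "\<lambda>t. x + t *\<^sub>R e \<in> \<Gamma>", OF t])
    have False if "x + a *\<^sub>R e \<in> \<Gamma>" "x + b *\<^sub>R e \<in> \<Gamma>" "a < b" for a b
    proof -
      have "x + a *\<^sub>R e + (b - a) *\<^sub>R e \<in> Dp"
        using that e_K by (intro plus_K K_scale) auto
      moreover have "x + a *\<^sub>R e + (b - a) *\<^sub>R e = x + b *\<^sub>R e" by (simp add: algebra_simps)
      ultimately show False using that by simp
    qed
    then show "s = t" if "x + s *\<^sub>R e \<in> \<Gamma>" for s using that t by (metis linorder_neqE_linordered_idom)
  qed
qed

definition \<Phi> :: "'a \<Rightarrow> real" where "\<Phi> x = (THE t. x + t *\<^sub>R e \<in> \<Gamma>)"

lemma \<Phi>_in: "x + \<Phi> x *\<^sub>R e \<in> \<Gamma>"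
  unfolding \<Phi>_def by (rule theI'[OF line_meets_\<Gamma>])

lemma \<Phi>_eqI: "x + t *\<^sub>R e \<in> \<Gamma> \<Longrightarrow> \<Phi> x = t"
  using line_meets_\<Gamma>[of x] \<Phi>_in[of x] by blast

lemma \<Phi>_shift: "\<Phi> (x + t *\<^sub>R e) = \<Phi> x - t"
  by (rule \<Phi>_eqI) (use \<Phi>_in[of x] in \<open>simp add: algebra_simps\<close>)

lemma \<Phi>_pos: "\<Phi> x > 0 \<Longrightarrow> x \<in> Dm"
  using minus_K[of "x + \<Phi> x *\<^sub>R e" "\<Phi> x *\<^sub>R e"] \<Phi>_in[of x] K_scale[OF e_K] by simp

lemma \<Phi>_neg: "\<Phi> x < 0 \<Longrightarrow> x \<in> Dp"
  using plus_K[of "x + \<Phi> x *\<^sub>R e" "(- \<Phi> x) *\<^sub>R e"] \<Phi>_in[of x] K_scale[OF e_K, of "- \<Phi> x"] by simp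

lemma \<Phi>_zero: "\<Phi> x = 0 \<Longrightarrow> x \<in> \<Gamma>"
  using \<Phi>_in[of x] by simp

lemma Dm_iff: "x \<in> Dm \<longleftrightarrow> \<Phi> x > 0" and Dp_iff: "x \<in> Dp \<longleftrightarrow> \<Phi> x < 0" and \<Gamma>_iff: "x \<in> \<Gamma> \<longleftrightarrow> \<Phi> x = 0"
  using \<Phi>_pos[of x] \<Phi>_neg[of x] \<Phi>_zero[of x] disjoint by (fastforce elim: linorder_cases[of "\<Phi> x" 0])+

text \<open>If a ball of radius \<open>r\<close> around \<open>e\<close> lies in \<open>K\<close>, a slope of \<open>\<Phi>\<close> above \<open>1/r\<close> would put two
  points of \<open>\<Gamma>\<close> at a difference in \<open>K\<close>.\<close>

lemma \<Phi>_lipschitz: "\<exists>L. L-lipschitz_on UNIV \<Phi>"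
proof -
  obtain r where r: "r > 0" "ball e r \<subseteq> K" using open_K e_K open_contains_ball by blast
  have le: "\<Phi> x - \<Phi> y \<le> norm (x - y) / r" for x y
  proof (rule ccontr)
    assume "\<not> \<Phi> x - \<Phi> y \<le> norm (x - y) / r"
    then have gt: "\<Phi> x - \<Phi> y > norm (x - y) / r" by simp
    define t where "t = \<Phi> x - \<Phi> y"
    have t: "t > 0"
      using gt r(1) unfolding t_def by (intro le_less_trans[of 0 "norm (x - y) / r"]) auto
    have "norm (x - y) < r * t" using gt r(1) by (simp add: t_def pos_divide_less_eq mult.commute)
    then have "norm (x - y) / t < r" using t by (simp add: pos_divide_less_eq)
    then have "norm ((x - y) /\<^sub>R t) < r" using t by (simp add: divide_inverse mult.commute)
    then have "e + (x - y) /\<^sub>R t \<in> K" using r(2) by (auto simp: dist_norm)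
    from K_scale[OF this t] have "t *\<^sub>R e + (x - y) \<in> K" using t by (simp add: scaleR_add_right)
    then have "(y + \<Phi> y *\<^sub>R e) + (t *\<^sub>R e + (x - y)) \<in> Dp" using \<Phi>_in[of y] by (intro plus_K) auto
    moreover have "(y + \<Phi> y *\<^sub>R e) + (t *\<^sub>R e + (x - y)) = x + \<Phi> x *\<^sub>R e" by (simp add: t_def algebra_simps)
    ultimately show False using \<Phi>_in[of x] by simp
  qed
  have "(1/r)-lipschitz_on UNIV \<Phi>"
  proof (rule lipschitz_onI)
    show "dist (\<Phi> x) (\<Phi> y) \<le> 1 / r * dist x y" for x y
      using le[of x y] le[of y x] by (simp add: dist_norm dist_real_def norm_minus_commute abs_le_iff)
  qed (use r in simp)
  then show ?thesis by blast
qed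

lemma \<Phi>_continuous: "continuous_on S \<Phi>"
  using \<Phi>_lipschitz lipschitz_on_continuous_on continuous_on_subset by blast

text \<open>Each side is a continuous image of a half-space: move every point along \<open>e\<close> to a prescribed
  distance from \<open>\<Gamma>\<close>.\<close>

lemma connected_side:
  assumes "c = 1 \<or> c = -1"
  shows "connected {x. 0 < c * \<Phi> x}"
proof -
  have "{x. 0 < c * \<Phi> x} = (\<lambda>(x, s). x + (\<Phi> x - c * s) *\<^sub>R e) ` (UNIV \<times> {0<..})"
  proof (intro set_eqI iffI)
    fix x assume "x \<in> {x. 0 < c * \<Phi> x}"
    then show "x \<in> (\<lambda>(x, s). x + (\<Phi> x - c * s) *\<^sub>R e) ` (UNIV \<times> {0<..})"
      using assms by (intro image_eqI[of _ _ "(x, c * \<Phi> x)"]) auto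
  qed (use assms in \<open>auto simp: \<Phi>_shift\<close>)
  moreover have "connected ((\<lambda>(x, s). x + (\<Phi> x - c * s) *\<^sub>R e) ` (UNIV \<times> {0<..}))"
    by (intro connected_continuous_image convex_connected convex_Times)
      (auto simp: split_beta intro!: continuous_intros continuous_on_compose2[OF \<Phi>_continuous[of UNIV]])
  ultimately show ?thesis by simp
qed

lemma connected_Dm: "connected Dm" and connected_Dp: "connected Dp"
proof -
  have "Dm = {x. 0 < 1 * \<Phi> x}" "Dp = {x. 0 < -1 * \<Phi> x}" by (auto simp: Dm_iff Dp_iff)
  then show "connected Dm" "connected Dp" using connected_side[of 1] connected_side[of "-1"] by metis+
qed

lemma nonempty_Dm: "Dm \<noteq> {}" and nonempty_Dp: "Dp \<noteq> {}"
proof -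
  obtain p where "p \<in> \<Gamma>" using \<Gamma>_nonempty by blast
  then have "\<Phi> p = 0" using \<Gamma>_iff by blast
  then have "\<Phi> (p + (-1) *\<^sub>R e) > 0" "\<Phi> (p + 1 *\<^sub>R e) < 0" unfolding \<Phi>_shift by auto
  then show "Dm \<noteq> {}" "Dp \<noteq> {}" using \<Phi>_pos \<Phi>_neg by blast+
qed

lemma components_complement_\<Gamma>: "components (- \<Gamma>) = {Dm, Dp}"
proof -
  have max: "D = A" if "connected D" "A \<noteq> {}" "A \<subseteq> D" "D \<subseteq> A \<union> B" "open A" "open B" "A \<inter> B = {}" for A B D :: "'a set"
  proof -
    have "A \<inter> D = {} \<or> B \<inter> D = {}"
      using connectedD[OF that(1,5,6)] that by blast
    then show ?thesis using that by blast
  qed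
  have "Dm \<in> components (- \<Gamma>)"
    unfolding in_components_maximal
    using nonempty_Dm connected_Dm max[OF _ nonempty_Dm _ _ open_Dm open_Dp disjoint] by auto
  moreover have "Dp \<in> components (- \<Gamma>)"
    unfolding in_components_maximal
    using nonempty_Dp connected_Dp max[OF _ nonempty_Dp _ _ open_Dp open_Dm] disjoint by auto
  moreover have "C \<in> {Dm, Dp}" if C: "C \<in> components (- \<Gamma>)" for C
  proof -
    have "C \<noteq> {}" "C \<subseteq> Dm \<union> Dp"
      using in_components_nonempty[OF C] in_components_subset[OF C] by auto
    then have "C \<inter> Dm \<noteq> {} \<or> C \<inter> Dp \<noteq> {}" by blast
    then show ?thesis using C calculation components_eq by blast
  qed
  ultimately show ?thesis by blast
qed

lemma \<Gamma>_subset_closures: "\<Gamma> \<subseteq> closure Dm" "\<Gamma> \<subseteq> closure Dp"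
proof -
  have near: "\<exists>y\<in>A. dist y p < \<epsilon>" if "p \<in> \<Gamma>" "\<epsilon> > 0" "p + c *\<^sub>R (\<epsilon> / 2) *\<^sub>R e \<in> A" "\<bar>c\<bar> = 1" for p \<epsilon> c A
    using that norm_e by (intro bexI[of _ "p + c *\<^sub>R (\<epsilon> / 2) *\<^sub>R e"]) (auto simp: dist_norm abs_mult)
  show "\<Gamma> \<subseteq> closure Dm"
  proof (intro subsetI closure_approachable[THEN iffD2] allI impI)
    fix \<epsilon> :: real assume "0 < \<epsilon>"
    fix p assume "p \<in> \<Gamma>"
    then have "\<Phi> p = 0" using \<Gamma>_iff by blast
    then show "\<exists>y\<in>Dm. dist y p < \<epsilon>"
      using near[OF \<open>p \<in> \<Gamma>\<close> \<open>0 < \<epsilon>\<close>, of "-1" Dm] \<open>0 < \<epsilon>\<close> \<Phi>_shift[of p "- (\<epsilon> / 2)"]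
      by (simp add: Dm_iff)
  qed
  show "\<Gamma> \<subseteq> closure Dp"
  proof (intro subsetI closure_approachable[THEN iffD2] allI impI)
    fix \<epsilon> :: real assume "0 < \<epsilon>"
    fix p assume "p \<in> \<Gamma>"
    then have "\<Phi> p = 0" using \<Gamma>_iff by blast
    then show "\<exists>y\<in>Dp. dist y p < \<epsilon>"
      using near[OF \<open>p \<in> \<Gamma>\<close> \<open>0 < \<epsilon>\<close>, of "1" Dp] \<open>0 < \<epsilon>\<close> \<Phi>_shift[of p "\<epsilon> / 2"]
      by (simp add: Dp_iff)
  qed
qed

lemma frontier_Dm: "frontier Dm = \<Gamma>" and frontier_Dp: "frontier Dp = \<Gamma>"
proof -
  have "closure Dm \<inter> Dp = {}" "closure Dp \<inter> Dm = {}"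
    using disjoint open_Int_closure_eq_empty[OF open_Dp, of Dm] open_Int_closure_eq_empty[OF open_Dm, of Dp]
    by (auto simp: Int_commute)
  then show "frontier Dm = \<Gamma>" "frontier Dp = \<Gamma>"
    using \<Gamma>_subset_closures open_Dm open_Dp by (auto simp: frontier_def interior_open)
qed

lemma closed_\<Gamma>: "closed \<Gamma>" using open_Dm open_Dp by (intro closed_Compl open_Un)

text \<open>A derivative of \<open>\<Phi>\<close> at a point of \<open>\<Gamma>\<close> is nonzero, because \<open>\<Phi>\<close> has slope \<open>-1\<close> along \<open>e\<close>. The
  gradient points into \<open>Dm\<close>, where \<open>\<Phi>\<close> is positive, whence the sign.\<close>

lemma derivative_gives_normal:
  assumes p: "p \<in> \<Gamma>" and D: "(\<Phi> has_derivative \<Phi>') (at p)"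
  obtains n where "norm n = 1" "\<And>w. w \<in> closure K \<Longrightarrow> 0 \<le> n \<bullet> w"
    "\<And>\<epsilon>. \<epsilon> > 0 \<Longrightarrow> \<exists>\<delta>>0. \<forall>x\<in>ball p \<delta>.
        (n \<bullet> (x - p) > \<epsilon> * norm (x - p) \<longrightarrow> x \<in> Dp) \<and> (n \<bullet> (x - p) < - \<epsilon> * norm (x - p) \<longrightarrow> x \<in> Dm)"
proof -
  define a where "a = - (\<Sum>i\<in>Basis. \<Phi>' i *\<^sub>R i)"
  have lin: "linear \<Phi>'" using D has_derivative_linear by blast
  have a: "\<Phi>' h = - (a \<bullet> h)" for h
  proof -
    have "\<Phi>' h = \<Phi>' (\<Sum>i\<in>Basis. (h \<bullet> i) *\<^sub>R i)" by (simp add: euclidean_representation)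
    also have "\<dots> = (\<Sum>i\<in>Basis. (h \<bullet> i) * \<Phi>' i)"
      by (simp add: linear_sum[OF lin] linear_scale[OF lin])
    also have "\<dots> = - (a \<bullet> h)" by (simp add: a_def inner_sum_right inner_commute mult.commute)
    finally show ?thesis .
  qed
  have line: "((\<lambda>t. \<Phi> (p + t *\<^sub>R w)) has_real_derivative - (a \<bullet> w)) (at 0)" for w
  proof -
    have "((\<lambda>t::real. p + t *\<^sub>R w) has_derivative (\<lambda>t. t *\<^sub>R w)) (at 0)"
      by (auto intro!: derivative_eq_intros)
    moreover have "(\<Phi> has_derivative \<Phi>') (at (p + 0 *\<^sub>R w))" using D by simp
    ultimately have "((\<lambda>t. \<Phi> (p + t *\<^sub>R w)) has_derivative (\<lambda>t. \<Phi>' (t *\<^sub>R w))) (at 0)"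
      by (rule has_derivative_compose)
    then show ?thesis unfolding has_field_derivative_def
      by (rule has_derivative_eq_rhs) (simp add: a fun_eq_iff)
  qed
  have \<Phi>p: "\<Phi> p = 0" using p \<Gamma>_iff by blast
  have "((\<lambda>t. \<Phi> (p + t *\<^sub>R e)) has_real_derivative - 1) (at 0)"
    unfolding \<Phi>_shift by (auto intro!: derivative_eq_intros)
  with line[of e] have "a \<bullet> e = 1" using DERIV_unique by fastforce
  then have "a \<noteq> 0" by auto
  define n where "n = a /\<^sub>R norm a"
  have K: "0 \<le> a \<bullet> w" if "w \<in> K" for w
  proof (rule ccontr)
    assume "\<not> 0 \<le> a \<bullet> w"
    then have "- (a \<bullet> w) > 0" by simp
    from DERIV_pos_inc_right[OF line this] obtain d where d: "d > 0"
      "\<And>h. h > 0 \<Longrightarrow> h < d \<Longrightarrow> \<Phi> (p + 0 *\<^sub>R w) < \<Phi> (p + (0 + h) *\<^sub>R w)" by blast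
    have "\<Phi> (p + (d / 2) *\<^sub>R w) > 0" using d(2)[of "d/2"] d(1) \<Phi>p by simp
    moreover have "p + (d / 2) *\<^sub>R w \<in> Dp" using p d(1) that by (intro plus_K K_scale) auto
    ultimately show False by (simp add: Dp_iff)
  qed
  have "K \<subseteq> {w. 0 \<le> a \<bullet> w}" using K by auto
  then have "closure K \<subseteq> {w. 0 \<le> a \<bullet> w}"
    by (rule closure_minimal) (use closed_halfspace_ge[of 0 a] in simp)
  show ?thesis
  proof (rule that[of n])
    show "norm n = 1" using \<open>a \<noteq> 0\<close> by (simp add: n_def)
    show "0 \<le> n \<bullet> w" if "w \<in> closure K" for w
      using that \<open>closure K \<subseteq> _\<close> by (auto simp: n_def)
    fix \<epsilon> :: real assume "\<epsilon> > 0"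
    then have "\<epsilon> * norm a > 0" using \<open>a \<noteq> 0\<close> by simp
    then obtain \<delta> where \<delta>: "\<delta> > 0"
      "\<And>y. norm (y - p) < \<delta> \<Longrightarrow> norm (\<Phi> y - \<Phi> p - \<Phi>' (y - p)) \<le> \<epsilon> * norm a * norm (y - p)"
      using D[unfolded has_derivative_at_alt] by blast
    show "\<exists>\<delta>>0. \<forall>x\<in>ball p \<delta>.
        (n \<bullet> (x - p) > \<epsilon> * norm (x - p) \<longrightarrow> x \<in> Dp) \<and> (n \<bullet> (x - p) < - \<epsilon> * norm (x - p) \<longrightarrow> x \<in> Dm)"
    proof (intro exI conjI ballI impI)
      fix x assume x: "x \<in> ball p \<delta>"
      then have est: "\<bar>\<Phi> x + a \<bullet> (x - p)\<bar> \<le> \<epsilon> * norm a * norm (x - p)"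
        using \<delta>(2)[of x] \<Phi>p by (simp add: dist_norm norm_minus_commute a)
      have n: "n \<bullet> (x - p) = a \<bullet> (x - p) / norm a" by (simp add: n_def divide_inverse mult.commute)
      show "x \<in> Dp" if "n \<bullet> (x - p) > \<epsilon> * norm (x - p)"
      proof -
        have "a \<bullet> (x - p) > \<epsilon> * norm a * norm (x - p)"
          using that \<open>a \<noteq> 0\<close> unfolding n by (simp add: pos_less_divide_eq mult.commute mult.left_commute)
        then show ?thesis using est by (simp add: Dp_iff)
      qed
      show "x \<in> Dm" if "n \<bullet> (x - p) < - \<epsilon> * norm (x - p)"
      proof -
        have "a \<bullet> (x - p) < - \<epsilon> * norm a * norm (x - p)"
          using that \<open>a \<noteq> 0\<close> unfolding n by (simp add: pos_divide_less_eq mult.commute mult.left_commute)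
        then show ?thesis using est by (simp add: Dm_iff)
      qed
    qed (rule \<delta>(1))
  qed
qed

end

section \<open>Lipschitz functions are differentiable almost everywhere\<close>

text \<open>\<open>steep G v q\<close> is the set of points \<open>x\<close> with arbitrarily short segments in direction \<open>v\<close>, having
  \<open>x\<close> in the interior, over which the slope of \<open>G\<close> exceeds \<open>q\<close>. Interior points are used, instead of
  end points, because this makes the set a \<open>G\<^sub>\<delta>\<close> and lets it be covered by open balls.\<close>

definition steep :: "('a::real_normed_vector \<Rightarrow> real) \<Rightarrow> 'a \<Rightarrow> real \<Rightarrow> 'a set" where
  "steep G v q = {x. \<forall>n::nat. \<exists>a b. a < 0 \<and> 0 < b \<and> b - a < 1 / real (Suc n) \<and>
     q * (b - a) < G (x + b *\<^sub>R v) - G (x + a *\<^sub>R v)}"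

lemma steepD:
  assumes "x \<in> steep G v q" "d > 0"
  obtains a b where "a < 0" "0 < b" "b - a < d" "q * (b - a) < G (x + b *\<^sub>R v) - G (x + a *\<^sub>R v)"
proof -
  obtain n where "1 / real (Suc n) < d"
    using reals_Archimedean[OF assms(2)] by (auto simp: inverse_eq_divide)
  moreover obtain a b where "a < 0" "0 < b" "b - a < 1 / real (Suc n)"
    "q * (b - a) < G (x + b *\<^sub>R v) - G (x + a *\<^sub>R v)"
    using assms(1) unfolding steep_def by blast
  ultimately show ?thesis using that by (meson less_trans)
qed

lemma not_steepD:
  assumes "x \<notin> steep G v q"
  obtains d where "d > 0" "\<And>a b. a < 0 \<Longrightarrow> 0 < b \<Longrightarrow> b - a < d \<Longrightarrow> G (x + b *\<^sub>R v) - G (x + a *\<^sub>R v) \<le> q * (b - a)"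
proof -
  obtain n where n: "\<not> (\<exists>a b. a < 0 \<and> 0 < b \<and> b - a < 1 / real (Suc n) \<and>
     q * (b - a) < G (x + b *\<^sub>R v) - G (x + a *\<^sub>R v))"
    using assms unfolding steep_def by blast
  show ?thesis
  proof (rule that[of "1 / real (Suc n)"])
    fix a b :: real assume "a < 0" "0 < b" "b - a < 1 / real (Suc n)"
    then show "G (x + b *\<^sub>R v) - G (x + a *\<^sub>R v) \<le> q * (b - a)" using n not_le by blast
  qed simp
qed

lemma steep_borel:
  assumes "continuous_on UNIV G"
  shows "steep G v q \<in> sets borel"
proof -
  define Str where "Str n = (\<Union>a\<in>{..<0}. \<Union>b\<in>{b. 0 < b \<and> b - a < 1 / real (Suc n)}.
      {x. q * (b - a) < G (x + b *\<^sub>R v) - G (x + a *\<^sub>R v)})" for n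
  have "open (Str n)" for n
    unfolding Str_def
    by (intro open_UN ballI open_Collect_less continuous_intros continuous_on_compose2[OF assms]) auto
  then have "(\<Inter>n. Str n) \<in> sets borel" by (intro sets.countable_INT) auto
  also have "(\<Inter>n. Str n) = steep G v q" unfolding Str_def steep_def by (intro set_eqI) (simp, blast)
  finally show ?thesis .
qed

lemma emeasure_interval_measure_ball:
  assumes "mono h" "continuous_on UNIV h" "r > 0"
  shows "emeasure (interval_measure h) (ball c r) = ennreal (h (c + r) - h (c - r))"
proof -
  have "emeasure (interval_measure h) {c - r..c + r} = h (c + r) - h (c - r)"
    and pt: "emeasure (interval_measure h) {c} = 0" for c
    using emeasure_interval_measure_Icc[of "c - r" "c + r" h] emeasure_interval_measure_Icc[of c c h] assms
    by (auto simp: monoD)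
  moreover have "emeasure (interval_measure h) {c - r..c + r} = emeasure (interval_measure h) (ball c r)"
  proof (rule emeasure_eq_AE)
    have "{c - r, c + r} \<in> null_sets (interval_measure h)"
    proof -
      have "{c - r} \<union> {c + r} \<in> null_sets (interval_measure h)"
        using pt[of "c - r"] pt[of "c + r"] by (intro null_sets.Un null_setsI) auto
      then show ?thesis by (simp add: insert_commute)
    qed
    from AE_not_in[OF this] show "AE x in interval_measure h. x \<in> {c - r..c + r} \<longleftrightarrow> x \<in> ball c r"
      by eventually_elim (auto simp: dist_real_def abs_less_iff)
  qed auto
  ultimately show ?thesis by simp
qed

lemma interval_as_ball:
  fixes a b x :: real
  assumes "a < b"
  obtains c r where "c + r = x + b" "c - r = x + a" "2 * r = b - a" "r > 0" "ball c r = {x + a<..<x + b}"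
proof
  show e: "(x + (a + b) / 2) + (b - a) / 2 = x + b" "(x + (a + b) / 2) - (b - a) / 2 = x + a"
    by (simp_all add: field_simps)
  show "ball (x + (a + b) / 2) ((b - a) / 2) = {x + a<..<x + b}"
    unfolding ball_eq_greaterThanLessThan e ..
qed (use assms in auto)

lemma steep_Vitali_cover:
  fixes h :: "real \<Rightarrow> real"
  assumes S: "S \<subseteq> steep h 1 q" "S \<subseteq> U" "open U"
  obtains C :: "(real \<times> real) set" where "countable C"
    "\<And>i. i \<in> C \<Longrightarrow> snd i > 0 \<and> ball (fst i) (snd i) \<subseteq> U \<and> q * (2 * snd i) < h (fst i + snd i) - h (fst i - snd i)"
    "disjoint_family_on (\<lambda>i. ball (fst i) (snd i)) C" "negligible (S - (\<Union>i\<in>C. ball (fst i) (snd i)))"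
proof -
  let ?K = "{i. snd i > 0 \<and> ball (fst i) (snd i) \<subseteq> U \<and> q * (2 * snd i) < h (fst i + snd i) - h (fst i - snd i)}"
  have fine: "\<exists>i. i \<in> ?K \<and> x \<in> ball (fst i) (snd i) \<and> snd i < d" if x: "x \<in> S" "d > 0" for x d
  proof -
    obtain \<rho> where \<rho>: "\<rho> > 0" "ball x \<rho> \<subseteq> U" using S(2,3) x(1) by (meson openE subsetD)
    have xs: "x \<in> steep h 1 q" using x(1) S(1) by blast
    have md: "min d \<rho> > 0" using x(2) \<rho>(1) by simp
    obtain a b where ab: "a < 0" "0 < b" "b - a < min d \<rho>"
      "q * (b - a) < h (x + b *\<^sub>R 1) - h (x + a *\<^sub>R 1)"
      using steepD[OF xs md] by blast
    then have "a < b" by simp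
    obtain c r where cr: "c + r = x + b" "c - r = x + a" "2 * r = b - a" "r > 0"
      "ball c r = {x + a<..<x + b}" by (rule interval_as_ball[OF \<open>a < b\<close>])
    have "{x + a<..<x + b} \<subseteq> ball x \<rho>" using ab(1-3) by (auto simp: dist_real_def abs_less_iff)
    then have "(c, r) \<in> ?K"
      unfolding mem_Collect_eq fst_conv snd_conv cr using ab(4) \<rho>(2) cr(4) by auto
    moreover have "x \<in> ball c r" "r < d" using ab cr by auto
    ultimately show ?thesis by (intro exI[of _ "(c, r)"]) auto
  qed
  obtain C where C: "countable C" "C \<subseteq> ?K"
    "pairwise (\<lambda>i j. disjnt (ball (fst i) (snd i)) (ball (fst j) (snd j))) C"
    "negligible (S - (\<Union>i\<in>C. ball (fst i) (snd i)))"
    by (rule Vitali_covering_theorem_balls[OF fine]) blast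
  show ?thesis
    by (rule that[OF C(1) _ _ C(4)]) (use C(2,3) in \<open>auto simp: disjoint_family_on_def pairwise_def disjnt_def\<close>)
qed

text \<open>This is the one-dimensional core. Let \<open>S\<close> be the set of points where slopes below \<open>p\<close> and slopes
  above \<open>q > p\<close> both occur on arbitrarily short intervals. Vitali's theorem covers \<open>S\<close>, almost
  efficiently, by disjoint intervals with slope below \<open>p\<close>, and then covers \<open>S\<close> again, inside these, by
  disjoint intervals with slope above \<open>q\<close>. The increments of \<open>h\<close> add up to at most \<open>p |S|\<close> and at
  least \<open>q |S|\<close>.\<close>

lemma monotone_two_slopes_null:
  fixes h :: "real \<Rightarrow> real"
  assumes h: "mono h" "continuous_on UNIV h" and pq: "p < q"
  shows "steep h 1 q \<inter> steep (\<lambda>x. - h x) 1 (- p) \<in> null_sets lborel"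
proof (cases "p < 0")
  case True
  have "x \<notin> steep (\<lambda>x. - h x) 1 (- p)" for x
  proof
    assume "x \<in> steep (\<lambda>x. - h x) 1 (- p)"
    then obtain a b where "a < 0" "0 < b" "- p * (b - a) < - h (x + b *\<^sub>R 1) - - h (x + a *\<^sub>R 1)"
      using zero_less_one by (rule steepD)
    moreover have "h (x + a *\<^sub>R 1) \<le> h (x + b *\<^sub>R 1)" using \<open>a < 0\<close> \<open>0 < b\<close> by (intro monoD[OF h(1)]) auto
    moreover have "- p * (b - a) > 0" using True \<open>a < 0\<close> \<open>0 < b\<close> by (intro mult_pos_pos) auto
    ultimately show False by simp
  qed
  then have "steep (\<lambda>x. - h x) 1 (- p) = {}" by blast
  then show ?thesis by simp
next
  case False
  then have p: "p \<ge> 0" "q > 0" using pq by auto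
  let ?\<mu> = "interval_measure h"
  let ?B = "\<lambda>i. ball (fst i) (snd i) :: real set"
  have null: "steep h 1 q \<inter> steep (\<lambda>x. - h x) 1 (- p) \<inter> ball 0 R \<in> null_sets lborel" for R
  proof -
    define S where "S = steep h 1 q \<inter> steep (\<lambda>x. - h x) 1 (- p) \<inter> ball 0 R"
    have S_borel: "S \<in> sets borel"
      unfolding S_def using h(2) by (intro sets.Int steep_borel continuous_intros) auto
    have "bounded S" unfolding S_def by (intro bounded_Int disjI2 bounded_ball)
    then have mS: "emeasure lborel S = ennreal (measure lborel S)"
      using emeasure_bounded_finite[OF \<open>bounded S\<close>] by (intro emeasure_eq_ennreal_measure) auto
    have key: "q * measure lborel S \<le> p * (measure lborel S + \<epsilon>)" if "\<epsilon> > 0" for \<epsilon>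
    proof -
      obtain U where U: "open U" "S \<subseteq> U" "emeasure lborel (U - S) < ennreal \<epsilon>"
        by (rule outer_regular_lborel[OF S_borel \<open>\<epsilon> > 0\<close>])
      have S12: "S \<subseteq> steep h 1 q" "S \<subseteq> steep (\<lambda>x. - h x) 1 (- p)" by (auto simp: S_def)
      obtain C1 where C1: "countable C1"
        "\<And>i. i \<in> C1 \<Longrightarrow> snd i > 0 \<and> ?B i \<subseteq> U \<and> - p * (2 * snd i) < - h (fst i + snd i) - - h (fst i - snd i)"
        "disjoint_family_on ?B C1" "negligible (S - (\<Union>i\<in>C1. ?B i))"
        by (rule steep_Vitali_cover[OF S12(2) U(2,1)]) blast
      have C1_open: "open (\<Union>i\<in>C1. ?B i)" by auto
      have "S \<inter> (\<Union>i\<in>C1. ?B i) \<subseteq> steep h 1 q" using S12(1) by blast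
      from steep_Vitali_cover[OF this Int_lower2 C1_open] obtain C2 where C2: "countable C2"
        "\<And>i. i \<in> C2 \<Longrightarrow> snd i > 0 \<and> ?B i \<subseteq> (\<Union>i\<in>C1. ?B i) \<and> q * (2 * snd i) < h (fst i + snd i) - h (fst i - snd i)"
        "disjoint_family_on ?B C2" "negligible (S \<inter> (\<Union>i\<in>C1. ?B i) - (\<Union>i\<in>C2. ?B i))"
        by blast
      have sum: "emeasure M (\<Union>i\<in>C. ?B i) = (\<integral>\<^sup>+i. emeasure M (?B i) \<partial>count_space C)"
        if "C \<in> {C1, C2}" "sets M = sets borel" for C M
        using that C1(1,3) C2(1,3) by (intro emeasure_UN_countable) auto
      have len: "emeasure lborel (?B i) = ennreal (2 * snd i)" if "snd i > 0" for i
        using that by (simp add: ball_eq_greaterThanLessThan)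
      have "emeasure lborel S \<le> emeasure lborel (\<Union>i\<in>C2. ?B i)"
      proof -
        have B2: "(\<Union>i\<in>C2. ?B i) \<in> sets borel" by (intro borel_open open_UN) auto
        have "S - (\<Union>i\<in>C2. ?B i) \<subseteq> (S - (\<Union>i\<in>C1. ?B i)) \<union> (S \<inter> (\<Union>i\<in>C1. ?B i) - (\<Union>i\<in>C2. ?B i))" by blast
        then have "negligible (S - (\<Union>i\<in>C2. ?B i))"
          using C1(4) C2(4) negligible_Un negligible_subset by blast
        then have n: "S - (\<Union>i\<in>C2. ?B i) \<in> null_sets lebesgue" by (simp add: negligible_iff_null_sets)
        have "emeasure lebesgue S \<le> emeasure lebesgue ((\<Union>i\<in>C2. ?B i) \<union> (S - (\<Union>i\<in>C2. ?B i)))"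
          using S_borel B2 by (intro emeasure_mono) auto
        also have "\<dots> = emeasure lebesgue (\<Union>i\<in>C2. ?B i)"
          using n B2 by (intro emeasure_Un_null_set) auto
        finally show ?thesis using S_borel B2 by simp
      qed
      then have "ennreal q * emeasure lborel S \<le> ennreal q * emeasure lborel (\<Union>i\<in>C2. ?B i)"
        by (rule mult_left_mono) simp
      also have "\<dots> = (\<integral>\<^sup>+i. ennreal q * emeasure lborel (?B i) \<partial>count_space C2)"
        by (simp add: sum nn_integral_cmult)
      also have "\<dots> \<le> (\<integral>\<^sup>+i. emeasure ?\<mu> (?B i) \<partial>count_space C2)"
      proof (intro nn_integral_mono)
        fix i assume "i \<in> space (count_space C2)"
        then have i: "snd i > 0" "q * (2 * snd i) < h (fst i + snd i) - h (fst i - snd i)"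
          using C2(2)[of i] by auto
        show "ennreal q * emeasure lborel (?B i) \<le> emeasure ?\<mu> (?B i)"
          using i p by (simp add: len emeasure_interval_measure_ball[OF h] ennreal_leI flip: ennreal_mult)
      qed
      also have "\<dots> = emeasure ?\<mu> (\<Union>i\<in>C2. ?B i)" by (subst sum) auto
      also have "\<dots> \<le> emeasure ?\<mu> (\<Union>i\<in>C1. ?B i)"
      proof (rule emeasure_mono)
        have "(\<Union>i\<in>C1. ?B i) \<in> sets borel" by (intro borel_open open_UN) auto
        then show "(\<Union>i\<in>C1. ?B i) \<in> sets ?\<mu>" by simp
      qed (use C2(2) in fast)
      also have "\<dots> = (\<integral>\<^sup>+i. emeasure ?\<mu> (?B i) \<partial>count_space C1)" by (subst sum) auto
      also have "\<dots> \<le> (\<integral>\<^sup>+i. ennreal p * emeasure lborel (?B i) \<partial>count_space C1)"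
      proof (intro nn_integral_mono)
        fix i assume "i \<in> space (count_space C1)"
        then have i: "snd i > 0" "h (fst i + snd i) - h (fst i - snd i) < p * (2 * snd i)"
          using C1(2)[of i] by auto
        show "emeasure ?\<mu> (?B i) \<le> ennreal p * emeasure lborel (?B i)"
          using i p by (simp add: len emeasure_interval_measure_ball[OF h] ennreal_leI flip: ennreal_mult)
      qed
      also have "\<dots> = ennreal p * emeasure lborel (\<Union>i\<in>C1. ?B i)"
        by (simp add: sum nn_integral_cmult)
      also have "\<dots> \<le> ennreal p * emeasure lborel U"
        using C1(2) U(1) by (intro mult_left_mono emeasure_mono UN_least) auto
      also have "\<dots> \<le> ennreal p * ennreal (measure lborel S + \<epsilon>)"
      proof (rule mult_left_mono)
        have "emeasure lborel U \<le> emeasure lborel S + emeasure lborel (U - S)"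
          using emeasure_subadditive[of S lborel "U - S"] S_borel U(1,2) by (simp add: Un_absorb1)
        also have "\<dots> \<le> ennreal (measure lborel S) + ennreal \<epsilon>"
          using U(3) unfolding mS by (intro add_left_mono) simp
        finally show "emeasure lborel U \<le> ennreal (measure lborel S + \<epsilon>)"
          using \<open>\<epsilon> > 0\<close> by (simp add: ennreal_plus)
      qed simp
      finally have "ennreal q * emeasure lborel S \<le> ennreal p * ennreal (measure lborel S + \<epsilon>)" .
      note this[unfolded mS]
      then have "ennreal (q * measure lborel S) \<le> ennreal (p * (measure lborel S + \<epsilon>))"
        using p \<open>\<epsilon> > 0\<close> by (simp only: ennreal_mult' ennreal_mult'')
      then show ?thesis using p \<open>\<epsilon> > 0\<close> by (subst (asm) ennreal_le_iff) auto
    qed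
    have "q * measure lborel S \<le> p * measure lborel S"
    proof (rule field_le_epsilon)
      fix \<epsilon> :: real assume "\<epsilon> > 0"
      show "q * measure lborel S \<le> p * measure lborel S + \<epsilon>"
        using key[of "\<epsilon> / (p + 1)"] \<open>\<epsilon> > 0\<close> p
        by (simp add: distrib_left) (smt (verit) divide_right_mono mult_imp_div_pos_le nonzero_mult_div_cancel_left pos_divide_le_eq mult.commute)
    qed
    then have "(q - p) * measure lborel S \<le> 0" by (simp add: left_diff_distrib)
    then have "measure lborel S = 0"
      using pq measure_nonneg[of lborel S] by (simp add: mult_le_0_iff)
    then have "emeasure lborel S = 0" by (simp add: mS)
    then show ?thesis using S_borel by (auto simp: S_def[symmetric])
  qed
  have "(\<Union>n::nat. steep h 1 q \<inter> steep (\<lambda>x. - h x) 1 (- p) \<inter> ball 0 (real n)) \<in> null_sets lborel"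
    by (intro null_sets_UN null)
  also have "(\<Union>n::nat. steep h 1 q \<inter> steep (\<lambda>x. - h x) 1 (- p) \<inter> ball 0 (real n))
      = steep h 1 q \<inter> steep (\<lambda>x. - h x) 1 (- p)"
    using reals_Archimedean2 by auto
  finally show ?thesis .
qed

text \<open>The points where the slopes of \<open>G\<close> over short segments in direction \<open>v\<close>, taken around the
  point, have different upper and lower limits.\<close>

definition oscillating :: "('a::real_normed_vector \<Rightarrow> real) \<Rightarrow> 'a \<Rightarrow> 'a set" where
  "oscillating G v = (\<Union>p\<in>\<rat>. \<Union>q\<in>\<rat> \<inter> {p<..}. steep G v q \<inter> steep (\<lambda>x. - G x) v (- p))"

lemma oscillating_borel: "continuous_on UNIV G \<Longrightarrow> oscillating G v \<in> sets borel"
  unfolding oscillating_def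
  by (intro sets.countable_UN'' countable_Int1 countable_rat sets.Int steep_borel continuous_on_minus)

lemma lipschitz_real_oscillating_null:
  fixes g :: "real \<Rightarrow> real"
  assumes g: "L-lipschitz_on UNIV g"
  shows "oscillating g 1 \<in> null_sets lborel"
  unfolding oscillating_def
proof (intro null_sets_UN' countable_Int1 countable_rat)
  fix p q :: real assume "q \<in> \<rat> \<inter> {p<..}"
  \<comment> \<open>Adding \<open>L * x\<close> makes \<open>g\<close> monotone and shifts all slopes by \<open>L\<close>.\<close>
  define h where "h x = g x + L * x" for x
  have cont: "continuous_on UNIV g" by (rule lipschitz_on_continuous_on[OF g])
  have "mono h"
  proof (rule monoI)
    fix x y :: real assume "x \<le> y"
    then show "h x \<le> h y"
      using lipschitz_onD[OF g, of x y] by (auto simp: h_def dist_real_def algebra_simps abs_le_iff)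
  qed
  moreover have "continuous_on UNIV h" unfolding h_def by (intro continuous_intros cont)
  ultimately have "steep h 1 (q + L) \<inter> steep (\<lambda>x. - h x) 1 (- (p + L)) \<in> null_sets lborel"
    using \<open>q \<in> _\<close> by (intro monotone_two_slopes_null) auto
  moreover have "steep h 1 (q + L) = steep g 1 q" "steep (\<lambda>x. - h x) 1 (- (p + L)) = steep (\<lambda>x. - g x) 1 (- p)"
    by (auto simp: steep_def h_def algebra_simps)
  ultimately show "steep g 1 q \<inter> steep (\<lambda>x. - g x) 1 (- p) \<in> null_sets lborel" by simp
qed

text \<open>The one-dimensional result on almost every line in direction \<open>v\<close> gives, by Fubini, some \<open>s\<close> such
  that the translate by \<open>s v\<close> of the exceptional set is null.\<close>

lemma lipschitz_oscillating_null:
  fixes G :: "'a::euclidean_space \<Rightarrow> real"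
  assumes G: "L-lipschitz_on UNIV G"
  shows "AE x in lborel. x \<notin> oscillating G v"
proof -
  have cont: "continuous_on UNIV G" by (rule lipschitz_on_continuous_on[OF G])
  have line: "AE s in lborel. x + s *\<^sub>R v \<notin> oscillating G v" for x
  proof -
    have "(L * norm v)-lipschitz_on UNIV (\<lambda>s. G (x + s *\<^sub>R v))"
    proof (rule lipschitz_onI)
      show "dist (G (x + s *\<^sub>R v)) (G (x + t *\<^sub>R v)) \<le> L * norm v * dist s t" for s t
        using lipschitz_onD[OF G, of "x + s *\<^sub>R v" "x + t *\<^sub>R v"]
        by (simp add: dist_norm flip: scaleR_diff_left) (simp add: dist_real_def mult.commute mult.left_commute)
    qed (use lipschitz_on_nonneg[OF G] in simp)
    from lipschitz_real_oscillating_null[OF this]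
    have "AE s in lborel. s \<notin> oscillating (\<lambda>s. G (x + s *\<^sub>R v)) 1" by (rule AE_not_in)
    moreover have "s \<in> oscillating (\<lambda>s. G (x + s *\<^sub>R v)) 1 \<longleftrightarrow> x + s *\<^sub>R v \<in> oscillating G v" for s
      by (simp add: oscillating_def steep_def scaleR_add_left add.assoc)
    ultimately show ?thesis by simp
  qed
  have "AE s in (lborel :: real measure). AE x in lborel. x + s *\<^sub>R v \<notin> oscillating G v"
  proof (rule AE_lborel_swap[OF AE_I2[OF line]])
    have "- {p :: 'a \<times> real. fst p + snd p *\<^sub>R v \<in> oscillating G v} \<in> sets borel"
      by (intro borel_comp borel_preimage_continuous oscillating_borel cont continuous_intros)
    then show "{p :: 'a \<times> real. fst p + snd p *\<^sub>R v \<notin> oscillating G v} \<in> sets borel"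
      by (simp add: Collect_neg_eq)
  qed
  then obtain s :: real where "AE x in lborel. x + s *\<^sub>R v \<notin> oscillating G v"
    by (rule AE_lborel_positive_witness)
  from AE_lborel_translate[OF this, of "- s *\<^sub>R v"] show ?thesis by simp
qed

text \<open>The derivative is the supremum of the slopes \<open>q\<close> that are exceeded on arbitrarily short
  segments around \<open>x\<close>; a segment starting at \<open>x\<close> is a limit of segments around \<open>x\<close>.\<close>

lemma not_oscillating_imp_directional_derivative:
  fixes G :: "'a::euclidean_space \<Rightarrow> real"
  assumes G: "L-lipschitz_on UNIV G" and x: "x \<notin> oscillating G v"
  shows "\<exists>D. ((\<lambda>s. G (x + s *\<^sub>R v)) has_real_derivative D) (at 0)"
proof -
  have cont: "continuous_on UNIV (\<lambda>s::real. G (x + s *\<^sub>R v))"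
    by (intro continuous_on_compose2[OF lipschitz_on_continuous_on[OF G]] continuous_intros) auto
  have lip: "\<bar>G (x + b *\<^sub>R v) - G (x + a *\<^sub>R v)\<bar> \<le> L * norm v * (b - a)" if "a < b" for a b
    using lipschitz_onD[OF G, of "x + b *\<^sub>R v" "x + a *\<^sub>R v"] that
    by (simp add: dist_norm flip: scaleR_diff_left) (simp add: mult.commute mult.left_commute)
  define A where "A = {q. x \<in> steep G v q}"
  have down: "q' \<in> A" if "q \<in> A" "q' \<le> q" for q q'
  proof -
    have "q' * (b - a) \<le> q * (b - a)" if "a < 0" "0 < b" for a b :: real
      using \<open>q' \<le> q\<close> that by (intro mult_right_mono) auto
    then have "x \<in> steep G v q'" if "x \<in> steep G v q"
      using that unfolding steep_def mem_Collect_eq by (meson le_less_trans)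
    then show ?thesis using \<open>q \<in> A\<close> by (simp add: A_def)
  qed
  have "- L * norm v - 1 \<in> A"
    unfolding A_def steep_def
  proof (intro CollectI allI exI conjI)
    fix n :: nat
    let ?b = "1 / (3 * real (Suc n))"
    show "- ?b < 0" "0 < ?b" by auto
    show "?b - - ?b < 1 / real (Suc n)" by (simp add: field_simps)
    have "0 < ?b - - ?b" by simp
    then have "(- L * norm v - 1) * (?b - - ?b) < - (L * norm v * (?b - - ?b))"
      by (simp only: left_diff_distrib mult_minus_left mult_1)
    also have "\<dots> \<le> G (x + ?b *\<^sub>R v) - G (x + (- ?b) *\<^sub>R v)"
      using lip[of "- ?b" ?b] by (simp only: abs_le_iff) simp
    finally show "(- L * norm v - 1) * (?b - - ?b) < G (x + ?b *\<^sub>R v) - G (x + (- ?b) *\<^sub>R v)" .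
  qed
  moreover have bdd: "q \<le> L * norm v" if "q \<in> A" for q
  proof (rule ccontr)
    assume "\<not> q \<le> L * norm v"
    have "x \<in> steep G v q" using that by (simp add: A_def)
    then obtain a b where "a < 0" "0 < b" "q * (b - a) < G (x + b *\<^sub>R v) - G (x + a *\<^sub>R v)"
      using zero_less_one by (rule steepD)
    moreover have "L * norm v * (b - a) \<le> q * (b - a)"
      using \<open>\<not> q \<le> _\<close> \<open>a < 0\<close> \<open>0 < b\<close> by (intro mult_right_mono) auto
    moreover have "G (x + b *\<^sub>R v) - G (x + a *\<^sub>R v) \<le> L * norm v * (b - a)"
      using lip[of a b] \<open>a < 0\<close> \<open>0 < b\<close> by simp
    ultimately show False by linarith
  qed
  ultimately have A: "A \<noteq> {}" "bdd_above A" unfolding bdd_above_def by blast+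
  define D where "D = Sup A"
  have straddle: "\<exists>d>0. \<forall>a b. a < 0 \<and> 0 < b \<and> b - a < d \<longrightarrow>
      \<bar>G (x + b *\<^sub>R v) - G (x + a *\<^sub>R v) - D * (b - a)\<bar> \<le> \<epsilon> * (b - a)" if eps: "\<epsilon> > 0" for \<epsilon>
  proof -
    have "D + \<epsilon> \<notin> A" using cSup_upper[OF _ A(2), of "D + \<epsilon>"] eps by (auto simp: D_def)
    then have "x \<notin> steep G v (D + \<epsilon>)" by (simp add: A_def)
    then obtain d1 where d1: "d1 > 0"
      "\<And>a b. a < 0 \<Longrightarrow> 0 < b \<Longrightarrow> b - a < d1 \<Longrightarrow> G (x + b *\<^sub>R v) - G (x + a *\<^sub>R v) \<le> (D + \<epsilon>) * (b - a)"
      by (rule not_steepD) blast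
    obtain p where p: "p \<in> \<rat>" "D - \<epsilon> < p" "p < D - \<epsilon> / 2" using Rats_dense_in_real[of "D - \<epsilon>" "D - \<epsilon> / 2"] eps by auto
    obtain q where q: "q \<in> \<rat>" "p < q" "q < D" using Rats_dense_in_real[of p D] p eps by auto
    obtain q' where "q' \<in> A" "q < q'" using q(3) less_cSup_iff[OF A] by (auto simp: D_def)
    then have "x \<in> steep G v q" using down[of q' q] by (simp add: A_def)
    then have "x \<notin> steep (\<lambda>x. - G x) v (- p)"
      using x p(1) q(1,2) unfolding oscillating_def by blast
    then obtain d2 where d2: "d2 > 0"
      "\<And>a b. a < 0 \<Longrightarrow> 0 < b \<Longrightarrow> b - a < d2 \<Longrightarrow> - G (x + b *\<^sub>R v) - - G (x + a *\<^sub>R v) \<le> - p * (b - a)"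
      using not_steepD[of x "\<lambda>x. - G x" v "- p"] by blast
    show ?thesis
    proof (intro exI[of _ "min d1 d2"] conjI allI impI)
      fix a b assume ab: "a < 0 \<and> 0 < b \<and> b - a < min d1 d2"
      have "(D - \<epsilon>) * (b - a) \<le> p * (b - a)" using p ab by (intro mult_right_mono) auto
      moreover have "p * (b - a) \<le> G (x + b *\<^sub>R v) - G (x + a *\<^sub>R v)" using d2(2)[of a b] ab by simp
      moreover have "G (x + b *\<^sub>R v) - G (x + a *\<^sub>R v) \<le> (D + \<epsilon>) * (b - a)" using d1(2)[of a b] ab by simp
      ultimately show "\<bar>G (x + b *\<^sub>R v) - G (x + a *\<^sub>R v) - D * (b - a)\<bar> \<le> \<epsilon> * (b - a)"
        by (simp add: abs_le_iff left_diff_distrib distrib_right)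
    qed (use d1 d2 in auto)
  qed
  have "((\<lambda>s. G (x + s *\<^sub>R v)) has_derivative (\<lambda>s. s * D)) (at 0)"
    unfolding has_derivative_at_alt
  proof (intro conjI allI impI)
    show "bounded_linear (\<lambda>s. s * D)" by (rule bounded_linear_mult_left)
    fix \<epsilon> :: real assume "\<epsilon> > 0"
    obtain d where d: "d > 0" "\<And>a b. a < 0 \<Longrightarrow> 0 < b \<Longrightarrow> b - a < d \<Longrightarrow>
      \<bar>G (x + b *\<^sub>R v) - G (x + a *\<^sub>R v) - D * (b - a)\<bar> \<le> \<epsilon> * (b - a)"
      using straddle[OF \<open>\<epsilon> > 0\<close>] by blast
    \<comment> \<open>Enlarging the segment by \<open>\<eta>\<close> on both sides allows \<open>0\<close> to be an end point.\<close>
    have est: "\<bar>G (x + b *\<^sub>R v) - G (x + a *\<^sub>R v) - D * (b - a)\<bar> \<le> \<epsilon> * (b - a)"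
      if ab: "a \<le> 0" "0 \<le> b" "b - a < d" for a b
    proof (rule tendsto_le[OF trivial_limit_at_right_real])
      let ?l = "\<lambda>\<eta>. \<bar>G (x + (b + \<eta>) *\<^sub>R v) - G (x + (a - \<eta>) *\<^sub>R v) - D * (b + \<eta> - (a - \<eta>))\<bar>"
      have "continuous_on UNIV ?l"
        by (intro continuous_intros continuous_on_compose2[OF cont]) auto
      then have "(?l \<longlongrightarrow> ?l 0) (at 0)" unfolding continuous_on_def by blast
      then show "(?l \<longlongrightarrow> \<bar>G (x + b *\<^sub>R v) - G (x + a *\<^sub>R v) - D * (b - a)\<bar>) (at_right 0)"
        by (simp add: filterlim_at_split)
      show "((\<lambda>\<eta>. \<epsilon> * (b + \<eta> - (a - \<eta>))) \<longlongrightarrow> \<epsilon> * (b - a)) (at_right 0)"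
        by (auto intro!: tendsto_eq_intros)
      have "\<forall>\<^sub>F \<eta> in at_right 0. \<eta> \<in> {0<..<(d - (b - a)) / 2}"
        using ab by (intro eventually_at_rightI[of _ "(d - (b - a)) / 2"]) auto
      then show "\<forall>\<^sub>F \<eta> in at_right 0. ?l \<eta> \<le> \<epsilon> * (b + \<eta> - (a - \<eta>))"
        by (rule eventually_mono) (intro d(2), use ab in \<open>auto simp: field_simps\<close>)
    qed
    show "\<exists>d>0. \<forall>y. norm (y - 0) < d \<longrightarrow>
        norm (G (x + y *\<^sub>R v) - G (x + 0 *\<^sub>R v) - (y - 0) * D) \<le> \<epsilon> * norm (y - 0)"
    proof (intro exI[of _ d] conjI allI impI)
      fix y :: real assume "norm (y - 0) < d"
      then show "norm (G (x + y *\<^sub>R v) - G (x + 0 *\<^sub>R v) - (y - 0) * D) \<le> \<epsilon> * norm (y - 0)"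
        using est[of 0 y] est[of y 0] by (cases "y \<ge> 0") (auto simp: abs_le_iff mult.commute)
    qed (rule d)
  qed
  then show ?thesis unfolding has_field_derivative_def by (auto simp: mult_commute_abs)
qed

text \<open>Both sides of the linearity relation have the same integral against every cutoff \<open>\<phi>\<close>: moving
  the difference quotients over to \<open>\<phi>\<close> turns it into the linearity of the derivative of \<open>\<phi>\<close>.\<close>

lemma directional_derivative_linear_AE:
  fixes G :: "'a::euclidean_space \<Rightarrow> real"
  assumes G: "L-lipschitz_on UNIV G"
  shows "AE x in lborel. \<forall>D. (\<forall>w\<in>insert v Basis. ((\<lambda>s. G (x + s *\<^sub>R w)) has_real_derivative D w) (at 0))
      \<longrightarrow> D v = (\<Sum>i\<in>Basis. (v \<bullet> i) * D i)"
proof -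
  have L: "L \<ge> 0" using lipschitz_on_nonneg[OF G] .
  have cont: "continuous_on UNIV G" by (rule lipschitz_on_continuous_on[OF G])
  have [measurable]: "G \<in> borel_measurable borel" by (rule borel_measurable_continuous_onI[OF cont])
  have lbG: "locally_bounded (\<lambda>z. G (z + c))" for c unfolding locally_bounded_def
  proof (intro allI exI ballI)
    fix R and z :: 'a assume "z \<in> cball 0 R"
    then have "L * norm z \<le> L * R" using L by (intro mult_left_mono) auto
    then show "\<bar>G (z + c)\<bar> \<le> \<bar>G c\<bar> + L * R"
      using lipschitz_onD[OF G, of "z + c" c] by (simp add: dist_norm)
  qed
  have lbG0: "locally_bounded G" using lbG[of 0] by simp
  define Q where "Q w n x = (G (x + (1 / real (Suc n)) *\<^sub>R w) - G x) / (1 / real (Suc n))" for w n x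
  have Qm[measurable]: "Q w n \<in> borel_measurable borel" for w n
    unfolding Q_def by (intro borel_measurable_continuous_onI continuous_intros continuous_on_compose2[OF cont]) auto
  have Q_bound: "\<bar>Q w n x\<bar> \<le> L * norm w" for w n x
  proof -
    have "\<bar>G (x + (1 / real (Suc n)) *\<^sub>R w) - G x\<bar> \<le> L * norm w * (1 / real (Suc n))"
      using lipschitz_onD[OF G, of "x + (1 / real (Suc n)) *\<^sub>R w" x]
      by (simp add: dist_norm del: of_nat_Suc)
    then show ?thesis unfolding Q_def abs_divide by (subst pos_divide_le_eq) (simp_all del: of_nat_Suc)
  qed
  define M where "M = L * norm v + (\<Sum>i\<in>Basis. \<bar>v \<bullet> i\<bar> * L)"
  define T where "T n x = Q v n x - (\<Sum>i\<in>Basis. (v \<bullet> i) * Q i n x)" for n x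
  have Tm[measurable]: "T n \<in> borel_measurable borel" for n unfolding T_def by measurable
  have T_bound: "\<bar>T n x\<bar> \<le> M" for n x
  proof -
    have "\<bar>\<Sum>i\<in>Basis. (v \<bullet> i) * Q i n x\<bar> \<le> (\<Sum>i\<in>Basis. \<bar>v \<bullet> i\<bar> * L)"
    proof (rule order_trans[OF sum_abs sum_mono])
      fix i :: 'a assume "i \<in> Basis"
      then show "\<bar>(v \<bullet> i) * Q i n x\<bar> \<le> \<bar>v \<bullet> i\<bar> * L"
        using Q_bound[of i n x] by (simp add: abs_mult mult_left_mono)
    qed
    then show ?thesis using Q_bound[of v n x] unfolding T_def M_def by linarith
  qed
  have M: "M \<ge> 0" using T_bound[of 0 0] by linarith
  have inv_lim: "filterlim (\<lambda>n. 1 / real (Suc n)) (at 0) sequentially"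
    unfolding filterlim_at using LIMSEQ_inverse_real_of_nat by (simp add: inverse_eq_divide del: of_nat_Suc)
  define good where "good x \<longleftrightarrow> (\<forall>w\<in>insert v Basis. x \<notin> oscillating G w)" for x
  have good_AE: "AE x in lborel. good x"
    unfolding good_def by (intro AE_finite_allI) (auto intro: lipschitz_oscillating_null[OF G])
  have Q_lim: "(\<lambda>n. Q w n x) \<longlonglongrightarrow> D" if "((\<lambda>s. G (x + s *\<^sub>R w)) has_real_derivative D) (at 0)" for w x D
  proof -
    have "((\<lambda>h. (G (x + h *\<^sub>R w) - G x) / h) \<longlongrightarrow> D) (at 0)" using that by (simp add: DERIV_def)
    from filterlim_compose[OF this inv_lim] show ?thesis unfolding Q_def .
  qed
  \<comment> \<open>Where the sequence diverges, \<open>lim\<close> is an arbitrary number; truncation keeps \<open>S\<close> bounded there.\<close>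
  define S where "S x = (if \<bar>lim (\<lambda>n. T n x)\<bar> \<le> M then lim (\<lambda>n. T n x) else 0)" for x
  have Sm[measurable]: "S \<in> borel_measurable borel" unfolding S_def by measurable
  have S_bound: "\<bar>S x\<bar> \<le> M" for x using M by (simp add: S_def)
  have T_lim: "(\<lambda>n. T n x) \<longlonglongrightarrow> S x" if "good x" for x
  proof -
    have "\<exists>D. ((\<lambda>s. G (x + s *\<^sub>R w)) has_real_derivative D) (at 0)" if "w \<in> insert v Basis" for w
      using that \<open>good x\<close> by (intro not_oscillating_imp_directional_derivative[OF G]) (auto simp: good_def)
    then obtain D where D: "\<And>w. w \<in> insert v Basis \<Longrightarrow> ((\<lambda>s. G (x + s *\<^sub>R w)) has_real_derivative D w) (at 0)"
      by metis
    have "(\<lambda>n. T n x) \<longlonglongrightarrow> D v - (\<Sum>i\<in>Basis. (v \<bullet> i) * D i)"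
      unfolding T_def by (intro tendsto_intros Q_lim D) auto
    then have "convergent (\<lambda>n. T n x)" by (rule convergentI)
    then have l: "(\<lambda>n. T n x) \<longlonglongrightarrow> lim (\<lambda>n. T n x)" by (simp add: convergent_LIMSEQ_iff)
    from tendsto_rabs[OF l] have "\<bar>lim (\<lambda>n. T n x)\<bar> \<le> M"
      by (rule LIMSEQ_le_const2) (use T_bound in blast)
    then show ?thesis using l by (simp add: S_def)
  qed
  have int0: "(\<integral>x. S x * \<phi> x \<partial>lborel) = 0" if \<phi>: "cutoff UNIV \<phi>" for \<phi>
  proof -
    note [measurable] = cutoff_measurable[OF \<phi>]
    note intl = integrable_mult_cutoff[OF \<phi>]
    have lbb: "locally_bounded g" if "\<And>x. \<bar>g x\<bar> \<le> B" for g :: "'a \<Rightarrow> real" and B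
      using that by (auto simp: locally_bounded_def)
    have intQ: "integrable lborel (\<lambda>x. Q w n x * \<phi> x)" for w n
      by (rule intl[OF _ lbb[OF Q_bound]]) simp
    define H where "H w s = (\<integral>z. G z * \<phi> (z - s *\<^sub>R w) \<partial>lborel)" for w s
    define d where "d w = (\<integral>z. G z * frechet_derivative \<phi> (at z) w \<partial>lborel)" for w
    have H': "(H w has_real_derivative - d w) (at 0)" for w
      using integral_translated_cutoff_derivative[OF _ lbG0 \<phi>, of w 0] by (simp add: H_def[abs_def] d_def)
    have QH: "(\<integral>x. Q w n x * \<phi> x \<partial>lborel) = (H w (1 / real (Suc n)) - H w 0) / (1 / real (Suc n))" for w n
    proof -
      let ?s = "1 / real (Suc n)"
      have "H w ?s = (\<integral>x. G (x + ?s *\<^sub>R w) * \<phi> x \<partial>lborel)"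
        using lborel_integral_translate[of "\<lambda>z. G z * \<phi> (z - ?s *\<^sub>R w)" "?s *\<^sub>R w"] by (simp add: H_def)
      moreover have "H w 0 = (\<integral>x. G x * \<phi> x \<partial>lborel)" by (simp add: H_def)
      ultimately have "H w ?s - H w 0 = (\<integral>x. G (x + ?s *\<^sub>R w) * \<phi> x - G x * \<phi> x \<partial>lborel)"
        using Bochner_Integration.integral_diff[OF intl[OF _ lbG] intl[OF _ lbG0]] by simp
      also have "\<dots> = (\<integral>x. ?s * (Q w n x * \<phi> x) \<partial>lborel)"
      proof (rule Bochner_Integration.integral_cong[OF refl])
        have cancel: "s * (c / s * y) = c * y" if "s \<noteq> 0" for s c y :: real using that by simp
        show "G (x + ?s *\<^sub>R w) * \<phi> x - G x * \<phi> x = ?s * (Q w n x * \<phi> x)" for x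
          unfolding Q_def by (subst cancel) (simp_all add: left_diff_distrib)
      qed
      also have "\<dots> = ?s * (\<integral>x. Q w n x * \<phi> x \<partial>lborel)" by simp
      finally show ?thesis by (simp del: of_nat_Suc)
    qed
    have lim: "(\<lambda>n. \<integral>x. Q w n x * \<phi> x \<partial>lborel) \<longlonglongrightarrow> - d w" for w
    proof -
      have "((\<lambda>h. (H w h - H w 0) / h) \<longlongrightarrow> - d w) (at 0)" using H'[of w] by (simp add: DERIV_def)
      from filterlim_compose[OF this inv_lim] show ?thesis unfolding QH .
    qed
    have "(\<integral>x. T n x * \<phi> x \<partial>lborel) = (\<integral>x. Q v n x * \<phi> x \<partial>lborel) - (\<Sum>i\<in>Basis. (v \<bullet> i) * (\<integral>x. Q i n x * \<phi> x \<partial>lborel))" for n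
    proof -
      have "(\<integral>x. T n x * \<phi> x \<partial>lborel) = (\<integral>x. Q v n x * \<phi> x - (\<Sum>i\<in>Basis. (v \<bullet> i) * (Q i n x * \<phi> x)) \<partial>lborel)"
        by (simp add: T_def left_diff_distrib sum_distrib_right mult.assoc)
      also have "\<dots> = (\<integral>x. Q v n x * \<phi> x \<partial>lborel) - (\<integral>x. (\<Sum>i\<in>Basis. (v \<bullet> i) * (Q i n x * \<phi> x)) \<partial>lborel)"
        by (intro Bochner_Integration.integral_diff Bochner_Integration.integrable_sum integrable_mult_right intQ)
      also have "(\<integral>x. (\<Sum>i\<in>Basis. (v \<bullet> i) * (Q i n x * \<phi> x)) \<partial>lborel) = (\<Sum>i\<in>Basis. (v \<bullet> i) * (\<integral>x. Q i n x * \<phi> x \<partial>lborel))"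
        by (subst Bochner_Integration.integral_sum) (auto intro!: integrable_mult_right intQ)
      finally show ?thesis .
    qed
    then have lim1: "(\<lambda>n. \<integral>x. T n x * \<phi> x \<partial>lborel) \<longlonglongrightarrow> - d v - (\<Sum>i\<in>Basis. (v \<bullet> i) * (- d i))"
      by (simp only:) (intro tendsto_intros lim)
    have "(\<lambda>n. \<integral>x. T n x * \<phi> x \<partial>lborel) \<longlonglongrightarrow> (\<integral>x. S x * \<phi> x \<partial>lborel)"
    proof (rule integral_dominated_convergence[where w = "\<lambda>x. \<bar>M * \<phi> x\<bar>"])
      show "integrable lborel (\<lambda>x. \<bar>M * \<phi> x\<bar>)"
        by (intro integrable_abs intl[OF _ lbb[of "\<lambda>_. M" "\<bar>M\<bar>"]]) auto
      show "AE x in lborel. (\<lambda>n. T n x * \<phi> x) \<longlonglongrightarrow> S x * \<phi> x"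
        using good_AE by eventually_elim (intro tendsto_intros T_lim)
      show "AE x in lborel. norm (T n x * \<phi> x) \<le> \<bar>M * \<phi> x\<bar>" for n
        using T_bound M by (intro always_eventually allI) (auto simp: abs_mult intro!: mult_right_mono)
    qed auto
    from LIMSEQ_unique[OF this lim1] have "(\<integral>x. S x * \<phi> x \<partial>lborel) = (\<Sum>i\<in>Basis. (v \<bullet> i) * d i) - d v"
      by (simp add: sum_negf)
    also have "d v = (\<Sum>i\<in>Basis. (v \<bullet> i) * d i)"
    proof -
      note lin = cutoff_derivative_linear[OF \<phi>]
      have "frechet_derivative \<phi> (at z) v = (\<Sum>i\<in>Basis. (v \<bullet> i) * frechet_derivative \<phi> (at z) i)" for z
      proof -
        have "frechet_derivative \<phi> (at z) v = frechet_derivative \<phi> (at z) (\<Sum>i\<in>Basis. (v \<bullet> i) *\<^sub>R i)"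
          by (simp add: euclidean_representation)
        also have "\<dots> = (\<Sum>i\<in>Basis. (v \<bullet> i) * frechet_derivative \<phi> (at z) i)"
          by (simp add: linear_sum[OF lin] linear_scale[OF lin])
        finally show ?thesis .
      qed
      then have "d v = (\<integral>z. (\<Sum>i\<in>Basis. (v \<bullet> i) * (G z * frechet_derivative \<phi> (at z) i)) \<partial>lborel)"
        unfolding d_def by (simp add: sum_distrib_left mult.left_commute)
      also have "\<dots> = (\<Sum>i\<in>Basis. (v \<bullet> i) * d i)"
      proof (subst Bochner_Integration.integral_sum)
        show "integrable lborel (\<lambda>z. (v \<bullet> i) * (G z * frechet_derivative \<phi> (at z) i))" for i
          by (intro integrable_mult_right integrable_mult_cutoff_derivative[OF \<phi> _ lbG0]) simp
      qed (simp add: d_def)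
      finally show ?thesis .
    qed
    finally show ?thesis by simp
  qed
  have lbS: "locally_bounded S" "locally_bounded (\<lambda>x. - S x)"
    using S_bound by (auto simp: locally_bounded_def)
  have "AE x in lborel. x \<in> UNIV \<longrightarrow> S x \<le> 0"
    by (rule AE_nonpos_if_cutoff_integrals_nonpos[OF _ lbS(1)]) (auto simp: int0)
  moreover have "AE x in lborel. x \<in> UNIV \<longrightarrow> - S x \<le> 0"
    by (rule AE_nonpos_if_cutoff_integrals_nonpos[OF _ lbS(2)]) (auto simp: int0)
  ultimately show ?thesis using good_AE
  proof eventually_elim
    case (elim x)
    then have "S x = 0" by simp
    show ?case
    proof (intro allI impI)
      fix D assume D: "\<forall>w\<in>insert v Basis. ((\<lambda>s. G (x + s *\<^sub>R w)) has_real_derivative D w) (at 0)"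
      have "(\<lambda>n. T n x) \<longlonglongrightarrow> D v - (\<Sum>i\<in>Basis. (v \<bullet> i) * D i)"
        unfolding T_def by (intro tendsto_intros Q_lim) (use D in auto)
      from LIMSEQ_unique[OF this T_lim[OF elim(3)]] \<open>S x = 0\<close>
      show "D v = (\<Sum>i\<in>Basis. (v \<bullet> i) * D i)" by simp
    qed
  qed
qed

text \<open>Where the directional derivatives along a countable dense set of directions exist and depend
  linearly on the direction, the Lipschitz bound and the compactness of the unit sphere make the
  convergence of the difference quotients uniform in the direction.\<close>

theorem Rademacher:
  fixes G :: "'a::euclidean_space \<Rightarrow> real"
  assumes G: "L-lipschitz_on UNIV G"
  shows "AE x in lborel. G differentiable (at x)"
proof -
  have L: "L \<ge> 0" using lipschitz_on_nonneg[OF G] .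
  obtain Q :: "'a set" where Q: "countable Q" "\<And>X. open X \<Longrightarrow> X \<noteq> {} \<Longrightarrow> \<exists>d\<in>Q. d \<in> X"
    by (rule countable_dense_setE) blast
  have "AE x in lborel. \<forall>v\<in>Q \<union> Basis. x \<notin> oscillating G v"
    using Q(1) by (intro AE_ball_countable[THEN iffD2] ballI lipschitz_oscillating_null[OF G])
      (auto intro: countable_finite)
  moreover have "AE x in lborel. \<forall>v\<in>Q. \<forall>D. (\<forall>w\<in>insert v Basis. ((\<lambda>s. G (x + s *\<^sub>R w)) has_real_derivative D w) (at 0))
      \<longrightarrow> D v = (\<Sum>i\<in>Basis. (v \<bullet> i) * D i)"
    using Q(1) by (intro AE_ball_countable[THEN iffD2] ballI directional_derivative_linear_AE[OF G])
  ultimately show ?thesis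
  proof eventually_elim
    case (elim x)
    have "\<exists>D. ((\<lambda>s. G (x + s *\<^sub>R v)) has_real_derivative D) (at 0)" if "v \<in> Q \<union> Basis" for v
      using elim(1) that by (intro not_oscillating_imp_directional_derivative[OF G]) auto
    then obtain D where D: "\<And>v. v \<in> Q \<union> Basis \<Longrightarrow> ((\<lambda>s. G (x + s *\<^sub>R v)) has_real_derivative D v) (at 0)"
      by metis
    define a where "a = (\<Sum>i\<in>Basis. D i *\<^sub>R i)"
    have Da: "D v = a \<bullet> v" if "v \<in> Q" for v
    proof -
      have "D v = (\<Sum>i\<in>Basis. (v \<bullet> i) * D i)" using elim(2) that D by blast
      then show ?thesis by (simp add: a_def inner_sum_right inner_commute mult.commute)
    qed
    have lipG: "\<bar>G y - G z\<bar> \<le> L * norm (y - z)" for y z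
      using lipschitz_onD[OF G, of y z] by (simp add: dist_norm)
    have "(G has_derivative (\<lambda>h. a \<bullet> h)) (at x)"
      unfolding has_derivative_at_alt
    proof (intro conjI allI impI)
      show "bounded_linear (\<lambda>h. a \<bullet> h)" by (rule bounded_linear_inner_right)
      fix \<epsilon> :: real assume "\<epsilon> > 0"
      define \<eta> where "\<eta> = \<epsilon> / (L + norm a + 1)"
      have pos: "L + norm a + 1 > 0" using L norm_ge_zero[of a] by linarith
      have \<eta>: "\<eta> > 0" "\<eta> * (L + norm a + 1) = \<epsilon>" using \<open>\<epsilon> > 0\<close> pos by (auto simp: \<eta>_def)
      have "sphere (0::'a) 1 \<subseteq> (\<Union>v\<in>Q. ball v \<eta>)"
      proof
        fix u :: 'a
        obtain v where "v \<in> Q" "v \<in> ball u \<eta>" using Q(2)[of "ball u \<eta>"] \<eta>(1) by auto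
        then show "u \<in> (\<Union>v\<in>Q. ball v \<eta>)" by (auto simp: dist_commute)
      qed
      then obtain F where F: "F \<subseteq> Q" "finite F" "sphere (0::'a) 1 \<subseteq> (\<Union>v\<in>F. ball v \<eta>)"
        using compactE_image[OF compact_sphere[of "0::'a" 1], of Q "\<lambda>v. ball v \<eta>"] by auto
      have "\<exists>d>0. \<forall>t. \<bar>t\<bar> < d \<longrightarrow> \<bar>G (x + t *\<^sub>R v) - G x - t * (a \<bullet> v)\<bar> \<le> \<eta> * \<bar>t\<bar>" if "v \<in> F" for v
      proof -
        have "((\<lambda>s. G (x + s *\<^sub>R v)) has_derivative (*) (a \<bullet> v)) (at 0)"
          using D[of v] Da[of v] that F(1) by (auto simp: has_field_derivative_def)
        then show ?thesis
          using \<eta>(1) unfolding has_derivative_at_alt by (auto simp: mult.commute)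
      qed
      then obtain d where d: "\<And>v. v \<in> F \<Longrightarrow> d v > 0"
        "\<And>v t. v \<in> F \<Longrightarrow> \<bar>t\<bar> < d v \<Longrightarrow> \<bar>G (x + t *\<^sub>R v) - G x - t * (a \<bullet> v)\<bar> \<le> \<eta> * \<bar>t\<bar>"
        by metis
      define \<delta> where "\<delta> = Min (insert 1 (d ` F))"
      have \<delta>: "\<delta> > 0" "\<And>v. v \<in> F \<Longrightarrow> \<delta> \<le> d v"
        using F(2) d(1) by (auto simp: \<delta>_def)
      show "\<exists>d>0. \<forall>y. norm (y - x) < d \<longrightarrow> norm (G y - G x - a \<bullet> (y - x)) \<le> \<epsilon> * norm (y - x)"
      proof (intro exI[of _ \<delta>] conjI allI impI)
        fix y assume y: "norm (y - x) < \<delta>"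
        show "norm (G y - G x - a \<bullet> (y - x)) \<le> \<epsilon> * norm (y - x)"
        proof (cases "y = x")
          case False
          define t where "t = norm (y - x)"
          define u where "u = (y - x) /\<^sub>R t"
          have t: "t > 0" "t < \<delta>" using False y by (auto simp: t_def)
          have yx: "y - x = t *\<^sub>R u" using t by (simp add: u_def)
          have "norm u = 1" using t by (simp add: u_def t_def)
          then obtain v where v: "v \<in> F" "norm (u - v) < \<eta>"
            using F(3) by (force simp: dist_norm norm_minus_commute)
          have 1: "\<bar>G (x + t *\<^sub>R v) - G x - t * (a \<bullet> v)\<bar> \<le> \<eta> * t"
            using d(2)[OF v(1), of t] \<delta>(2)[OF v(1)] t by simp
          have "\<bar>G y - G (x + t *\<^sub>R v)\<bar> \<le> L * norm (t *\<^sub>R (u - v))"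
            using lipG[of y "x + t *\<^sub>R v"] yx by (simp add: algebra_simps)
          also have "\<dots> \<le> L * (t * \<eta>)" using v(2) t L by (intro mult_left_mono) auto
          finally have 2: "\<bar>G y - G (x + t *\<^sub>R v)\<bar> \<le> L * (t * \<eta>)" .
          have "\<bar>a \<bullet> (t *\<^sub>R (v - u))\<bar> \<le> norm a * norm (t *\<^sub>R (v - u))" by (rule Cauchy_Schwarz_ineq2)
          also have "\<dots> \<le> norm a * (t * \<eta>)" using v(2) t by (intro mult_left_mono) (auto simp: norm_minus_commute)
          finally have 3: "\<bar>t * (a \<bullet> v) - a \<bullet> (y - x)\<bar> \<le> norm a * (t * \<eta>)"
            by (simp add: yx inner_diff_right right_diff_distrib)
          have "\<bar>G y - G x - a \<bullet> (y - x)\<bar> \<le> \<eta> * t + L * (t * \<eta>) + norm a * (t * \<eta>)"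
            using 1 2 3 by linarith
          also have "\<dots> = \<eta> * (L + norm a + 1) * t" by (simp add: algebra_simps)
          finally show ?thesis by (simp add: \<eta>(2) t_def)
        qed simp
      qed (rule \<delta>)
    qed
    then show ?case by (auto simp: differentiable_def)
  qed
qed

section \<open>Lipschitz graphs over null sets have Hausdorff measure zero\<close>

text \<open>Vanishing of the Hausdorff measure in terms of explicit coverings, which can be combined for
  countable unions with errors \<open>\<epsilon> / 2\<^bsup>k+1\<^esup>\<close>.\<close>

definition hausdorff_null :: "nat \<Rightarrow> 'a::metric_space set \<Rightarrow> bool" where
  "hausdorff_null m S \<longleftrightarrow> (\<forall>\<delta>>0. \<forall>\<epsilon>>0. \<exists>C. S \<subseteq> (\<Union>i::nat. C i) \<and>
     (\<forall>i. bounded (C i) \<and> diameter (C i) \<le> \<delta>) \<and> (\<Sum>i. ennreal (diameter (C i) ^ m)) \<le> ennreal \<epsilon>)"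

lemma hausdorff_null_imp_measure_0:
  assumes "hausdorff_null m S"
  shows "hausdorff_measure m S = 0"
proof -
  have "(INF C\<in>{C. S \<subseteq> (\<Union>i::nat. C i) \<and> (\<forall>i. bounded (C i) \<and> diameter (C i) \<le> \<delta>)}.
       \<Sum>i. ennreal (diameter (C i) ^ m)) \<le> 0" (is "?I \<le> 0") if "\<delta> > 0" for \<delta> :: real
  proof (rule ennreal_le_epsilon)
    fix \<epsilon> :: real assume "\<epsilon> > 0"
    then obtain C where "S \<subseteq> (\<Union>i::nat. C i)" "\<forall>i. bounded (C i) \<and> diameter (C i) \<le> \<delta>"
      "(\<Sum>i. ennreal (diameter (C i) ^ m)) \<le> ennreal \<epsilon>"
      using assms \<open>\<delta> > 0\<close> unfolding hausdorff_null_def by blast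
    then show "?I \<le> 0 + ennreal \<epsilon>" by (auto intro!: INF_lower2[of C])
  qed
  then show ?thesis unfolding hausdorff_measure_def
    by (intro antisym SUP_least) auto
qed

lemma hausdorff_null_subset: "hausdorff_null m S \<Longrightarrow> T \<subseteq> S \<Longrightarrow> hausdorff_null m T"
  unfolding hausdorff_null_def by (meson order_trans)

lemma hausdorff_null_UN:
  fixes S :: "nat \<Rightarrow> 'a::metric_space set"
  assumes "\<And>k. hausdorff_null m (S k)"
  shows "hausdorff_null m (\<Union>k. S k)"
  unfolding hausdorff_null_def
proof (intro allI impI)
  fix \<delta> \<epsilon> :: real assume "\<delta> > 0" "\<epsilon> > 0"
  have "\<exists>C. S k \<subseteq> (\<Union>i::nat. C i) \<and> (\<forall>i. bounded (C i) \<and> diameter (C i) \<le> \<delta>) \<and>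
      (\<Sum>i. ennreal (diameter (C i) ^ m)) \<le> ennreal (\<epsilon> * (1/2) ^ Suc k)" for k
    using assms[of k] \<open>\<delta> > 0\<close> \<open>\<epsilon> > 0\<close> unfolding hausdorff_null_def by simp
  then obtain C where C: "\<And>k. S k \<subseteq> (\<Union>i::nat. C k i)" "\<And>k i. bounded (C k i) \<and> diameter (C k i) \<le> \<delta>"
      "\<And>k. (\<Sum>i. ennreal (diameter (C k i) ^ m)) \<le> ennreal (\<epsilon> * (1/2) ^ Suc k)"
    by metis
  define C' where "C' n = C (fst (prod_decode n)) (snd (prod_decode n))" for n
  have "(\<Sum>n. ennreal (diameter (C' n) ^ m)) = (\<Sum>k. \<Sum>i. ennreal (diameter (C k i) ^ m))"
    unfolding C'_def
    using suminf_ennreal_2dimen[of "\<lambda>k. \<Sum>i. ennreal (diameter (C k i) ^ m)"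
        "\<lambda>p. ennreal (diameter (C (fst p) (snd p)) ^ m)"] by simp
  also have "\<dots> \<le> (\<Sum>k. ennreal (\<epsilon> * (1/2) ^ Suc k))"
    by (intro suminf_le C(3)) auto
  also have "\<dots> = ennreal \<epsilon>"
  proof -
    have "(\<lambda>k. \<epsilon> * (1/2) ^ Suc k) sums (\<epsilon> * 1)" by (intro sums_mult power_half_series)
    then show ?thesis using \<open>\<epsilon> > 0\<close> by (intro suminf_ennreal_eq) auto
  qed
  finally have "(\<Sum>n. ennreal (diameter (C' n) ^ m)) \<le> ennreal \<epsilon>" .
  moreover have "(\<Union>k. S k) \<subseteq> (\<Union>n. C' n)"
  proof
    fix x assume "x \<in> (\<Union>k. S k)"
    then obtain k i where "x \<in> C k i" using C(1) by blast
    then have "x \<in> C' (prod_encode (k, i))" by (simp add: C'_def)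
    then show "x \<in> (\<Union>n. C' n)" by blast
  qed
  moreover have "bounded (C' n) \<and> diameter (C' n) \<le> \<delta>" for n using C(2) by (simp add: C'_def)
  ultimately show "\<exists>C. (\<Union>k. S k) \<subseteq> (\<Union>i::nat. C i) \<and> (\<forall>i. bounded (C i) \<and> diameter (C i) \<le> \<delta>) \<and>
      (\<Sum>i. ennreal (diameter (C i) ^ m)) \<le> ennreal \<epsilon>" by blast
qed

text \<open>An open set of measure less than \<open>\<eta>\<close> around \<open>T\<close> contains small dyadic cubes that cover \<open>T\<close> and
  do not overlap, so that their volumes add up to at most \<open>\<eta>\<close>. Cubes, rather than general boxes, are
  needed in order to compare the volume with a power of the diameter.\<close>

lemma negligible_cube_cover:
  fixes T :: "'a::euclidean_space set"
  assumes "negligible T" "bounded T" "r > 0" "\<eta> > 0"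
  obtains K :: "nat \<Rightarrow> 'a set" and s :: "nat \<Rightarrow> real" where
    "T \<subseteq> (\<Union>i. K i)" "\<And>i. s i \<ge> 0" "\<And>i. bounded (K i)" "\<And>i. diameter (K i) \<le> 2 * r"
    "\<And>i. diameter (K i) \<le> real DIM('a) * s i" "(\<Sum>i. ennreal (s i ^ DIM('a))) \<le> ennreal \<eta>"
proof -
  obtain R where R: "R > 0" "T \<subseteq> cball 0 R"
    using bounded_subset_ballD[OF \<open>bounded T\<close>, of 0] ball_subset_cball by (meson order_trans)
  \<comment> \<open>Bisecting the cube \<open>cbox a b\<close> gives cubes.\<close>
  define a b :: 'a where "a = (- R) *\<^sub>R One" and "b = R *\<^sub>R One"
  have Tab: "T \<subseteq> cbox a b"
  proof
    fix x assume "x \<in> T"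
    then have "norm x \<le> R" using R(2) by auto
    then show "x \<in> cbox a b"
      using Basis_le_norm[of _ x] by (fastforce simp: mem_box a_def b_def abs_le_iff)
  qed
  have "box a b \<noteq> {}" using R(1) by (auto simp: box_ne_empty a_def b_def)
  have "T \<in> sets lebesgue" using \<open>negligible T\<close> by (simp add: negligible_imp_sets)
  then obtain U where U: "open U" "T \<subseteq> U" "emeasure lebesgue (U - T) < ennreal \<eta>"
    by (rule sets_lebesgue_outer_open[OF _ \<open>\<eta> > 0\<close>]) blast
  have "emeasure lebesgue U \<le> emeasure lebesgue (U - T)"
  proof -
    have "T \<in> null_sets lebesgue" using \<open>negligible T\<close> by (simp add: negligible_iff_null_sets)
    then have "emeasure lebesgue ((U - T) \<union> T) = emeasure lebesgue (U - T)"
      using U(1) by (intro emeasure_Un_null_set) auto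
    moreover have "(U - T) \<union> T = U" using U(2) by blast
    ultimately show ?thesis by simp
  qed
  then have Uless: "emeasure lborel U \<le> ennreal \<eta>" using U by simp
  define \<gamma> where "\<gamma> x = (if x \<in> U then U \<inter> ball x r else ball x r)" for x
  have "gauge \<gamma>" using U(1) \<open>r > 0\<close> by (auto simp: gauge_def \<gamma>_def)
  obtain \<D> where D: "countable \<D>" "\<And>K. K \<in> \<D> \<Longrightarrow> interior K \<noteq> {} \<and> (\<exists>c d. K = cbox c d)"
    "pairwise (\<lambda>A B. interior A \<inter> interior B = {}) \<D>" "\<And>K. K \<in> \<D> \<Longrightarrow> \<exists>x \<in> T \<inter> K. K \<subseteq> \<gamma> x"
    "\<And>u v. cbox u v \<in> \<D> \<Longrightarrow> \<exists>n. \<forall>i \<in> Basis. v \<bullet> i - u \<bullet> i = (b \<bullet> i - a \<bullet> i) / 2^n" "T \<subseteq> \<Union>\<D>"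
    using covering_lemma[OF Tab \<open>box a b \<noteq> {}\<close> \<open>gauge \<gamma>\<close>] by metis
  define cube where "cube K t \<longleftrightarrow> t \<ge> 0 \<and> diameter K \<le> real DIM('a) * t \<and>
      emeasure lborel (interior K) = ennreal (t ^ DIM('a)) \<and> bounded K \<and> diameter K \<le> 2 * r \<and> K \<subseteq> U"
    for K t
  have "\<exists>t. cube K t" if K: "K \<in> \<D>" for K
  proof -
    obtain c d where cd: "K = cbox c d" using D(2)[OF K] by blast
    obtain n where n: "\<And>i. i \<in> Basis \<Longrightarrow> d \<bullet> i - c \<bullet> i = (b \<bullet> i - a \<bullet> i) / 2^n" using D(5) K cd by metis
    define t where "t = 2 * R / 2 ^ n"
    have t: "t \<ge> 0" using R(1) by (simp add: t_def)
    have side: "(d - c) \<bullet> i = t" if "i \<in> Basis" for i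
      using n[OF that] that by (simp add: a_def b_def t_def inner_diff_left)
    have le: "c \<bullet> i \<le> d \<bullet> i" if "i \<in> Basis" for i using side[OF that] t by (simp add: inner_diff_left)
    have "norm (d - c) \<le> (\<Sum>i\<in>Basis. \<bar>(d - c) \<bullet> i\<bar>)" by (rule norm_le_l1)
    also have "\<dots> = real DIM('a) * t" using side t by simp
    finally have "diameter K \<le> real DIM('a) * t"
      using le by (simp add: cd diameter_cbox dist_norm norm_minus_commute)
    moreover have "emeasure lborel (interior K) = ennreal (t ^ DIM('a))"
      using le side by (simp add: cd interior_cbox emeasure_lborel_box)
    moreover have "K \<subseteq> U" "diameter K \<le> 2 * r"
    proof -
      obtain x where x: "x \<in> T" "K \<subseteq> \<gamma> x" using D(4)[OF K] by blast
      then have "x \<in> U" using U(2) by blast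
      with x(2) have KU: "K \<subseteq> U \<inter> ball x r" by (simp add: \<gamma>_def)
      then show "K \<subseteq> U" by blast
      show "diameter K \<le> 2 * r"
      proof (rule diameter_le)
        fix y z assume "y \<in> K" "z \<in> K"
        then have "dist x y < r" "dist x z < r" using KU by auto
        then show "norm (y - z) \<le> 2 * r" using dist_triangle3[of y z x] by (simp add: dist_norm)
      qed (use \<open>r > 0\<close> in simp)
    qed
    ultimately show ?thesis using t cd unfolding cube_def by (intro exI[of _ t]) auto
  qed
  then have "\<forall>K\<in>\<D>. \<exists>t. cube K t" by blast
  from bchoice[OF this] obtain t where "\<forall>K\<in>\<D>. cube K (t K)" ..
  then have t: "\<And>K. K \<in> \<D> \<Longrightarrow> t K \<ge> 0" "\<And>K. K \<in> \<D> \<Longrightarrow> diameter K \<le> real DIM('a) * t K"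
    "\<And>K. K \<in> \<D> \<Longrightarrow> emeasure lborel (interior K) = ennreal (t K ^ DIM('a))"
    "\<And>K. K \<in> \<D> \<Longrightarrow> bounded K" "\<And>K. K \<in> \<D> \<Longrightarrow> diameter K \<le> 2 * r" "\<And>K. K \<in> \<D> \<Longrightarrow> K \<subseteq> U"
    unfolding cube_def by simp_all
  define J where "J = to_nat_on \<D> ` \<D>"
  define K where "K i = (if i \<in> J then from_nat_into \<D> i else {})" for i
  define s where "s i = (if i \<in> J then t (from_nat_into \<D> i) else 0)" for i
  have KD: "from_nat_into \<D> i \<in> \<D>" if "i \<in> J" for i
    using that D(1) by (auto simp: J_def)
  show ?thesis
  proof (rule that[of K s])
    show "T \<subseteq> (\<Union>i. K i)"
    proof
      fix x assume "x \<in> T"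
      then obtain A where A: "A \<in> \<D>" "x \<in> A" using D(6) by blast
      then have "K (to_nat_on \<D> A) = A" using D(1) by (simp add: K_def J_def)
      then show "x \<in> (\<Union>i. K i)" using A(2) by blast
    qed
    show "s i \<ge> 0" "bounded (K i)" "diameter (K i) \<le> 2 * r" "diameter (K i) \<le> real DIM('a) * s i" for i
      using t KD \<open>r > 0\<close> by (auto simp: s_def K_def)
    have "disjoint_family (\<lambda>i. interior (K i))"
      unfolding disjoint_family_on_def
    proof (intro ballI impI)
      fix i j :: nat assume "i \<noteq> j"
      show "interior (K i) \<inter> interior (K j) = {}"
      proof (cases "i \<in> J \<and> j \<in> J")
        case True
        then obtain A B where "A \<in> \<D>" "B \<in> \<D>" "i = to_nat_on \<D> A" "j = to_nat_on \<D> B" by (auto simp: J_def)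
        then show ?thesis using D(1,3) \<open>i \<noteq> j\<close> True by (auto simp: K_def pairwise_def)
      qed (auto simp: K_def)
    qed
    then have "(\<Sum>i. emeasure lborel (interior (K i))) = emeasure lborel (\<Union>i. interior (K i))"
      by (intro suminf_emeasure) auto
    also have "\<dots> \<le> emeasure lborel U"
    proof (rule emeasure_mono)
      show "(\<Union>i. interior (K i)) \<subseteq> U"
        using t(6) KD interior_subset by (fastforce simp: K_def split: if_splits)
    qed (use U in auto)
    also note Uless
    also have "(\<lambda>i. emeasure lborel (interior (K i))) = (\<lambda>i. ennreal (s i ^ DIM('a)))"
      using t(3) KD by (auto simp: K_def s_def)
    finally show "(\<Sum>i. ennreal (s i ^ DIM('a))) \<le> ennreal \<eta>" .
  qed
qed

text \<open>A null cylinder \<open>N\<close> with axis \<open>e\<close> has the same image under \<open>P\<close> as each of its sections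
  \<open>{x \<in> N. x \<bullet> e = \<sigma>}\<close>. Cover a slab of \<open>N\<close> by cubes of side \<open>s\<^sub>i\<close> with \<open>\<Sum> s\<^sub>i\<^sup>d\<close> small. A cube meets the
  section at height \<open>\<sigma>\<close> only for \<open>\<sigma>\<close> in an interval of length comparable to \<open>s\<^sub>i\<close>; averaging over
  \<open>\<sigma> \<in> [0, 1]\<close> gives a section for which the sum of \<open>s\<^sub>i\<^bsup>d-1\<^esup>\<close> over the cubes that meet it is small.\<close>

lemma cylinder_image_hausdorff_null_bounded:
  fixes N :: "'a::euclidean_space set" and P :: "'a \<Rightarrow> 'b::euclidean_space"
  assumes dim: "DIM('a) = Suc m" "m > 0" and "negligible N" and e: "norm e = 1"
    and bnd: "bounded {x \<in> N. 0 \<le> x \<bullet> e \<and> x \<bullet> e \<le> 1}"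
    and N: "\<And>x t. x \<in> N \<Longrightarrow> x + t *\<^sub>R e \<in> N"
    and P: "L-lipschitz_on UNIV P" "\<And>x t. P (x + t *\<^sub>R e) = P x"
  shows "hausdorff_null m (P ` N)"
  unfolding hausdorff_null_def
proof (intro allI impI)
  fix \<delta> \<epsilon> :: real assume pos: "\<delta> > 0" "\<epsilon> > 0"
  have L: "L \<ge> 0" using lipschitz_on_nonneg[OF P(1)] .
  define d where "d = real DIM('a)"
  have d: "d \<ge> 0" by (simp add: d_def)
  \<comment> \<open>\<open>A s\<^sup>d\<close> is the contribution of a cube of side \<open>s\<close> to the integral over \<open>\<sigma>\<close>: an interval of length
    \<open>2 d s\<close> times the power \<open>m\<close> of the bound \<open>L d s\<close> on the diameter of its image.\<close>
  define A where "A = 2 * d * (L * d) ^ m"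
  have A: "A \<ge> 0" using L d by (simp add: A_def)
  define \<eta> where "\<eta> = \<epsilon> / (A + 1)"
  have \<eta>: "\<eta> > 0" "A * \<eta> < \<epsilon>" using pos A by (auto simp: \<eta>_def field_simps)
  define r where "r = \<delta> / (2 * (L + 1))"
  have r: "r > 0" "L * (2 * r) \<le> \<delta>" using pos L by (auto simp: r_def field_simps)
  let ?T = "{x \<in> N. 0 \<le> x \<bullet> e \<and> x \<bullet> e \<le> 1}"
  have negT: "negligible ?T" using \<open>negligible N\<close> by (rule negligible_subset) auto
  obtain K :: "nat \<Rightarrow> 'a set" and s :: "nat \<Rightarrow> real" where
    K: "?T \<subseteq> (\<Union>i. K i)" "\<And>i. s i \<ge> 0" "\<And>i. bounded (K i)" "\<And>i. diameter (K i) \<le> 2 * r"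
    "\<And>i. diameter (K i) \<le> d * s i" "(\<Sum>i. ennreal (s i ^ DIM('a))) \<le> ennreal \<eta>"
    by (rule negligible_cube_cover[OF negT bnd r(1) \<eta>(1), folded d_def]) blast
  define c where "c i = (SOME x. x \<in> K i) \<bullet> e" for i
  define I where "I i = {c i - d * s i..c i + d * s i}" for i
  define h where "h \<sigma> = (\<Sum>i. ennreal ((L * d * s i) ^ m) * indicator (I i) \<sigma>)" for \<sigma> :: real
  have "(\<integral>\<^sup>+\<sigma>. h \<sigma> \<partial>lborel) = (\<Sum>i. \<integral>\<^sup>+\<sigma>. ennreal ((L * d * s i) ^ m) * indicator (I i) \<sigma> \<partial>lborel)"
    unfolding h_def by (rule nn_integral_suminf) (simp add: I_def)
  also have "\<dots> = (\<Sum>i. ennreal A * ennreal (s i ^ DIM('a)))"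
  proof (rule suminf_cong)
    fix i
    have "(\<integral>\<^sup>+\<sigma>. ennreal ((L * d * s i) ^ m) * indicator (I i) \<sigma> \<partial>lborel) = ennreal ((L * d * s i) ^ m) * emeasure lborel (I i)"
      by (rule nn_integral_cmult_indicator) (simp add: I_def)
    also have "emeasure lborel (I i) = ennreal (2 * (d * s i))"
      using K(2)[of i] d by (simp add: I_def)
    also have "ennreal ((L * d * s i) ^ m) * ennreal (2 * (d * s i)) = ennreal ((L * d * s i) ^ m * (2 * (d * s i)))"
      using K(2)[of i] d L by (simp add: ennreal_mult)
    also have "(L * d * s i) ^ m * (2 * (d * s i)) = A * s i ^ DIM('a)"
      by (simp add: A_def dim(1) power_mult_distrib)
    also have "ennreal (A * s i ^ DIM('a)) = ennreal A * ennreal (s i ^ DIM('a))"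
      using A K(2)[of i] by (simp add: ennreal_mult)
    finally show "(\<integral>\<^sup>+\<sigma>. ennreal ((L * d * s i) ^ m) * indicator (I i) \<sigma> \<partial>lborel) = ennreal A * ennreal (s i ^ DIM('a))" .
  qed
  also have "\<dots> = ennreal A * (\<Sum>i. ennreal (s i ^ DIM('a)))" by (rule ennreal_suminf_cmult)
  also have "\<dots> \<le> ennreal A * ennreal \<eta>" by (rule mult_left_mono[OF K(6)]) simp
  also have "\<dots> < ennreal \<epsilon>" using \<eta> A pos by (simp add: ennreal_less_iff flip: ennreal_mult)
  finally have int: "(\<integral>\<^sup>+\<sigma>. h \<sigma> \<partial>lborel) < ennreal \<epsilon>" .
  have "\<exists>\<sigma>\<in>{0..1}. h \<sigma> \<le> ennreal \<epsilon>"
  proof (rule ccontr)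
    assume "\<not> ?thesis"
    then have "ennreal \<epsilon> * indicator {0..1} \<sigma> \<le> h \<sigma>" for \<sigma>
      by (cases "\<sigma> \<in> {0..1}") (auto simp: not_le less_imp_le)
    then have "(\<integral>\<^sup>+\<sigma>. ennreal \<epsilon> * indicator {0..1::real} \<sigma> \<partial>lborel) \<le> (\<integral>\<^sup>+\<sigma>. h \<sigma> \<partial>lborel)"
      by (intro nn_integral_mono) auto
    then show False using int by (simp add: nn_integral_cmult_indicator)
  qed
  then obtain \<sigma> where \<sigma>: "0 \<le> \<sigma>" "\<sigma> \<le> 1" "h \<sigma> \<le> ennreal \<epsilon>" by auto
  define C where "C i = P ` (K i \<inter> {x. x \<bullet> e = \<sigma>})" for i
  have diam: "diameter (C i) \<le> L * D" if "diameter (K i) \<le> D" "D \<ge> 0" for i D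
  proof (rule diameter_le)
    show "C i \<noteq> {} \<or> 0 \<le> L * D" using L that by auto
    fix y z assume "y \<in> C i" "z \<in> C i"
    then obtain y' z' where yz: "y = P y'" "z = P z'" "y' \<in> K i" "z' \<in> K i" by (auto simp: C_def)
    have "norm (y - z) \<le> L * dist y' z'" using lipschitz_onD[OF P(1), of y' z'] yz by (simp add: dist_norm)
    also have "\<dots> \<le> L * D"
      using diameter_bounded_bound[OF K(3) yz(3,4)] that L by (intro mult_left_mono) auto
    finally show "norm (y - z) \<le> L * D" .
  qed
  have "P ` N \<subseteq> (\<Union>i. C i)"
  proof
    fix y assume "y \<in> P ` N"
    then obtain x where x: "x \<in> N" "y = P x" by blast
    let ?x = "x + (\<sigma> - x \<bullet> e) *\<^sub>R e"
    have "e \<bullet> e = 1" using e by (simp add: dot_square_norm)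
    then have "?x \<bullet> e = \<sigma>" by (simp add: inner_add_left)
    moreover have "?x \<in> N" by (rule N[OF x(1)])
    ultimately have "?x \<in> (\<Union>i. K i)" using K(1) \<sigma> by auto
    then obtain i where "?x \<in> K i" by blast
    then have "P ?x \<in> C i" unfolding C_def using \<open>?x \<bullet> e = \<sigma>\<close> by blast
    then show "y \<in> (\<Union>i. C i)" using P(2) x(2) by auto
  qed
  moreover have "bounded (C i) \<and> diameter (C i) \<le> \<delta>" for i
  proof
    show "bounded (C i)" unfolding C_def
      by (intro bounded_uniformly_continuous_image bounded_Int disjI1 K(3)
          lipschitz_on_uniformly_continuous[OF lipschitz_on_subset[OF P(1)]]) auto
    have "diameter (C i) \<le> L * (2 * r)" using r(1) by (intro diam K(4)) simp
    then show "diameter (C i) \<le> \<delta>" using r(2) by (rule order_trans)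
  qed
  moreover have "(\<Sum>i. ennreal (diameter (C i) ^ m)) \<le> ennreal \<epsilon>"
  proof -
    have "ennreal (diameter (C i) ^ m) \<le> ennreal ((L * d * s i) ^ m) * indicator (I i) \<sigma>" for i
    proof (cases "K i \<inter> {x. x \<bullet> e = \<sigma>} = {}")
      case True
      then have "C i = {}" by (simp add: C_def)
      then show ?thesis using \<open>m > 0\<close> by (simp add: power_0_left)
    next
      case False
      then obtain x where x: "x \<in> K i" "x \<bullet> e = \<sigma>" by blast
      then have "(SOME x. x \<in> K i) \<in> K i" by (metis someI)
      from diameter_bounded_bound[OF K(3) x(1) this] have "norm (x - (SOME x. x \<in> K i)) \<le> d * s i"
        using K(5)[of i] by (simp add: dist_norm)
      then have "\<bar>(x - (SOME x. x \<in> K i)) \<bullet> e\<bar> \<le> d * s i"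
        using Cauchy_Schwarz_ineq2[of "x - (SOME x. x \<in> K i)" e] e by simp
      then have "\<sigma> \<in> I i" using x(2) by (simp add: I_def c_def inner_diff_left abs_le_iff)
      moreover have "diameter (C i) \<le> L * (d * s i)" using d K(2)[of i] by (intro diam K(5)) simp
      then have "diameter (C i) ^ m \<le> (L * d * s i) ^ m"
        by (intro power_mono) (auto simp: mult.assoc diameter_ge_0 C_def
            intro!: diameter_ge_0 bounded_uniformly_continuous_image bounded_Int disjI1 K(3)
            lipschitz_on_uniformly_continuous[OF lipschitz_on_subset[OF P(1)]])
      ultimately show ?thesis by (simp add: ennreal_leI)
    qed
    then have "(\<Sum>i. ennreal (diameter (C i) ^ m)) \<le> h \<sigma>"
      unfolding h_def by (intro suminf_le) auto
    then show ?thesis using \<sigma>(3) by (rule order_trans)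
  qed
  ultimately show "\<exists>C. P ` N \<subseteq> (\<Union>i::nat. C i) \<and> (\<forall>i. bounded (C i) \<and> diameter (C i) \<le> \<delta>) \<and>
     (\<Sum>i. ennreal (diameter (C i) ^ m)) \<le> ennreal \<epsilon>" by blast
qed

text \<open>The cylinder is exhausted by cylinders over bounded bases, each of which has bounded slabs.\<close>

proposition cylinder_image_hausdorff_null:
  fixes N :: "'a::euclidean_space set" and P :: "'a \<Rightarrow> 'b::euclidean_space"
  assumes dim: "DIM('a) = Suc m" "m > 0" and "negligible N" and e: "norm e = 1"
    and N: "\<And>x t. x \<in> N \<Longrightarrow> x + t *\<^sub>R e \<in> N"
    and P: "L-lipschitz_on UNIV P" "\<And>x t. P (x + t *\<^sub>R e) = P x"
  shows "hausdorff_null m (P ` N)"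
proof -
  define Nk where "Nk k = {x \<in> N. norm (x - (x \<bullet> e) *\<^sub>R e) \<le> real k}" for k
  have ee: "e \<bullet> e = 1" using e by (simp add: dot_square_norm)
  have "hausdorff_null m (P ` Nk k)" for k
  proof (rule cylinder_image_hausdorff_null_bounded[OF dim _ e _ _ P])
    show "negligible (Nk k)" using \<open>negligible N\<close> by (rule negligible_subset) (auto simp: Nk_def)
    show "x + t *\<^sub>R e \<in> Nk k" if "x \<in> Nk k" for x t
      using that N by (auto simp: Nk_def inner_add_left ee algebra_simps)
    show "bounded {x \<in> Nk k. 0 \<le> x \<bullet> e \<and> x \<bullet> e \<le> 1}"
    proof (rule boundedI)
      fix x assume "x \<in> {x \<in> Nk k. 0 \<le> x \<bullet> e \<and> x \<bullet> e \<le> 1}"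
      then have "norm (x - (x \<bullet> e) *\<^sub>R e) \<le> real k" "norm ((x \<bullet> e) *\<^sub>R e) \<le> 1" using e by (auto simp: Nk_def)
      then show "norm x \<le> real k + 1"
        using norm_triangle_ineq[of "x - (x \<bullet> e) *\<^sub>R e" "(x \<bullet> e) *\<^sub>R e"] by simp
    qed
  qed
  then have "hausdorff_null m (\<Union>k. P ` Nk k)" by (rule hausdorff_null_UN)
  moreover have "P ` N \<subseteq> (\<Union>k. P ` Nk k)"
  proof
    fix y assume "y \<in> P ` N"
    then obtain x where "x \<in> N" "y = P x" by blast
    moreover obtain k :: nat where "norm (x - (x \<bullet> e) *\<^sub>R e) \<le> real k" using real_arch_simple by blast
    ultimately have "y \<in> P ` Nk k" by (auto simp: Nk_def)
    then show "y \<in> (\<Union>k. P ` Nk k)" by blast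
  qed
  ultimately show ?thesis by (rule hausdorff_null_subset)
qed

section \<open>The structure of two-valued entropy solutions\<close>

context cone_separated_graph
begin

text \<open>The function \<open>\<Phi>\<close> is differentiable at \<open>x\<close> if and only if it is at \<open>x + t e\<close>, so the exceptional
  set is a cylinder; the projection \<open>x \<mapsto> x + \<Phi>(x) e\<close> onto \<open>\<Gamma>\<close> fixes the points of \<open>\<Gamma>\<close>.\<close>

lemma nondifferentiable_points_hausdorff_null:
  assumes dim: "DIM('a) = Suc m" "m > 0"
  shows "hausdorff_null m {p \<in> \<Gamma>. \<not> \<Phi> differentiable (at p)}"
proof -
  obtain L where L: "L-lipschitz_on UNIV \<Phi>" using \<Phi>_lipschitz by blast
  define N where "N = {x. \<not> \<Phi> differentiable (at x)}"
  define P where "P x = x + \<Phi> x *\<^sub>R e" for x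
  have "negligible N"
  proof -
    obtain N' where "{x. \<not> \<Phi> differentiable (at x)} \<subseteq> N'" "N' \<in> null_sets lborel"
      using Rademacher[OF L] by (auto simp: eventually_ae_filter)
    then show ?thesis
      using negligible_subset[of N' N] null_sets_completionI by (auto simp: N_def negligible_iff_null_sets)
  qed
  have "x + t *\<^sub>R e \<in> N" if "x \<in> N" for x t
  proof (rule ccontr)
    assume "x + t *\<^sub>R e \<notin> N"
    then obtain D where "(\<Phi> has_derivative D) (at (x + t *\<^sub>R e))" by (auto simp: N_def differentiable_def)
    moreover have "((\<lambda>y. y + t *\<^sub>R e) has_derivative (\<lambda>h. h)) (at x)" by (auto intro!: derivative_eq_intros)
    ultimately have "((\<lambda>y. \<Phi> (y + t *\<^sub>R e)) has_derivative D) (at x)"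
      using has_derivative_compose by blast
    then have "((\<lambda>y. \<Phi> (y + t *\<^sub>R e) + t) has_derivative D) (at x)"
      by (auto intro!: derivative_eq_intros)
    then have "(\<Phi> has_derivative D) (at x)" by (simp add: \<Phi>_shift)
    then show False using that by (auto simp: N_def differentiable_def)
  qed
  moreover have "(1 + L * 1)-lipschitz_on UNIV P"
  proof (rule lipschitz_onI)
    fix x y :: 'a
    have "dist (P x) (P y) \<le> norm (x - y) + norm ((\<Phi> x - \<Phi> y) *\<^sub>R e)"
      using norm_triangle_ineq[of "x - y" "(\<Phi> x - \<Phi> y) *\<^sub>R e"] by (simp add: P_def dist_norm algebra_simps)
    then show "dist (P x) (P y) \<le> (1 + L * 1) * dist x y"
      using lipschitz_onD[OF L, of x y] by (simp add: dist_norm norm_e distrib_right)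
  qed (use lipschitz_on_nonneg[OF L] in simp)
  moreover have "P (x + t *\<^sub>R e) = P x" for x t by (simp add: P_def \<Phi>_shift algebra_simps)
  ultimately have "hausdorff_null m (P ` N)"
    using cylinder_image_hausdorff_null[OF dim \<open>negligible N\<close> norm_e] by blast
  moreover have "{p \<in> \<Gamma>. \<not> \<Phi> differentiable (at p)} \<subseteq> P ` N"
  proof
    fix p assume "p \<in> {p \<in> \<Gamma>. \<not> \<Phi> differentiable (at p)}"
    then have "p \<in> N" "p = P p" using \<Gamma>_iff[of p] by (auto simp: N_def P_def)
    then show "p \<in> P ` N" by blast
  qed
  ultimately show ?thesis by (rule hausdorff_null_subset)
qed

end

theorem theorem2p1:
  fixes f :: "real \<Rightarrow> real ^ 'd"
    and um up :: real
    and u :: "real \<times> (real ^ 'd) \<Rightarrow> real"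
  assumes "CARD('d) \<ge> 2"
    and "smooth f"
    and "nondegenerate f"
    and "up < um"
    and "admissible_cone f um up \<noteq> {0}"
    and "entropy_solution f u"
    and "AE z in lebesgue_on half_space_time. u z \<in> {um, up}"
  shows "\<exists>u0 :: real ^ 'd \<Rightarrow> real.
    (\<forall>x. u0 x \<in> {um, up}) \<and>
    (AE z in lebesgue_on half_space_time. u z = u0 (snd z - fst z *\<^sub>R shock_velocity f um up)) \<and>
    ((AE x in lebesgue. u0 x = um) \<or>
     (AE x in lebesgue. u0 x = up) \<or>
     (\<exists>\<Gamma> Dm Dp.
        lipschitz_hypersurface \<Gamma> \<and> complete \<Gamma> \<and>
        separates_into \<Gamma> Dm Dp \<and>
        (AE x in lebesgue. (x \<in> Dm \<longrightarrow> u0 x = um) \<and> (x \<in> Dp \<longrightarrow> u0 x = up)) \<and>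
        hausdorff_measure (CARD('d) - 1)
          {p \<in> \<Gamma>. \<not> (\<exists>n \<in> admissible_cone f um up. oriented_normal Dm Dp p n)} = 0 \<and>
        lipschitz_graph_in_linear_coordinates \<Gamma> \<and>
        (\<forall>W \<in> interior (dual_cone (admissible_cone f um up)).
           mono (\<lambda>s::real. (\<lambda>x. x + s *\<^sub>R W) ` Dm) \<and>
           (\<Inter>s::real. (\<lambda>x. x + s *\<^sub>R W) ` Dm) = {} \<and>
           (\<Union>s::real. (\<lambda>x. x + s *\<^sub>R W) ` Dm) = UNIV)))"
proof -
  let ?v = "shock_velocity f um up"
  obtain E0 where E0: "E0 \<in> sets borel"
    and uE0: "AE z in lebesgue_on half_space_time. u z = (if snd z - fst z *\<^sub>R ?v \<in> E0 then um else up)"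
    and drops: "\<And>k s. up < k \<Longrightarrow> k < um \<Longrightarrow> s \<ge> 0 \<Longrightarrow>
       AE x in lborel. x + s *\<^sub>R (moving_flux f um up up - moving_flux f um up k) \<in> E0 \<longrightarrow> x \<in> E0"
    by (rule two_state_entropy_solution_profile[OF assms(6,4,7)]) blast
  define u0 where "u0 x = (if x \<in> E0 then um else up)" for x
  define C where "C = convex_cone hull flux_drops f um up"
  define K where "K = interior C"
  define Dm where "Dm = essential_interior E0"
  define Dp where "Dp = essential_interior (- E0)"
  have mono: "AE x in lborel. x + n \<in> E0 \<longrightarrow> x \<in> E0" if "n \<in> C" for n
    using that unfolding C_def
    by (rule convex_cone_hull_AE_decreasing[rotated]) (auto simp: flux_drops_def intro: drops)
  interpret sep: cone_separated_sets Dm Dp K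
    unfolding Dm_def Dp_def K_def C_def
    by (rule cone_monotone_set_separates[OF E0]) (use mono C_def in simp)
  have u0_Dm: "AE x in lborel. x \<in> Dm \<longrightarrow> u0 x = um"
    using AE_essential_interior[of E0] by eventually_elim (simp add: Dm_def u0_def)
  have u0_Dp: "AE x in lborel. x \<in> Dp \<longrightarrow> u0 x = up"
    using AE_essential_interior[of "- E0"] by eventually_elim (simp add: Dp_def u0_def)
  have K_nonempty: "K \<noteq> {}"
    unfolding K_def C_def by (rule interior_flux_drops_hull_nonempty[OF assms(2,3,4)])
  have u0: "\<forall>x. u0 x \<in> {um, up}"
    "AE z in lebesgue_on half_space_time. u z = u0 (snd z - fst z *\<^sub>R ?v)"
    using uE0 by (simp_all add: u0_def)
  show ?thesis
  proof (cases "sep.\<Gamma> = {}")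
    case True
    then have "Dm \<union> Dp = UNIV" by blast
    then have "Dm = {} \<or> Dp = {}"
      using connectedD[OF connected_UNIV sep.open_Dm sep.open_Dp] sep.disjoint by auto
    with \<open>Dm \<union> Dp = UNIV\<close> consider "Dp = UNIV" | "Dm = UNIV" by blast
    then show ?thesis
    proof cases
      case 1
      then have "AE x in lebesgue. u0 x = up" using AE_completion[OF u0_Dp] by simp
      with u0 show ?thesis by blast
    next
      case 2
      then have "AE x in lebesgue. u0 x = um" using AE_completion[OF u0_Dm] by simp
      with u0 show ?thesis by blast
    qed
  next
    case False
    have "K \<noteq> {0}" using sep.open_K not_open_singleton by metis
    then obtain n where n: "n \<in> K" "n \<noteq> 0" using K_nonempty by blast
    define e where "e = n /\<^sub>R norm n"
    interpret graph: cone_separated_graph Dm Dp K e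
      by unfold_locales (use n False in \<open>auto simp: e_def intro: sep.K_scale\<close>)
    let ?\<Gamma> = "sep.\<Gamma>" and ?\<Phi> = graph.\<Phi>
    obtain L where L: "L-lipschitz_on UNIV ?\<Phi>" using graph.\<Phi>_lipschitz by blast
    have ee: "e \<bullet> e = 1" using graph.norm_e by (simp add: dot_square_norm)
    have graph_eq: "?\<Gamma> = graph_over e e ?\<Phi>"
    proof (intro set_eqI iffI)
      fix x assume "x \<in> ?\<Gamma>"
      then have "?\<Phi> x = 0" using graph.\<Gamma>_iff by blast
      then have "?\<Phi> (x + (- (x \<bullet> e)) *\<^sub>R e) = x \<bullet> e" by (simp only: graph.\<Phi>_shift)
      then show "x \<in> graph_over e e ?\<Phi>" unfolding graph_over_def
        by (intro CollectI exI[of _ "x + (- (x \<bullet> e)) *\<^sub>R e"]) (auto simp: inner_diff_right ee inner_commute)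
    next
      fix x assume "x \<in> graph_over e e ?\<Phi>"
      then show "x \<in> ?\<Gamma>" using graph.\<Phi>_in by (auto simp: graph_over_def)
    qed
    have lip_e: "L-lipschitz_on {y. e \<bullet> y = 0} ?\<Phi>" by (rule lipschitz_on_subset[OF L]) simp
    have "lipschitz_hypersurface ?\<Gamma>"
      unfolding lipschitz_hypersurface_def
      using graph.norm_e lip_e graph_eq by (intro ballI exI[of _ e] exI[of _ ?\<Phi>] exI[of _ L] exI[of _ UNIV]) simp
    moreover have "complete ?\<Gamma>" using graph.closed_\<Gamma> by (simp only: complete_eq_closed)
    moreover have "separates_into ?\<Gamma> Dm Dp"
      unfolding separates_into_def
      using graph.components_complement_\<Gamma> graph.frontier_Dm graph.frontier_Dp graph.nonempty_Dm sep.disjoint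
      by blast
    moreover have "AE x in lebesgue. (x \<in> Dm \<longrightarrow> u0 x = um) \<and> (x \<in> Dp \<longrightarrow> u0 x = up)"
      using AE_completion[OF u0_Dm] AE_completion[OF u0_Dp] by eventually_elim simp
    moreover have "hausdorff_measure (CARD('d) - 1)
          {p \<in> ?\<Gamma>. \<not> (\<exists>n \<in> admissible_cone f um up. oriented_normal Dm Dp p n)} = 0"
    proof (rule hausdorff_null_imp_measure_0, rule hausdorff_null_subset)
      show "hausdorff_null (CARD('d) - 1) {p \<in> ?\<Gamma>. \<not> ?\<Phi> differentiable (at p)}"
        using assms(1) by (intro graph.nondifferentiable_points_hausdorff_null) auto
      have drops_K: "flux_drops f um up \<subseteq> closure K"
      proof -
        have "closure K = closure C"
          unfolding K_def C_def
          by (rule convex_closure_interior[OF convex_convex_cone_hull])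
            (use K_nonempty in \<open>simp add: K_def C_def\<close>)
        then show ?thesis
          using hull_subset[of "flux_drops f um up" convex_cone] closure_subset[of C] by (auto simp: C_def)
      qed
      show "{p \<in> ?\<Gamma>. \<not> (\<exists>n \<in> admissible_cone f um up. oriented_normal Dm Dp p n)}
          \<subseteq> {p \<in> ?\<Gamma>. \<not> ?\<Phi> differentiable (at p)}"
      proof
        fix p assume p: "p \<in> {p \<in> ?\<Gamma>. \<not> (\<exists>n \<in> admissible_cone f um up. oriented_normal Dm Dp p n)}"
        have "\<not> ?\<Phi> differentiable (at p)"
        proof
          assume "?\<Phi> differentiable (at p)"
          then obtain D where D: "(?\<Phi> has_derivative D) (at p)" by (auto simp: differentiable_def)
          have "p \<in> ?\<Gamma>" using p by blast
          from graph.derivative_gives_normal[OF this D] obtain n where n: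
            "norm n = 1" "\<And>w. w \<in> closure K \<Longrightarrow> 0 \<le> n \<bullet> w"
            "\<And>\<epsilon>. \<epsilon> > 0 \<Longrightarrow> \<exists>\<delta>>0. \<forall>x\<in>ball p \<delta>.
              (n \<bullet> (x - p) > \<epsilon> * norm (x - p) \<longrightarrow> x \<in> Dp) \<and> (n \<bullet> (x - p) < - \<epsilon> * norm (x - p) \<longrightarrow> x \<in> Dm)"
            by blast
          have "n \<in> admissible_cone f um up" using n(2) drops_K by (auto simp: admissible_cone_iff)
          moreover have "oriented_normal Dm Dp p n" using n(1,3) by (simp add: oriented_normal_def)
          ultimately show False using p by blast
        qed
        then show "p \<in> {p \<in> ?\<Gamma>. \<not> ?\<Phi> differentiable (at p)}" using p by blast
      qed
    qed
    moreover have "lipschitz_graph_in_linear_coordinates ?\<Gamma>"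
      unfolding lipschitz_graph_in_linear_coordinates_def
      using lip_e graph_eq ee by (intro exI[of _ e] exI[of _ ?\<Phi>] exI[of _ L]) simp
    moreover have "\<forall>W \<in> interior (dual_cone (admissible_cone f um up)).
           mono (\<lambda>s::real. (\<lambda>x. x + s *\<^sub>R W) ` Dm) \<and>
           (\<Inter>s::real. (\<lambda>x. x + s *\<^sub>R W) ` Dm) = {} \<and>
           (\<Union>s::real. (\<lambda>x. x + s *\<^sub>R W) ` Dm) = UNIV"
    proof
      fix W assume "W \<in> interior (dual_cone (admissible_cone f um up))"
      then have "W \<in> K" using interior_dual_cone_subset by (auto simp: K_def C_def)
      obtain p where "p \<in> ?\<Gamma>" using False by blast
      show "mono (\<lambda>s::real. (\<lambda>x. x + s *\<^sub>R W) ` Dm) \<and>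
           (\<Inter>s::real. (\<lambda>x. x + s *\<^sub>R W) ` Dm) = {} \<and>
           (\<Union>s::real. (\<lambda>x. x + s *\<^sub>R W) ` Dm) = UNIV"
        using sep.Dm_translates_mono[OF \<open>W \<in> K\<close>] sep.Dm_translates_Inter_Union[OF \<open>W \<in> K\<close> \<open>p \<in> ?\<Gamma>\<close>]
        by blast
    qed
    ultimately show ?thesis using u0 by blast
  qed
qed

end
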